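(* Let $(H,\langle\cdot,\cdot\rangle_H,\|\cdot\|_H)$ be a separable $\mathbb{R}$-Hilbert space, let $\mathbb{H}\subseteq H$ be a nonempty orthonormal basis of $H$, let $\eta,\kappa\in[0,\infty)$, let $\lambda\colon\mathbb{H}\to\mathbb{R}$ satisfy $\inf_{b\in\mathbb{H}}\lambda_b>-\min\{\eta,\kappa\}$, let $A\colon D(A)\subseteq H\to H$ be the linear operator with $D(A)=\{v\in H\colon\sum_{b\in\mathbb{H}}|\lambda_b\langle b,v\rangle_H|^2<\infty\}$ and $Av=\sum_{b\in\mathbb{H}}-\lambda_b\langle b,v\rangle_H b$ for all $v\in D(A)$, and let $(H_r,\langle\cdot,\cdot\rangle_{H_r},\|\cdot\|_{H_r})$, $r\in\mathbb{R}$, be a family of interpolation spaces associated to $\kappa-A$. Let $T,\vartheta,c\in(0,\infty)$, $\theta,\epsilon\in[0,\infty)$, $\alpha\in[0,\frac12]$, $\varphi\in[0,1)$, $\gamma\in(0,1)$, $\rho\in[-\alpha,1-\max\{\alpha,\gamma\})$, $\varrho\in(\rho,1-\max\{\alpha,\gamma\})$, $\chi\in\big(0,\min\{\frac{\varrho-\rho}{1+\vartheta},\frac{1-\alpha-\rho}{1+2\vartheta}\}\big]$, and let $F\in C(H_\varrho,H_{-\alpha})$. Let $(P_n)_{n\in\mathbb{N}}\subseteq L(H)$ and let $\mathbb{H}_n\subseteq\mathbb{H}$, $n\in\mathbb{N}$, be finite sets such that $P_n(u)=\sum_{b\in\mathbb{H}_n}\langle b,u\rangle_H b$ for all $n\in\mathbb{N}$,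 $u\in H$, and $\liminf_{m\to\infty}\inf(\{\lambda_b\colon b\in\mathbb{H}\setminus\mathbb{H}_m\}\cup\{\infty\})=\infty$. Let $\phi,\Phi\colon H_1\to[0,\infty)$ be functions such that for all $n\in\mathbb{N}$, $v,w\in P_n(H)$ it holds that $F(v)\in H$, $$\|F(v)\|_{H_{-\gamma}}\le c\,(2\epsilon+\|v\|_H^2),$$ $$\langle v,P_nF(v+w)\rangle_H\le\phi(w)\|v\|_H^2+\varphi\|(\eta-A)^{1/2}v\|_H^2+\Phi(w),$$ $$\|F(v)-F(w)\|_{H_{-\alpha}}\le\theta\,(1+\|v\|_{H_\rho}^\vartheta+\|w\|_{H_\rho}^\vartheta)\,\|v-w\|_{H_\rho}.$$ Let $(h_n)_{n\in\mathbb{N}}\subseteq(0,T]$ satisfy $\limsup_{m\to\infty}h_m=0$. Let $(\Omega,\mathcal{F},\mathbb{P})$ be a probability space, let $\mathcal{X}^n\colon[0,T]\times\Omega\to H_\varrho$, $n\in\mathbb{N}$, be stochastic processes, let $\mathcal{O}^n\colon[0,T]\times\Omega\to H_\varrho$, $n\in\mathbb{N}$, and $O\colon[0,T]\times\Omega\to H_\varrho$ be stochastic processes with continuous sample paths, and let $\mathbb{X}^n,\mathbb{O}^n\colon[0,T]\times\Omega\to H_\varrho$, $n\in\mathbb{N}$, be functions such that for all $n\in\mathbb{N}$, $t\in[0,T]$ it holds that $$\mathbb{X}^n_t=\int_0^tP_n\,e^{(t-s)A}\,\mathbf{1}_{\{\|\mathcal{X}^n_{\lfloor s\rfloor_{h_n}}\|_{H_\varrho}+\|\mathcal{O}^n_{\lfloor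 s\rfloor_{h_n}}\|_{H_\varrho}\le|h_n|^{-\chi}\}}\,F\big(\mathcal{X}^n_{\lfloor s\rfloor_{h_n}}\big)\,ds+\mathcal{O}^n_t,$$ $\mathcal{O}^n([0,T]\times\Omega)\subseteq P_n(H)$, $\mathbb{O}^n_t=\mathcal{O}^n_t-\int_0^te^{(t-s)(A-\eta)}\,\eta\,\mathcal{O}^n_s\,ds$, and $\mathbb{P}(\mathbb{X}^n_t=\mathcal{X}^n_t)=1$. Let $\Omega_0\in\{B\in\mathcal{F}\colon\mathbb{P}(B)=1\}$ and assume that for all $\omega\in\Omega_0$ it holds that $$\liminf_{m\to\infty}\int_0^Te^{\int_r^T2\phi(\mathbb{O}^m_{\lfloor u\rfloor_{h_m}}(\omega))\,du}\Big[1+|\Phi(\mathbb{O}^m_{\lfloor r\rfloor_{h_m}}(\omega))|+\int_0^T\|\mathcal{O}^m_u(\omega)\|_{H_\varrho}^{4+4\vartheta}\,du+\|\mathbb{O}^m_r(\omega)\|_H^2\Big]\,dr<\infty$$ and $$\limsup_{m\to\infty}\sup_{t\in[0,T]}\|O_t(\omega)-\mathcal{O}^m_t(\omega)\|_{H_\varrho}=0.$$ Then: (i) there exists an up-to-indistinguishability unique stochastic process $X\colon[0,T]\times\Omega\to H_\varrho$ with continuous sample paths which satisfies that for all $t\in[0,T]$ it holds $\mathbb{P}$-a.s. that $$X_t=\int_0^te^{(t-s)A}F(X_s)\,ds+O_t;$$ (ii) there exists an event $\Omega_1\in\{B\in\mathcal{F}\colon\mathbb{P}(B)=1\}$ such that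 for all $\omega\in\Omega_1$ it holds that $$\limsup_{n\to\infty}\sup_{t\in[0,T]}\|X_t(\omega)-\mathbb{X}^n_t(\omega)\|_{H_\varrho}=0.$$
   Context: $\mathbb{N}=\{1,2,3,\dots\}$. For $h\in(0,\infty)$, $t\in\mathbb{R}$: $\lfloor t\rfloor_h=\max((-\infty,t]\cap\{0,h,-h,2h,-2h,\dots\})$. $\mathbf{1}$ denotes an indicator function. $L(V,W)$ denotes the bounded linear operators between normed spaces, $L(V)=L(V,V)$, and $C(V,W)$ the continuous functions. $e^{tA}$, $t\ge0$, is the semigroup generated by $A$, i.e. $e^{tA}v=\sum_{b\in\mathbb{H}}e^{-\lambda_bt}\langle b,v\rangle_Hb$, and $e^{t(A-\eta)}=e^{-\eta t}e^{tA}$; it is extended in the usual way to the spaces $H_r$, $r<0$. The family of interpolation spaces associated to the positive self-adjoint operator $\kappa-A$: for $r\ge0$, $H_r=D((\kappa-A)^r)$ with $\langle v,w\rangle_{H_r}=\langle(\kappa-A)^rv,(\kappa-A)^rw\rangle_H$ (so $H_0=H$); for $r<0$, $H_r$ is the completion of $H$ with respect to the norm $\|v\|_{H_r}=\|(\kappa-A)^rv\|_H$. Integrals of vector-valued functions are Bochner integrals. *)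

theory Defs
  imports "HOL-Probability.Probability"
begin

definition orthonormal_basis :: "'h::real_inner set \<Rightarrow> bool" where
  "orthonormal_basis B \<longleftrightarrow>
     (\<forall>b\<in>B. norm b = 1) \<and> (\<forall>b\<in>B. \<forall>b'\<in>B. b \<noteq> b' \<longrightarrow> b \<bullet> b' = 0) \<and> closure (span B) = UNIV"

text \<open>If every element \<open>b\<close> of the orthonormal basis \<open>B\<close> is an eigenvector of \<open>S\<close>, then its
  eigenvalue is \<open>b \<bullet> S b\<close>, and the functional calculus reads
  \<open>f(S) v = (\<Sum>b\<in>B. f (b \<bullet> S b) \<langle>b, v\<rangle> b)\<close> for those \<open>v\<close> for which this series converges.\<close>

definition opfun_dom :: "'h::real_inner set \<Rightarrow> ('h \<Rightarrow> 'h) \<Rightarrow> (real \<Rightarrow> real) \<Rightarrow> 'h set" where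
  "opfun_dom B S f = {v. (\<lambda>b. \<bar>f (b \<bullet> S b) * (b \<bullet> v)\<bar>\<^sup>2) summable_on B}"

definition opfun :: "'h::real_inner set \<Rightarrow> ('h \<Rightarrow> 'h) \<Rightarrow> (real \<Rightarrow> real) \<Rightarrow> 'h \<Rightarrow> 'h" where
  "opfun B S f v = (\<Sum>\<^sub>\<infinity>b\<in>B. (f (b \<bullet> S b) * (b \<bullet> v)) *\<^sub>R b)"

definition fpow_dom :: "'h::real_inner set \<Rightarrow> ('h \<Rightarrow> 'h) \<Rightarrow> real \<Rightarrow> 'h set" where
  "fpow_dom B S r = opfun_dom B S (\<lambda>x. x powr r)"

definition fpow :: "'h::real_inner set \<Rightarrow> ('h \<Rightarrow> 'h) \<Rightarrow> real \<Rightarrow> 'h \<Rightarrow> 'h" where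
  "fpow B S r = opfun B S (\<lambda>x. x powr r)"

definition semigroup_op :: "'h::real_inner set \<Rightarrow> ('h \<Rightarrow> 'h) \<Rightarrow> real \<Rightarrow> 'h \<Rightarrow> 'h" where
  "semigroup_op B A t = opfun B A (\<lambda>x. exp (t * x))"

definition shift_op :: "real \<Rightarrow> ('h::real_vector \<Rightarrow> 'h) \<Rightarrow> 'h \<Rightarrow> 'h" where
  "shift_op k A v = k *\<^sub>R v - A v"

text \<open>The spaces \<open>H\<^sub>r\<close> depend on a real parameter, so they are not types but subspaces \<open>S\<close> of
  an ambient vector space, each with its own norm \<open>N\<close>, which is relevant on \<open>S\<close> only.\<close>

definition norm_on :: "'e::real_vector set \<Rightarrow> ('e \<Rightarrow> real) \<Rightarrow> bool" where
  "norm_on S N \<longleftrightarrow> subspace S \<and>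
     (\<forall>x\<in>S. 0 \<le> N x \<and> (N x = 0 \<longleftrightarrow> x = 0)) \<and>
     (\<forall>x\<in>S. \<forall>c. N (c *\<^sub>R x) = \<bar>c\<bar> * N x) \<and>
     (\<forall>x\<in>S. \<forall>y\<in>S. N (x + y) \<le> N x + N y)"

text \<open>The locale \<^locale>\<open>Metric_space\<close> asks for nonnegativity and symmetry also outside the
  carrier, hence the case distinction.\<close>

definition ndist :: "'e::real_vector set \<Rightarrow> ('e \<Rightarrow> real) \<Rightarrow> 'e \<Rightarrow> 'e \<Rightarrow> real" where
  "ndist S N x y = (if x \<in> S \<and> y \<in> S then N (x - y) else 0)"

definition ntop :: "'e::real_vector set \<Rightarrow> ('e \<Rightarrow> real) \<Rightarrow> 'e topology" where
  "ntop S N = Metric_space.mtopology S (ndist S N)"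

definition nborel :: "'e::real_vector set \<Rightarrow> ('e \<Rightarrow> real) \<Rightarrow> 'e measure" where
  "nborel S N = sigma S {U. openin (ntop S N) U}"

text \<open>The same as \<^const>\<open>has_bochner_integral\<close>, for functions with values in \<open>(S, N)\<close>.\<close>

definition has_bochner_integral_in ::
  "'e::real_vector set \<Rightarrow> ('e \<Rightarrow> real) \<Rightarrow> 'a measure \<Rightarrow> ('a \<Rightarrow> 'e) \<Rightarrow> 'e \<Rightarrow> bool" where
  "has_bochner_integral_in S N M f y \<longleftrightarrow>
     f \<in> measurable M (nborel S N) \<and>
     (\<exists>s :: nat \<Rightarrow> 'a \<Rightarrow> 'e.
        (\<forall>i. Bochner_Integration.simple_bochner_integrable M (s i) \<and> s i ` space M \<subseteq> S) \<and>
        (\<lambda>i. \<integral>\<^sup>+x. ennreal (N (f x - s i x)) \<partial>M) \<longlonglongrightarrow> 0 \<and>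
        limitin (ntop S N) (\<lambda>i. Bochner_Integration.simple_bochner_integral M (s i)) y sequentially)"

text \<open>Integration over \<open>(0, t)\<close> with respect to Lebesgue measure. The endpoints are left out
  because the integrands below involve \<open>e\<^bsup>(t - s)A\<^esup>\<close>, which need not map into \<open>S\<close> for \<open>s = t\<close>.\<close>

definition has_time_integral ::
  "'e::real_vector set \<Rightarrow> ('e \<Rightarrow> real) \<Rightarrow> real \<Rightarrow> (real \<Rightarrow> 'e) \<Rightarrow> 'e \<Rightarrow> bool" where
  "has_time_integral S N t f y \<longleftrightarrow>
     has_bochner_integral_in S N (restrict_space lborel {0<..<t}) f y"

text \<open>\<open>(S, N)\<close> is a completion of the space \<open>'h\<close> with respect to the norm \<open>N0\<close>, where \<open>j\<close> is
  the inclusion of \<open>'h\<close> into its completion.\<close>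

definition is_completion ::
  "('h::real_vector \<Rightarrow> 'e::real_vector) \<Rightarrow> ('h \<Rightarrow> real) \<Rightarrow> 'e set \<Rightarrow> ('e \<Rightarrow> real) \<Rightarrow> bool" where
  "is_completion j N0 S N \<longleftrightarrow>
     norm_on S N \<and> Metric_space.mcomplete S (ndist S N) \<and>
     range j \<subseteq> S \<and> (\<forall>v. N (j v) = N0 v) \<and> (ntop S N) closure_of (range j) = S"

text \<open>\<open>(Hs r, nrm r)\<close>, \<open>r \<in> \<real>\<close>, is a family of interpolation spaces associated to the positive
  operator \<open>S\<close> which is diagonal with respect to \<open>B\<close>. All these spaces live in one vector space
  \<open>'e\<close>, in which the Hilbert space \<open>'h\<close> is included by means of the injection \<open>j\<close>.\<close>

definition interpolation_spaces ::
  "'h::real_inner set \<Rightarrow> ('h \<Rightarrow> 'h) \<Rightarrow> ('h \<Rightarrow> 'e::real_vector) \<Rightarrow> (real \<Rightarrow> 'e set) \<Rightarrow>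
   (real \<Rightarrow> 'e \<Rightarrow> real) \<Rightarrow> bool" where
  "interpolation_spaces B S j Hs nrm \<longleftrightarrow>
     linear j \<and> inj j \<and>
     (\<forall>r\<ge>0. Hs r = j ` fpow_dom B S r \<and>
        (\<forall>v\<in>fpow_dom B S r. nrm r (j v) = norm (fpow B S r v))) \<and>
     (\<forall>r<0. is_completion j (\<lambda>v. norm (fpow B S r v)) (Hs r) (nrm r))"

text \<open>The continuous extension of \<open>L\<close> from \<open>'h\<close> to a space \<open>(S, N)\<close> in which \<open>'h\<close> is dense.\<close>

definition extend_op ::
  "('h \<Rightarrow> 'e::real_vector) \<Rightarrow> 'e set \<Rightarrow> ('e \<Rightarrow> real) \<Rightarrow> ('h \<Rightarrow> 'h) \<Rightarrow> 'e \<Rightarrow> 'e" where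
  "extend_op j S N L x = (THE y. \<forall>v :: nat \<Rightarrow> 'h.
     limitin (ntop S N) (\<lambda>n. j (v n)) x sequentially \<longrightarrow>
     limitin (ntop S N) (\<lambda>n. j (L (v n))) y sequentially)"

text \<open>For \<open>t > 0\<close> the extension of \<open>e\<^bsup>tA\<^esup>\<close> takes its values in the intersection of \<open>range j\<close>
  and all the spaces \<open>H\<^sub>r\<close>.\<close>

definition ext_semigroup ::
  "'h::real_inner set \<Rightarrow> ('h \<Rightarrow> 'h) \<Rightarrow> ('h \<Rightarrow> 'e::real_vector) \<Rightarrow> 'e set \<Rightarrow> ('e \<Rightarrow> real) \<Rightarrow>
   real \<Rightarrow> 'e \<Rightarrow> 'e" where
  "ext_semigroup B A j S N t = extend_op j S N (semigroup_op B A t)"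

definition round_down :: "real \<Rightarrow> real \<Rightarrow> real" where
  "round_down h t = (GREATEST x. x \<in> {..t} \<inter> range (\<lambda>k::int. of_int k * h))"

definition process_on ::
  "'w measure \<Rightarrow> real \<Rightarrow> 'e::real_vector set \<Rightarrow> ('e \<Rightarrow> real) \<Rightarrow> (real \<Rightarrow> 'w \<Rightarrow> 'e) \<Rightarrow> bool" where
  "process_on M T S N X \<longleftrightarrow> (\<forall>t\<in>{0..T}. X t \<in> measurable M (nborel S N))"

definition cont_process_on ::
  "'w measure \<Rightarrow> real \<Rightarrow> 'e::real_vector set \<Rightarrow> ('e \<Rightarrow> real) \<Rightarrow> (real \<Rightarrow> 'w \<Rightarrow> 'e) \<Rightarrow> bool" where
  "cont_process_on M T S N X \<longleftrightarrow> process_on M T S N X \<and>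
     (\<forall>\<omega>\<in>space M. continuous_map (top_of_set {0..T}) (ntop S N) (\<lambda>t. X t \<omega>))"

definition indistinguishable ::
  "'w measure \<Rightarrow> real \<Rightarrow> (real \<Rightarrow> 'w \<Rightarrow> 'e) \<Rightarrow> (real \<Rightarrow> 'w \<Rightarrow> 'e) \<Rightarrow> bool" where
  "indistinguishable M T X Y \<longleftrightarrow> (AE \<omega> in M. \<forall>t\<in>{0..T}. X t \<omega> = Y t \<omega>)"

definition mild_solution ::
  "'w measure \<Rightarrow> real \<Rightarrow> 'e::real_vector set \<Rightarrow> ('e \<Rightarrow> real) \<Rightarrow> (real \<Rightarrow> 'e \<Rightarrow> 'e) \<Rightarrow> ('e \<Rightarrow> 'e) \<Rightarrow>
   (real \<Rightarrow> 'w \<Rightarrow> 'e) \<Rightarrow> (real \<Rightarrow> 'w \<Rightarrow> 'e) \<Rightarrow> bool" where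
  "mild_solution M T S N E F Z X \<longleftrightarrow> cont_process_on M T S N X \<and>
     (\<forall>t\<in>{0..T}. AE \<omega> in M.
        has_time_integral S N t (\<lambda>s. E (t - s) (F (X s \<omega>))) (X t \<omega> - Z t \<omega>))"

end

theory Submission imports Defs
begin

text \<open>
  Only the eigenvalues \<open>mu b = \<kappa> + lam b\<close> of \<open>\<kappa> - A\<close> matter. Every space \<open>Hs r\<close> is the isometric
  image of the Hilbert space under a map \<open>V r\<close>, where \<open>V r g = j v\<close> if the coefficients of \<open>g\<close> are
  those of \<open>v\<close> multiplied by \<open>mu b powr r\<close>. In these coordinates the equation in \<open>Hs varrho\<close> reads
  \<open>x t = z t + \<integral> K (t - s) (f (x s)) ds\<close> in one Hilbert space, where \<open>K r\<close> multiplies the coefficient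
  of \<open>b\<close> by \<open>mu b powr (varrho + \<alpha>) * exp (- lam b * r)\<close>. The norm of \<open>K r\<close> is at most a constant
  times \<open>r powr - (varrho + \<alpha>)\<close>, an integrable singularity because \<open>varrho + \<alpha> < 1\<close>. The projections
  \<open>P n\<close> tend to the identity pointwise, so the Lipschitz estimate on their ranges extends by continuity,
  and \<open>f\<close> is Lipschitz on bounded sets.

  Convolution with \<open>r powr - a\<close>, \<open>a < 1\<close>, has a small norm with respect to the supremum weighted by
  \<open>exp (- \<mu> * t)\<close> if \<open>\<mu>\<close> is large (\<open>kernel_mass_small\<close>). This one fact yields uniqueness, the
  existence of a solution for globally Lipschitz \<open>f\<close> as a fixed point, and an estimate of the error of
  the scheme as long as the scheme stays in a ball on which \<open>f\<close> agrees with a globally Lipschitz map.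
  Consequently (\<open>scheme_converges_if_frequently_bounded\<close>) it is enough to bound infinitely many members
  of the sequence of schemes by one constant \<open>R\<close>: the solution of the equation in which \<open>f\<close> is cut off at
  radius \<open>R + 1\<close> is the limit of these members, so it is bounded by \<open>R\<close> and solves the original equation,
  and then all schemes with small steps remain within radius \<open>R + 1\<close> and converge to it.

  The bound is an energy estimate (\<open>uniform_energy_bound\<close>). The difference of the approximation and the
  shifted noise solves a finite-dimensional equation with dissipation \<open>\<eta> - A\<close>, to which the coercivity
  condition applies, except that the nonlinearity is evaluated at the preceding grid point. The error
  made by this is the product of an increment of the scheme and of a local Lipschitz constant. Since the
  nonlinearity is switched off above the level \<open>h powr - chi\<close>, the Lipschitz constant is at most of order
  \<open>h powr - (chi * vartheta)\<close>, and the bound on \<open>chi\<close> makes the increment at least as small as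
  \<open>h powr (chi * vartheta)\<close>. Gronwall's inequality then bounds the difference by the integral whose
  lower limit is assumed to be finite, that is, along a subsequence. This is a bound in the Hilbert space
  itself. For \<open>varrho \<le> 0\<close> it suffices; for \<open>varrho > 0\<close> the growth condition turns it into a bound of
  the nonlinearity in \<open>Hs (- \<gamma>)\<close>, which the semigroup lifts to \<open>Hs varrho\<close> as \<open>varrho + \<gamma> < 1\<close>.

  All this holds for each \<open>\<omega>\<close> at which the approximations are driven by their own grid values, hence
  almost surely, since there are only countably many grid points. The limit is measurable because at
  time \<open>t\<close> it is the limit of the processes \<open>\<X> n\<close> at the grid points preceding \<open>t\<close>. A second solution
  satisfies the equation almost surely for each fixed \<open>t\<close>, hence almost surely on a countable dense set
  of times, and this determines it by continuity.
\<close>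

section \<open>Series with respect to an orthonormal basis\<close>

locale onb =
  fixes B :: "'h::{real_inner, banach, second_countable_topology} set"
  assumes basis: "orthonormal_basis B"
begin

definition l2 :: "('h \<Rightarrow> real) \<Rightarrow> bool" where
  "l2 c \<longleftrightarrow> (\<lambda>b. (c b)\<^sup>2) summable_on B"

text \<open>The diagonal operator with eigenvalues \<open>f b\<close>. An unbounded \<open>f\<close> is admitted; the value is the
  intended one for those \<open>v\<close> whose image has square summable coefficients.\<close>

definition dg :: "('h \<Rightarrow> real) \<Rightarrow> 'h \<Rightarrow> 'h" where
  "dg f v = (\<Sum>\<^sub>\<infinity>b\<in>B. (f b * (b \<bullet> v)) *\<^sub>R b)"

lemma inner_basis: "b \<in> B \<Longrightarrow> b' \<in> B \<Longrightarrow> b \<bullet> b' = (if b = b' then 1 else 0)"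
  using basis unfolding orthonormal_basis_def by (auto simp: norm_eq_1)

lemma inner_basis_sum:
  assumes "finite J" "J \<subseteq> B" "b \<in> B"
  shows "b \<bullet> (\<Sum>b'\<in>J. c b' *\<^sub>R b') = (if b \<in> J then c b else 0)"
proof -
  have "b \<bullet> (\<Sum>b'\<in>J. c b' *\<^sub>R b') = (\<Sum>b'\<in>J. if b' = b then c b' else 0)"
    using assms inner_basis unfolding inner_sum_right by (intro sum.cong) auto
  then show ?thesis using assms by simp
qed

lemma norm_basis_sum:
  assumes "finite J" "J \<subseteq> B"
  shows "(norm (\<Sum>b\<in>J. c b *\<^sub>R b))\<^sup>2 = (\<Sum>b\<in>J. (c b)\<^sup>2)"
proof -
  let ?s = "\<Sum>b\<in>J. c b *\<^sub>R b"
  have "(norm ?s)\<^sup>2 = (\<Sum>b\<in>J. c b * (b \<bullet> ?s))"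
    by (simp add: power2_norm_eq_inner inner_sum_left)
  also have "\<dots> = (\<Sum>b\<in>J. (c b)\<^sup>2)"
    using assms inner_basis_sum[OF assms] by (intro sum.cong) (auto simp: power2_eq_square subset_iff)
  finally show ?thesis .
qed

text \<open>By Pythagoras the squared distance of two finite partial sums of the series is controlled by the
  corresponding sums of the squared coefficients, so the Cauchy criterion carries over.\<close>

lemma l2_series_summable:
  assumes "l2 c"
  shows "(\<lambda>b. c b *\<^sub>R b) summable_on B"
proof -
  let ?F = "finite_subsets_at_top B"
  have lim: "(sum (\<lambda>b. (c b)\<^sup>2) \<longlongrightarrow> (\<Sum>\<^sub>\<infinity>b\<in>B. (c b)\<^sup>2)) ?F"
    using assms infsum_tendsto unfolding l2_def by blast
  have "\<exists>P. eventually P ?F \<and> (\<forall>X Y. P X \<and> P Y \<longrightarrow> dist (\<Sum>b\<in>X. c b *\<^sub>R b) (\<Sum>b\<in>Y. c b *\<^sub>R b) < e)"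
    if "e > 0" for e
  proof -
    define L where "L = (\<Sum>\<^sub>\<infinity>b\<in>B. (c b)\<^sup>2)"
    have "eventually (\<lambda>X. dist (\<Sum>b\<in>X. (c b)\<^sup>2) L < (e/2)\<^sup>2) ?F"
      using tendstoD[OF lim, of "(e/2)\<^sup>2"] that by (auto simp: L_def)
    then obtain J where J: "finite J" "J \<subseteq> B" "\<bar>(\<Sum>b\<in>J. (c b)\<^sup>2) - L\<bar> < (e/2)\<^sup>2"
      unfolding eventually_finite_subsets_at_top dist_real_def by blast
    have *: "dist (\<Sum>b\<in>X. c b *\<^sub>R b) (\<Sum>b\<in>J. c b *\<^sub>R b) < e/2"
      if X: "finite X" "J \<subseteq> X" "X \<subseteq> B" for X
    proof -
      have "(\<Sum>b\<in>X. c b *\<^sub>R b) - (\<Sum>b\<in>J. c b *\<^sub>R b) = (\<Sum>b\<in>X-J. c b *\<^sub>R b)"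
        using X by (simp add: sum_diff)
      then have "(dist (\<Sum>b\<in>X. c b *\<^sub>R b) (\<Sum>b\<in>J. c b *\<^sub>R b))\<^sup>2 = (\<Sum>b\<in>X-J. (c b)\<^sup>2)"
        using norm_basis_sum[of "X-J" c] X by (auto simp: dist_norm)
      also have "\<dots> = (\<Sum>b\<in>X. (c b)\<^sup>2) - (\<Sum>b\<in>J. (c b)\<^sup>2)"
        using X by (simp add: sum_diff)
      also have "\<dots> \<le> L - (\<Sum>b\<in>J. (c b)\<^sup>2)"
        using finite_sum_le_infsum[of "\<lambda>b. (c b)\<^sup>2" B X] assms X unfolding l2_def L_def by auto
      also have "\<dots> < (e/2)\<^sup>2" using J by auto
      finally show ?thesis by (rule power2_less_imp_less) (use \<open>e > 0\<close> in simp)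
    qed
    show ?thesis
    proof (intro exI conjI allI impI)
      show "eventually (\<lambda>X. finite X \<and> J \<subseteq> X \<and> X \<subseteq> B) ?F"
        unfolding eventually_finite_subsets_at_top using J by blast
      show "dist (\<Sum>b\<in>X. c b *\<^sub>R b) (\<Sum>b\<in>Y. c b *\<^sub>R b) < e"
        if "(finite X \<and> J \<subseteq> X \<and> X \<subseteq> B) \<and> (finite Y \<and> J \<subseteq> Y \<and> Y \<subseteq> B)" for X Y
        using *[of X] *[of Y] that dist_triangle_half_l by blast
    qed
  qed
  then have "cauchy_filter (filtermap (sum (\<lambda>b. c b *\<^sub>R b)) ?F)"
    by (simp only: cauchy_filter_metric_filtermap) blast
  moreover have "Topological_Spaces.complete (UNIV :: 'h set)"
    by (metis Cauchy_convergent UNIV_I complete_def convergent_def)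
  ultimately obtain x where "filtermap (sum (\<lambda>b. c b *\<^sub>R b)) ?F \<le> nhds x"
    using cauchy_filter_complete_converges[of "filtermap (sum (\<lambda>b. c b *\<^sub>R b)) ?F" UNIV]
    by (auto simp: filtermap_bot_iff)
  then show ?thesis
    unfolding summable_on_def has_sum_def by (auto simp: filterlim_def)
qed

lemma l2_series:
  assumes "l2 c"
  defines "x \<equiv> \<Sum>\<^sub>\<infinity>b\<in>B. c b *\<^sub>R b"
  shows "b \<in> B \<Longrightarrow> b \<bullet> x = c b" and "(norm x)\<^sup>2 = (\<Sum>\<^sub>\<infinity>b\<in>B. (c b)\<^sup>2)"
proof -
  have hs: "((\<lambda>b. c b *\<^sub>R b) has_sum x) B"
    using l2_series_summable[OF assms(1)] unfolding x_def by simp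
  show *: "b \<bullet> x = c b" if "b \<in> B" for b
  proof -
    have "((\<lambda>b'. b \<bullet> (c b' *\<^sub>R b')) has_sum (b \<bullet> x)) B"
      using has_sum_bounded_linear[OF bounded_linear_inner_right hs] by simp
    moreover have "((\<lambda>b'. b \<bullet> (c b' *\<^sub>R b')) has_sum (c b)) B"
      by (rule has_sum_finite_neutralI[of "{b}"]) (use that inner_basis in auto)
    ultimately show ?thesis using has_sum_unique by blast
  qed
  have "((\<lambda>b. x \<bullet> (c b *\<^sub>R b)) has_sum (x \<bullet> x)) B"
    using has_sum_bounded_linear[OF bounded_linear_inner_right hs] by simp
  also have "?this \<longleftrightarrow> ((\<lambda>b. (c b)\<^sup>2) has_sum (x \<bullet> x)) B"
    using * by (intro has_sum_cong) (auto simp: power2_eq_square inner_commute)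
  finally show "(norm x)\<^sup>2 = (\<Sum>\<^sub>\<infinity>b\<in>B. (c b)\<^sup>2)"
    by (simp add: infsumI power2_norm_eq_inner)
qed

lemma bessel:
  assumes "finite J" "J \<subseteq> B"
  shows "(\<Sum>b\<in>J. (b \<bullet> v)\<^sup>2) \<le> (norm v)\<^sup>2"
proof -
  let ?s = "\<Sum>b\<in>J. (b \<bullet> v) *\<^sub>R b"
  have 1: "v \<bullet> ?s = (\<Sum>b\<in>J. (b \<bullet> v)\<^sup>2)"
    by (simp add: inner_sum_right power2_eq_square inner_commute)
  have 2: "?s \<bullet> ?s = (\<Sum>b\<in>J. (b \<bullet> v)\<^sup>2)"
    using norm_basis_sum[OF assms, of "\<lambda>b. b \<bullet> v"] by (simp add: power2_norm_eq_inner)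
  have "0 \<le> (v - ?s) \<bullet> (v - ?s)" by simp
  also have "\<dots> = v \<bullet> v - 2 * (v \<bullet> ?s) + ?s \<bullet> ?s"
    by (simp add: inner_diff_left inner_diff_right inner_commute)
  also have "\<dots> = (norm v)\<^sup>2 - (\<Sum>b\<in>J. (b \<bullet> v)\<^sup>2)"
    unfolding 1 2 by (simp add: power2_norm_eq_inner)
  finally show ?thesis by simp
qed

lemma l2_inner: "l2 (\<lambda>b. b \<bullet> v)"
  unfolding l2_def
  by (rule nonneg_bdd_above_summable_on) (auto intro!: bdd_aboveI2[of _ _ "(norm v)\<^sup>2"] bessel)

lemma zero_if_orthogonal_to_basis:
  assumes "\<And>b. b \<in> B \<Longrightarrow> b \<bullet> v = 0"
  shows "v = 0"
proof -
  have "span B \<subseteq> {x. x \<bullet> v = 0}"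
    using assms by (intro span_minimal) (auto simp: subspace_def inner_add_left)
  moreover have "closed {x. x \<bullet> v = 0}"
    by (intro closed_Collect_eq continuous_intros)
  ultimately have "closure (span B) \<subseteq> {x. x \<bullet> v = 0}"
    by (rule closure_minimal)
  moreover have "v \<in> closure (span B)" using basis unfolding orthonormal_basis_def by auto
  ultimately have "v \<bullet> v = 0" by auto
  then show ?thesis by simp
qed

lemma basis_eqI:
  assumes "\<And>b. b \<in> B \<Longrightarrow> b \<bullet> v = b \<bullet> w"
  shows "v = w"
  using zero_if_orthogonal_to_basis[of "v - w"] assms by (simp add: inner_diff_right)

text \<open>The series formed with the coefficients of \<open>v\<close> has the same coefficients as \<open>v\<close>, hence equals \<open>v\<close>,
  because no nonzero vector is orthogonal to the dense subspace \<open>span B\<close>.\<close>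

lemma parseval: "(norm v)\<^sup>2 = (\<Sum>\<^sub>\<infinity>b\<in>B. (b \<bullet> v)\<^sup>2)"
proof -
  have "v = (\<Sum>\<^sub>\<infinity>b\<in>B. (b \<bullet> v) *\<^sub>R b)"
    using l2_series(1)[OF l2_inner] by (intro basis_eqI) auto
  then show ?thesis using l2_series(2)[OF l2_inner] by metis
qed

lemma inner_dg: "l2 (\<lambda>b. f b * (b \<bullet> v)) \<Longrightarrow> b \<in> B \<Longrightarrow> b \<bullet> dg f v = f b * (b \<bullet> v)"
  unfolding dg_def by (rule l2_series)

lemma l2_mono:
  assumes "l2 c" "\<And>b. b \<in> B \<Longrightarrow> \<bar>d b\<bar> \<le> C * \<bar>c b\<bar>"
  shows "l2 d"
proof -
  have "(\<lambda>b. C\<^sup>2 * (c b)\<^sup>2) summable_on B"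
    using assms(1) unfolding l2_def by (intro summable_on_cmult_right)
  then show ?thesis unfolding l2_def
  proof (rule summable_on_comparison_test)
    fix b assume "b \<in> B"
    then have "\<bar>d b\<bar>\<^sup>2 \<le> (C * \<bar>c b\<bar>)\<^sup>2"
      using assms(2) by (intro power_mono) auto
    then show "(d b)\<^sup>2 \<le> C\<^sup>2 * (c b)\<^sup>2" by (simp add: power_mult_distrib)
  qed auto
qed

text \<open>Norm estimates for diagonal operators reduce to estimates of single coefficients.\<close>

lemma norm_mono:
  assumes "0 \<le> C" "\<And>b. b \<in> B \<Longrightarrow> \<bar>b \<bullet> v\<bar> \<le> C * \<bar>b \<bullet> w\<bar>"
  shows "norm v \<le> C * norm w"
proof -
  have "(norm v)\<^sup>2 \<le> (\<Sum>\<^sub>\<infinity>b\<in>B. C\<^sup>2 * (b \<bullet> w)\<^sup>2)"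
    unfolding parseval
  proof (rule infsum_mono)
    show "(\<lambda>b. (b \<bullet> v)\<^sup>2) summable_on B" using l2_inner unfolding l2_def by auto
    show "(\<lambda>b. C\<^sup>2 * (b \<bullet> w)\<^sup>2) summable_on B"
      using l2_inner unfolding l2_def by (intro summable_on_cmult_right) auto
    fix b assume "b \<in> B"
    then have "\<bar>b \<bullet> v\<bar>\<^sup>2 \<le> (C * \<bar>b \<bullet> w\<bar>)\<^sup>2"
      using assms(2) by (intro power_mono) auto
    then show "(b \<bullet> v)\<^sup>2 \<le> C\<^sup>2 * (b \<bullet> w)\<^sup>2" by (simp add: power_mult_distrib)
  qed
  also have "\<dots> = (C * norm w)\<^sup>2"
    unfolding power_mult_distrib parseval using l2_inner[unfolded l2_def] by (intro infsum_cmult_right)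
  finally show ?thesis by (rule power2_le_imp_le) (use assms(1) in simp)
qed

definition bdd_mult :: "('h \<Rightarrow> real) \<Rightarrow> bool" where
  "bdd_mult f \<longleftrightarrow> (\<exists>C. \<forall>b\<in>B. \<bar>f b\<bar> \<le> C)"

lemma bdd_multI: "(\<And>b. b \<in> B \<Longrightarrow> \<bar>f b\<bar> \<le> C) \<Longrightarrow> bdd_mult f"
  unfolding bdd_mult_def by auto

lemma l2_bdd_mult:
  assumes "bdd_mult f" "l2 c"
  shows "l2 (\<lambda>b. f b * c b)"
proof -
  obtain C where "\<forall>b\<in>B. \<bar>f b\<bar> \<le> C" using assms(1) unfolding bdd_mult_def by auto
  then show ?thesis
    by (intro l2_mono[OF assms(2), of _ C]) (auto simp: abs_mult intro: mult_right_mono)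
qed

lemma inner_dg_bdd: "bdd_mult f \<Longrightarrow> b \<in> B \<Longrightarrow> b \<bullet> dg f v = f b * (b \<bullet> v)"
  by (intro inner_dg l2_bdd_mult l2_inner)

lemma norm_dg_le:
  assumes "0 \<le> C" "\<And>b. b \<in> B \<Longrightarrow> \<bar>f b\<bar> \<le> C"
  shows "norm (dg f v) \<le> C * norm v"
  using assms inner_dg_bdd[OF bdd_multI[OF assms(2)]]
  by (intro norm_mono) (auto simp: abs_mult intro: mult_right_mono)

lemma bounded_linear_dg:
  assumes "bdd_mult f"
  shows "bounded_linear (dg f)"
proof -
  obtain C where C: "\<forall>b\<in>B. \<bar>f b\<bar> \<le> C" using assms unfolding bdd_mult_def by auto
  show ?thesis
  proof (rule bounded_linear_intro)
    show "dg f (x + y) = dg f x + dg f y" for x y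
      by (rule basis_eqI) (simp add: inner_dg_bdd[OF assms] inner_add_right algebra_simps)
    show "dg f (r *\<^sub>R x) = r *\<^sub>R dg f x" for r x
      by (rule basis_eqI) (simp add: inner_dg_bdd[OF assms])
    show "norm (dg f x) \<le> norm x * max 0 C" for x
      using norm_dg_le[of "max 0 C" f x] C by (simp add: max.coboundedI2 mult.commute)
  qed
qed

lemma range_dg_dense:
  assumes f: "bdd_mult f" "\<And>b. b \<in> B \<Longrightarrow> f b \<noteq> 0"
  shows "closure (range (dg f)) = UNIV"
proof -
  interpret d: bounded_linear "dg f" by (rule bounded_linear_dg[OF f(1)])
  have "b \<in> range (dg f)" if "b \<in> B" for b
  proof (rule range_eqI)
    show "b = dg f ((1 / f b) *\<^sub>R b)"
      using f that by (intro basis_eqI) (auto simp: inner_dg_bdd inner_basis)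
  qed
  moreover have "subspace (range (dg f))"
    by (simp add: d.linear_axioms linear_subspace_image)
  ultimately have "span B \<subseteq> range (dg f)" by (intro span_minimal) auto
  then show ?thesis
    using closure_mono basis unfolding orthonormal_basis_def by blast
qed

end

section \<open>Norms on subspaces and isometric coordinates\<close>

lemma Metric_space_ndist:
  assumes "norm_on S N"
  shows "Metric_space S (ndist S N)"
proof
  have sub: "subspace S" and n: "\<And>x. x \<in> S \<Longrightarrow> 0 \<le> N x \<and> (N x = 0 \<longleftrightarrow> x = 0)"
    and sc: "\<And>x c. x \<in> S \<Longrightarrow> N (c *\<^sub>R x) = \<bar>c\<bar> * N x"
    and tri: "\<And>x y. x \<in> S \<Longrightarrow> y \<in> S \<Longrightarrow> N (x + y) \<le> N x + N y"
    using assms unfolding norm_on_def by auto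
  show "0 \<le> ndist S N x y" for x y
    using n subspace_diff[OF sub] by (auto simp: ndist_def)
  have "N (- x) = N x" if "x \<in> S" for x using sc[OF that, of "-1"] by simp
  from this[of "_ - _"] show "ndist S N x y = ndist S N y x" for x y
    using subspace_diff[OF sub] by (auto simp: ndist_def)
  show "(ndist S N x y = 0) = (x = y)" if "x \<in> S" "y \<in> S" for x y
    using that n[of "x - y"] subspace_diff[OF sub] by (auto simp: ndist_def)
  show "ndist S N x z \<le> ndist S N x y + ndist S N y z" if "x \<in> S" "y \<in> S" "z \<in> S" for x y z
    using that tri[of "x - y" "y - z"] subspace_diff[OF sub] by (auto simp: ndist_def)
qed

lemma limitin_ntop:
  assumes "norm_on S N" "\<And>i. f i \<in> S"
  shows "limitin (ntop S N) f y F \<longleftrightarrow> y \<in> S \<and> ((\<lambda>i. N (f i - y)) \<longlongrightarrow> 0) F"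
proof -
  interpret Metric_space S "ndist S N" by (rule Metric_space_ndist[OF assms(1)])
  show ?thesis
    unfolding ntop_def limitin_metric_dist_null using assms(2) by (auto simp: ndist_def)
qed

lemma norm_on_tendsto_unique:
  assumes "norm_on S N" "\<And>i. f i \<in> S" "limitin (ntop S N) f y F" "limitin (ntop S N) f y' F" "F \<noteq> bot"
  shows "y = y'"
proof -
  interpret Metric_space S "ndist S N" by (rule Metric_space_ndist[OF assms(1)])
  show ?thesis using assms(3-) unfolding ntop_def by (rule limitin_metric_unique)
qed

text \<open>A linear isometry of a normed type onto \<open>(S, N)\<close> carries limits, continuity, measurability and
  Bochner integrals over to that type, where they are the usual notions.\<close>

definition isometry_onto :: "('h::real_normed_vector \<Rightarrow> 'e::real_vector) \<Rightarrow> 'e set \<Rightarrow> ('e \<Rightarrow> real) \<Rightarrow> bool" where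
  "isometry_onto V S N \<longleftrightarrow> linear V \<and> range V = S \<and> (\<forall>x. N (V x) = norm x)"

locale isometric_coordinates =
  fixes V :: "'h::{real_normed_vector} \<Rightarrow> 'e::real_vector" and S N
  assumes iso: "isometry_onto V S N"
begin

lemma linear_V: "linear V" and range_V: "range V = S" and N_V [simp]: "N (V x) = norm x"
  using iso unfolding isometry_onto_def by auto

lemma V_in [simp]: "V x \<in> S" using range_V by auto

lemmas V_diff = linear_diff[OF linear_V] and V_add = linear_add[OF linear_V]
  and V_scale = linear_scale[OF linear_V] and V_0 = linear_0[OF linear_V]

lemma V_eq_iff [simp]: "V x = V y \<longleftrightarrow> x = y"
proof
  assume "V x = V y"
  then have "N (V (x - y)) = N (V 0)" by (simp add: V_diff V_0)
  then show "x = y" by simp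
qed simp

lemma inj_V: "inj V" by (auto intro: injI)

lemma inv_V [simp]: "inv V (V x) = x" using inj_V by simp

lemma V_inv [simp]: "x \<in> S \<Longrightarrow> V (inv V x) = x" using range_V f_inv_into_f by metis

lemma norm_on: "norm_on S N"
  unfolding norm_on_def range_V[symmetric]
  using linear_subspace_image[OF linear_V subspace_UNIV]
  by (auto simp: V_add[symmetric] V_scale[symmetric] norm_triangle_ineq) (metis V_0 V_eq_iff)+

lemma ndist_V [simp]: "ndist S N (V x) (V y) = dist x y"
  by (simp add: ndist_def V_diff[symmetric] dist_norm)

sublocale Metric_space S "ndist S N" by (rule Metric_space_ndist[OF norm_on])

lemma topspace_ntop [simp]: "topspace (ntop S N) = S"
  by (simp add: ntop_def)

lemma limitin_V: "limitin (ntop S N) (\<lambda>i. V (f i)) (V y) F \<longleftrightarrow> (f \<longlongrightarrow> y) F"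
  by (subst limitin_ntop[OF norm_on]) (auto simp: V_diff[symmetric] tendsto_norm_zero_iff Lim_null[symmetric])

lemma openin_ntop: "openin (ntop S N) U \<longleftrightarrow> U \<subseteq> S \<and> open (V -` U)"
proof -
  have "(\<forall>x. x \<in> U \<longrightarrow> (\<exists>r>0. mball x r \<subseteq> U)) \<longleftrightarrow> open (V -` U)" if "U \<subseteq> S"
  proof
    assume *: "\<forall>x. x \<in> U \<longrightarrow> (\<exists>r>0. mball x r \<subseteq> U)"
    show "open (V -` U)" unfolding open_dist
    proof
      fix x assume "x \<in> V -` U"
      then obtain r where "r > 0" "mball (V x) r \<subseteq> U" using * by auto
      then show "\<exists>e>0. \<forall>y. dist y x < e \<longrightarrow> y \<in> V -` U"
        by (intro exI[of _ r]) (auto simp: subset_iff dist_commute)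
    qed
  next
    assume *: "open (V -` U)"
    show "\<forall>x. x \<in> U \<longrightarrow> (\<exists>r>0. mball x r \<subseteq> U)"
    proof (intro allI impI)
      fix x assume "x \<in> U"
      with that obtain u where u: "x = V u" using range_V by auto
      with * \<open>x \<in> U\<close> obtain e where e: "e > 0" "\<forall>y. dist y u < e \<longrightarrow> y \<in> V -` U"
        unfolding open_dist by auto
      have "mball x e \<subseteq> U"
      proof
        fix y assume y: "y \<in> mball x e"
        then obtain w where "y = V w" using range_V by auto
        with y u e show "y \<in> U" by (auto simp: dist_commute)
      qed
      with e show "\<exists>r>0. mball x r \<subseteq> U" by blast
    qed
  qed
  then show ?thesis unfolding ntop_def openin_mtopology by auto
qed

lemma continuous_map_V: "continuous_map X (ntop S N) (\<lambda>x. V (g x)) \<longleftrightarrow> continuous_map X euclidean g"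
proof
  assume *: "continuous_map X (ntop S N) (\<lambda>x. V (g x))"
  have "openin X {x \<in> topspace X. g x \<in> W}" if "open W" for W
  proof -
    have "V -` (V ` W) = W" by auto
    then have "openin (ntop S N) (V ` W)" using that by (auto simp: openin_ntop)
    then have "openin X {x \<in> topspace X. V (g x) \<in> V ` W}"
      using * unfolding continuous_map_def by auto
    then show ?thesis by (simp add: inj_image_mem_iff[OF inj_V])
  qed
  then show "continuous_map X euclidean g" unfolding continuous_map_def by auto
next
  assume *: "continuous_map X euclidean g"
  have "openin X {x \<in> topspace X. g x \<in> V -` U}" if "openin (ntop S N) U" for U
    using * that unfolding continuous_map_def openin_ntop by auto
  then show "continuous_map X (ntop S N) (\<lambda>x. V (g x))" unfolding continuous_map_def by auto
qed

lemma space_nborel [simp]: "space (nborel S N) = S"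
  unfolding nborel_def by (rule space_measure_of) (auto simp: openin_ntop)

lemma measurable_V_iff: "(\<lambda>x. V (g x)) \<in> measurable M (nborel S N) \<longleftrightarrow> g \<in> borel_measurable M"
proof
  assume *: "(\<lambda>x. V (g x)) \<in> measurable M (nborel S N)"
  show "g \<in> borel_measurable M"
  proof (rule borel_measurableI)
    fix W :: "'h set" assume "open W"
    have "V -` (V ` W) = W" by auto
    then have "openin (ntop S N) (V ` W)" using \<open>open W\<close> by (auto simp: openin_ntop)
    then have "V ` W \<in> sets (nborel S N)"
      unfolding nborel_def by (subst sets_measure_of) (auto simp: openin_ntop intro: sigma_sets.Basic)
    from measurable_sets[OF * this] show "g -` W \<inter> space M \<in> sets M"
      by (simp add: vimage_def inj_image_mem_iff[OF inj_V])
  qed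
next
  assume *: "g \<in> borel_measurable M"
  show "(\<lambda>x. V (g x)) \<in> measurable M (nborel S N)"
    unfolding nborel_def
  proof (rule measurable_measure_of)
    show "{U. openin (ntop S N) U} \<subseteq> Pow S" by (auto simp: openin_ntop)
    fix U assume "U \<in> {U. openin (ntop S N) U}"
    then have "open (V -` U)" by (auto simp: openin_ntop)
    then have "g -` (V -` U) \<inter> space M \<in> sets M" using * by (auto intro: measurable_sets)
    then show "(\<lambda>x. V (g x)) -` U \<inter> space M \<in> sets M" by (simp add: vimage_def)
  qed auto
qed

lemma measurable_nborelD:
  assumes "f \<in> measurable M (nborel S N)"
  shows "(\<lambda>x. inv V (f x)) \<in> borel_measurable M"
proof -
  have "f \<in> measurable M (nborel S N) \<longleftrightarrow> (\<lambda>x. V (inv V (f x))) \<in> measurable M (nborel S N)"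
    using measurable_space[OF assms] by (intro measurable_cong) auto
  then show ?thesis using assms measurable_V_iff by blast
qed

lemma simple_bochner_integral_cong_space:
  "(\<And>x. x \<in> space M \<Longrightarrow> f x = g x) \<Longrightarrow>
    Bochner_Integration.simple_bochner_integral M f = Bochner_Integration.simple_bochner_integral M g"
  unfolding Bochner_Integration.simple_bochner_integral_def
  by (intro sum.cong arg_cong2[where f=scaleR] arg_cong[where f="measure M"]) auto

end

locale banach_coordinates = isometric_coordinates V S N
  for V :: "'h::{banach, second_countable_topology} \<Rightarrow> 'e::real_vector" and S N
begin

text \<open>A simple function with values in \<open>S\<close> is the image of a simple function, with the same sum up to \<open>V\<close>
  and at the same \<open>L\<^sup>1\<close> distance from the integrand. The preimage is formed with \<open>inv V\<close>, which inverts
  \<open>V\<close> on the space of the measure only, where the values are known to lie in \<open>S\<close>.\<close>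

lemma has_bochner_integral_in_V:
  "has_bochner_integral_in S N M (\<lambda>x. V (g x)) (V y) \<longleftrightarrow> has_bochner_integral M g y"
proof
  assume "has_bochner_integral M g y"
  then obtain s where s: "g \<in> borel_measurable M" "\<And>i. Bochner_Integration.simple_bochner_integrable M (s i)"
    "(\<lambda>i. \<integral>\<^sup>+x. ennreal (norm (g x - s i x)) \<partial>M) \<longlonglongrightarrow> 0"
    "(\<lambda>i. Bochner_Integration.simple_bochner_integral M (s i)) \<longlonglongrightarrow> y"
    by (auto elim!: has_bochner_integral.cases)
  have "Bochner_Integration.simple_bochner_integrable M (\<lambda>x. V (s i x))" for i
    using simple_bochner_integrable_compose2[where p="\<lambda>x y. V x", OF _ s(2) s(2)] by (simp add: V_0)
  moreover have "(\<lambda>i. \<integral>\<^sup>+x. ennreal (N (V (g x) - V (s i x))) \<partial>M) \<longlonglongrightarrow> 0"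
    using s(3) by (simp add: V_diff[symmetric])
  moreover have "limitin (ntop S N) (\<lambda>i. Bochner_Integration.simple_bochner_integral M (\<lambda>x. V (s i x))) (V y) sequentially"
    using s(4) by (simp add: simple_bochner_integral_linear[OF linear_V s(2)] limitin_V)
  ultimately show "has_bochner_integral_in S N M (\<lambda>x. V (g x)) (V y)"
    unfolding has_bochner_integral_in_def using s(1)
    by (intro conjI exI[of _ "\<lambda>i x. V (s i x)"]) (auto simp: measurable_V_iff)
next
  assume *: "has_bochner_integral_in S N M (\<lambda>x. V (g x)) (V y)"
  then obtain s where s: "g \<in> borel_measurable M" "\<And>i. Bochner_Integration.simple_bochner_integrable M (s i)"
    "\<And>i. s i ` space M \<subseteq> S"
    "(\<lambda>i. \<integral>\<^sup>+x. ennreal (N (V (g x) - s i x)) \<partial>M) \<longlonglongrightarrow> 0"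
    "limitin (ntop S N) (\<lambda>i. Bochner_Integration.simple_bochner_integral M (s i)) (V y) sequentially"
    unfolding has_bochner_integral_in_def measurable_V_iff by auto
  define r where "r = (\<lambda>i x. inv V (s i x))"
  have Vr: "x \<in> space M \<Longrightarrow> V (r i x) = s i x" for i x
    unfolding r_def using s(3)[of i] by (intro V_inv) auto
  have r: "Bochner_Integration.simple_bochner_integrable M (r i)" for i
  proof -
    have "{x \<in> space M. r i x \<noteq> 0} = {x \<in> space M. s i x \<noteq> 0}"
      using Vr[of _ i] V_0 V_eq_iff by metis
    then show ?thesis
      using s(2)[of i] unfolding r_def
      by (auto simp: simple_bochner_integrable.simps intro: simple_function_compose1)
  qed
  have "(\<lambda>i. \<integral>\<^sup>+x. ennreal (norm (g x - r i x)) \<partial>M) \<longlonglongrightarrow> 0"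
  proof -
    have "(\<integral>\<^sup>+x. ennreal (N (V (g x) - s i x)) \<partial>M) = (\<integral>\<^sup>+x. ennreal (norm (g x - r i x)) \<partial>M)" for i
      by (intro nn_integral_cong) (simp add: Vr[symmetric] V_diff[symmetric])
    then show ?thesis using s(4) by simp
  qed
  moreover have "(\<lambda>i. Bochner_Integration.simple_bochner_integral M (r i)) \<longlonglongrightarrow> y"
  proof -
    have "Bochner_Integration.simple_bochner_integral M (s i) = V (Bochner_Integration.simple_bochner_integral M (r i))" for i
      using simple_bochner_integral_linear[OF linear_V r, of i]
        simple_bochner_integral_cong_space[of M "\<lambda>x. V (r i x)" "s i"] Vr by metis
    then show ?thesis using s(5) by (intro limitin_V[THEN iffD1]) simp
  qed
  ultimately show "has_bochner_integral M g y"
    using s(1) r by (intro has_bochner_integral.intros)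
qed

end

section \<open>Coordinates on a completion\<close>

text \<open>Both \<open>L\<close> and \<open>j\<close> map the Hilbert space onto a dense subspace of a complete space, and they induce
  the same distance. So \<open>L v \<mapsto> j v\<close> is an isometry between dense subspaces, and it extends to limits.\<close>

lemma completion_coordinates:
  fixes L :: "'h::banach \<Rightarrow> 'h" and j :: "'h \<Rightarrow> 'e::real_vector"
  assumes comp: "is_completion j (\<lambda>v. norm (L v)) S N"
    and L: "linear L" "closure (range L) = UNIV" and j: "linear j"
  shows "\<exists>V. isometry_onto V S N \<and> (\<forall>v. V (L v) = j v)"
proof -
  have N: "norm_on S N" and mc: "Metric_space.mcomplete S (ndist S N)" and jS: "\<And>v. j v \<in> S"
    and Nj: "\<And>v. N (j v) = norm (L v)" and dense: "(ntop S N) closure_of (range j) = S"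
    using comp unfolding is_completion_def by auto
  interpret Metric_space S "ndist S N" by (rule Metric_space_ndist[OF N])
  have sub: "subspace S" and n0: "\<And>x. x \<in> S \<Longrightarrow> 0 \<le> N x \<and> (N x = 0 \<longleftrightarrow> x = 0)"
    and sc: "\<And>x c. x \<in> S \<Longrightarrow> N (c *\<^sub>R x) = \<bar>c\<bar> * N x"
    and tri: "\<And>x y. x \<in> S \<Longrightarrow> y \<in> S \<Longrightarrow> N (x + y) \<le> N x + N y"
    using N unfolding norm_on_def by auto
  note lim = limitin_ntop[OF N jS]
  have dj: "ndist S N (j v) (j w) = dist (L v) (L w)" for v w
    by (simp add: ndist_def jS linear_diff[OF j, symmetric] linear_diff[OF L(1), symmetric] Nj dist_norm)
  (* The graph of the extension; that it is the graph of a linear isometry follows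
     from \<open>P_ex\<close>, \<open>PN\<close> and \<open>P_lin\<close>. *)
  define P where "P = (\<lambda>x y. \<exists>v. (\<lambda>n. L (v n)) \<longlonglongrightarrow> x \<and> limitin (ntop S N) (\<lambda>n. j (v n)) y sequentially)"
  have P_ex: "\<exists>y. P x y" for x
  proof -
    have "x \<in> closure (range L)" using L(2) by auto
    then obtain u where u: "\<forall>n. u n \<in> range L" "u \<longlonglongrightarrow> x"
      unfolding closure_sequential by blast
    then have "\<forall>n. \<exists>w. u n = L w" by auto
    then obtain v where "\<forall>n. u n = L (v n)" by metis
    then have "u = (\<lambda>n. L (v n))" by auto
    with u have v: "(\<lambda>n. L (v n)) \<longlonglongrightarrow> x" by simp
    then have "Cauchy (\<lambda>n. L (v n))" by (rule LIMSEQ_imp_Cauchy)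
    then have "MCauchy (\<lambda>n. j (v n))"
      unfolding MCauchy_def Cauchy_def dj using jS by (auto 0 3)
    then obtain y where "limitin mtopology (\<lambda>n. j (v n)) y sequentially"
      using mc unfolding mcomplete_def by blast
    with v show ?thesis unfolding P_def ntop_def by blast
  qed
  have PS: "y \<in> S" if "P x y" for x y using that lim unfolding P_def by blast
  have PN: "N y = norm x" if P: "P x y" for x y
  proof -
    obtain v where v: "(\<lambda>n. L (v n)) \<longlonglongrightarrow> x" "(\<lambda>n. N (j (v n) - y)) \<longlonglongrightarrow> 0" and y: "y \<in> S"
      using P unfolding P_def lim by blast
    have "\<bar>N (j (v n)) - N y\<bar> \<le> N (j (v n) - y)" for n
    proof -
      have "N (j (v n)) \<le> N (j (v n) - y) + N y"
        using tri[of "j (v n) - y" y] y jS subspace_diff[OF sub] by auto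
      moreover have "N y \<le> N (y - j (v n)) + N (j (v n))"
        using tri[of "y - j (v n)" "j (v n)"] y jS subspace_diff[OF sub] by auto
      moreover have "N (y - j (v n)) = N (j (v n) - y)"
        using sc[of "j (v n) - y" "-1"] y jS subspace_diff[OF sub] by auto
      ultimately show ?thesis by linarith
    qed
    then have "(\<lambda>n. N (j (v n)) - N y) \<longlonglongrightarrow> 0"
      by (intro Lim_null_comparison[OF _ v(2)]) auto
    then have "(\<lambda>n. norm (L (v n))) \<longlonglongrightarrow> N y" by (simp add: Nj LIM_zero_iff)
    moreover have "(\<lambda>n. norm (L (v n))) \<longlonglongrightarrow> norm x" using v(1) by (rule tendsto_norm)
    ultimately show ?thesis by (rule LIMSEQ_unique)
  qed
  have P_lin: "P (x + c *\<^sub>R x') (y + c *\<^sub>R y')" if P: "P x y" "P x' y'" for x x' y y' c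
  proof -
    obtain v where v: "(\<lambda>n. L (v n)) \<longlonglongrightarrow> x" "(\<lambda>n. N (j (v n) - y)) \<longlonglongrightarrow> 0" and y: "y \<in> S"
      using P(1) unfolding P_def lim by blast
    obtain v' where v': "(\<lambda>n. L (v' n)) \<longlonglongrightarrow> x'" "(\<lambda>n. N (j (v' n) - y')) \<longlonglongrightarrow> 0" and y': "y' \<in> S"
      using P(2) unfolding P_def lim by blast
    have "(\<lambda>n. L (v n + c *\<^sub>R v' n)) \<longlonglongrightarrow> x + c *\<^sub>R x'"
      unfolding linear_add[OF L(1)] linear_scale[OF L(1)] by (intro tendsto_intros v v')
    moreover have "(\<lambda>n. N (j (v n + c *\<^sub>R v' n) - (y + c *\<^sub>R y'))) \<longlonglongrightarrow> 0"
    proof (rule Lim_null_comparison)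
      show "(\<lambda>n. N (j (v n) - y) + \<bar>c\<bar> * N (j (v' n) - y')) \<longlonglongrightarrow> 0"
        using tendsto_add[OF v(2) tendsto_mult_right_zero[OF v'(2), of "\<bar>c\<bar>"]] by simp
      have "N (j (v n + c *\<^sub>R v' n) - (y + c *\<^sub>R y')) \<le> N (j (v n) - y) + \<bar>c\<bar> * N (j (v' n) - y')" for n
      proof -
        have eq: "j (v n + c *\<^sub>R v' n) - (y + c *\<^sub>R y') = (j (v n) - y) + c *\<^sub>R (j (v' n) - y')"
          by (simp add: linear_add[OF j] linear_scale[OF j] algebra_simps)
        have m: "j (v n) - y \<in> S" "j (v' n) - y' \<in> S"
          using y y' jS subspace_diff[OF sub] by auto
        show ?thesis
          unfolding eq sc[OF m(2), symmetric] by (rule tri[OF m(1) subspace_scale[OF sub m(2)]])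
      qed
      moreover have "0 \<le> N (j (v n + c *\<^sub>R v' n) - (y + c *\<^sub>R y'))" for n
        using n0 y y' jS subspace_diff[OF sub] subspace_add[OF sub] subspace_scale[OF sub] by auto
      ultimately show "\<forall>\<^sub>F n in sequentially. norm (N (j (v n + c *\<^sub>R v' n) - (y + c *\<^sub>R y')))
          \<le> N (j (v n) - y) + \<bar>c\<bar> * N (j (v' n) - y')" by auto
    qed
    moreover have "y + c *\<^sub>R y' \<in> S"
      by (rule subspace_add[OF sub y subspace_scale[OF sub y']])
    ultimately show ?thesis unfolding P_def lim
      by (intro exI[of _ "\<lambda>n. v n + c *\<^sub>R v' n"] conjI)
  qed
  have P_unique: "y = y'" if "P x y" "P x y'" for x y y'
  proof -
    have "P (x + (-1) *\<^sub>R x) (y + (-1) *\<^sub>R y')" using that by (rule P_lin)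
    from PN[OF this] PS[OF this] n0 show ?thesis by auto
  qed
  define V where "V = (\<lambda>x. SOME y. P x y)"
  have PV: "P x (V x)" for x unfolding V_def using P_ex by (rule someI_ex)
  have VI: "V x = y" if "P x y" for x y using P_unique[OF PV that] .
  have Vlin: "V (x + c *\<^sub>R x') = V x + c *\<^sub>R V x'" for x c x'
    by (intro VI P_lin PV)
  have "linear V"
  proof (rule linearI)
    show "V (x + y) = V x + V y" for x y using Vlin[of x 1 y] by simp
    have "V 0 = 0" using Vlin[of 0 "-1" 0] by simp
    then show "V (c *\<^sub>R x) = c *\<^sub>R V x" for c x using Vlin[of 0 c x] by simp
  qed
  moreover have "range V = S"
  proof (intro antisym subsetI)
    fix y assume "y \<in> range V" then show "y \<in> S" using PS PV by auto
  next
    fix y assume y: "y \<in> S"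
    have "\<exists>v. N (j v - y) < 1 / Suc n" for n
    proof -
      have "y \<in> mtopology closure_of (range j)" using y dense unfolding ntop_def by simp
      then have "\<forall>r>0. \<exists>z\<in>range j. z \<in> mball y r"
        unfolding metric_closure_of mem_Collect_eq by (rule conjunct2)
      then have "\<exists>z\<in>range j. z \<in> mball y (1 / Suc n)"
        by (meson of_nat_0_less_iff zero_less_Suc zero_less_divide_1_iff)
      then obtain v where "ndist S N (j v) y < 1 / Suc n"
        by (metis commute in_mball rangeE)
      then show ?thesis using y jS unfolding ndist_def by auto
    qed
    then obtain v where v: "\<And>n. N (j (v n) - y) < 1 / Suc n" by metis
    have "(\<lambda>n. N (j (v n) - y)) \<longlonglongrightarrow> 0"
    proof (rule Lim_null_comparison[OF _ LIMSEQ_inverse_real_of_nat])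
      show "\<forall>\<^sub>F n in sequentially. norm (N (j (v n) - y)) \<le> inverse (real (Suc n))"
        using v n0[OF subspace_diff[OF sub jS y]] by (auto simp: less_imp_le divide_inverse)
    qed
    then have l: "limitin (ntop S N) (\<lambda>n. j (v n)) y sequentially"
      unfolding lim using y by simp
    then have "MCauchy (\<lambda>n. j (v n))"
      by (intro convergent_imp_MCauchy[of _ y]) (auto simp: jS ntop_def)
    then have "Cauchy (\<lambda>n. L (v n))"
      unfolding MCauchy_def Cauchy_def dj by (auto 0 3)
    then obtain x where x: "(\<lambda>n. L (v n)) \<longlonglongrightarrow> x"
      using Cauchy_convergent convergentD by metis
    have "P x y" unfolding P_def by (intro exI[of _ v] conjI x l)
    then have "V x = y" by (rule VI)
    then show "y \<in> range V" by (auto intro: range_eqI[OF sym])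
  qed
  moreover have "N (V x) = norm x" for x by (rule PN[OF PV])
  moreover have "V (L v) = j v" for v
  proof (rule VI)
    have "(\<lambda>n. N (j v - j v)) \<longlonglongrightarrow> 0" using n0[OF subspace_0[OF sub]] by simp
    then show "P (L v) (j v)" unfolding P_def lim using jS by (intro exI[of _ "\<lambda>n. v"]) auto
  qed
  ultimately show ?thesis unfolding isometry_onto_def by (intro exI[of _ V]) simp
qed

section \<open>Interpolation spaces in spectral coordinates\<close>

text \<open>The smoothing of the heat semigroup: a power \<open>a\<close> of the generator costs \<open>t powr - a\<close>.\<close>

lemma powr_mult_exp_le:
  fixes x t a :: real
  assumes "0 < x" "0 < t" "0 \<le> a" "a \<le> 1"
  shows "x powr a * exp (- (x * t)) \<le> t powr - a"
proof -
  have "(x * t) powr a \<le> exp (x * t)"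
  proof (cases "x * t \<le> 1")
    case True
    then have "(x * t) powr a \<le> 1" using assms by (simp add: powr_le1)
    also have "1 \<le> exp (x * t)" using assms by simp
    finally show ?thesis .
  next
    case False
    then have "(x * t) powr a \<le> (x * t) powr 1" using assms by (intro powr_mono) auto
    also have "\<dots> = x * t" using assms by simp
    also have "\<dots> \<le> exp (x * t)" using exp_ge_add_one_self[of "x * t"] by linarith
    finally show ?thesis .
  qed
  then have "x powr a * t powr a \<le> exp (x * t)" using assms by (simp add: powr_mult)
  then show ?thesis using assms by (simp add: exp_minus powr_minus field_simps)
qed

locale interpolation = onb B for B :: "'h::{real_inner, banach, second_countable_topology} set" +
  fixes mu :: "'h \<Rightarrow> real" and \<kappa> \<delta> :: real and A :: "'h \<Rightarrow> 'h"
    and j :: "'h \<Rightarrow> 'e::real_vector" and Hs :: "real \<Rightarrow> 'e set" and nrm :: "real \<Rightarrow> 'e \<Rightarrow> real"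
  assumes eigenvalue: "b \<in> B \<Longrightarrow> b \<bullet> A b = \<kappa> - mu b"
    and \<delta>_pos: "0 < \<delta>" and mu_ge: "b \<in> B \<Longrightarrow> \<delta> \<le> mu b" and \<kappa>_nonneg: "0 \<le> \<kappa>"
    and spaces: "interpolation_spaces B (shift_op \<kappa> A) j Hs nrm"
begin

lemma mu_pos: "b \<in> B \<Longrightarrow> 0 < mu b"
  using mu_ge \<delta>_pos by (meson less_le_trans)

lemma mu_powr_cancel:
  assumes "b \<in> B"
  shows "mu b powr r * (mu b powr - r * x) = x" "mu b powr - r * (mu b powr r * x) = x"
  using mu_pos[OF assms] by (simp_all add: powr_minus)

lemma linear_j: "linear j" and inj_j: "inj j"
  using spaces unfolding interpolation_spaces_def by auto

lemma inv_j [simp]: "inv j (j v) = v"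
  using inj_j by simp

lemma shift_eigenvalue: "b \<in> B \<Longrightarrow> b \<bullet> shift_op \<kappa> A b = mu b"
  using eigenvalue inner_basis unfolding shift_op_def by (simp add: inner_diff_right)

lemma fpow_eq_dg: "fpow B (shift_op \<kappa> A) r = dg (\<lambda>b. mu b powr r)"
  unfolding fpow_def opfun_def dg_def fun_eq_iff
  by (auto intro!: infsum_cong simp: shift_eigenvalue)

lemma fpow_dom_eq: "fpow_dom B (shift_op \<kappa> A) r = {v. l2 (\<lambda>b. mu b powr r * (b \<bullet> v))}"
  unfolding fpow_dom_def opfun_dom_def l2_def
  by (intro Collect_cong summable_on_cong) (simp add: shift_eigenvalue)

lemma mu_powr_le:
  assumes "r \<le> 0" "b \<in> B"
  shows "mu b powr r \<le> \<delta> powr r"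
  using mu_ge[OF assms(2)] \<delta>_pos assms(1) by (intro powr_mono2') auto

lemma bdd_mult_mu_powr: "r \<le> 0 \<Longrightarrow> bdd_mult (\<lambda>b. mu b powr r)"
  by (rule bdd_multI[of _ "\<delta> powr r"]) (simp add: mu_powr_le)

text \<open>For \<open>r < 0\<close> this is the isometry of a completion. For \<open>r \<ge> 0\<close> the power \<open>- r\<close> is bounded, maps onto
  the domain of the power \<open>r\<close>, and \<open>j\<close> after it is the required map.\<close>

lemma coordinates_exist:
  "\<exists>V. isometry_onto V (Hs r) (nrm r) \<and> (\<forall>v. l2 (\<lambda>b. mu b powr r * (b \<bullet> v)) \<longrightarrow> V (dg (\<lambda>b. mu b powr r) v) = j v)"
proof (cases "r < 0")
  case True
  let ?L = "dg (\<lambda>b. mu b powr r)"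
  have bdd: "bdd_mult (\<lambda>b. mu b powr r)" using True by (intro bdd_mult_mu_powr) simp
  have "is_completion j (\<lambda>v. norm (?L v)) (Hs r) (nrm r)"
    using spaces True unfolding interpolation_spaces_def fpow_eq_dg by auto
  moreover have "linear ?L" using bounded_linear_dg[OF bdd] bounded_linear.linear by blast
  moreover have "closure (range ?L) = UNIV" using range_dg_dense[OF bdd] mu_pos by force
  ultimately show ?thesis using completion_coordinates[OF _ _ _ linear_j] by blast
next
  case False
  then have r: "0 \<le> r" by simp
  have bdd: "bdd_mult (\<lambda>b. mu b powr - r)" using r by (intro bdd_mult_mu_powr) simp
  let ?L = "dg (\<lambda>b. mu b powr - r)"
  have Hs_r: "Hs r = j ` {v. l2 (\<lambda>b. mu b powr r * (b \<bullet> v))}"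
    and nrm_r: "\<And>v. l2 (\<lambda>b. mu b powr r * (b \<bullet> v)) \<Longrightarrow> nrm r (j v) = norm (dg (\<lambda>b. mu b powr r) v)"
    using spaces r unfolding interpolation_spaces_def fpow_eq_dg fpow_dom_eq by auto
  have eq: "mu b powr r * (b \<bullet> ?L x) = b \<bullet> x" if "b \<in> B" for b x
    using that by (simp add: inner_dg_bdd[OF bdd] mu_powr_cancel)
  have l2L: "l2 (\<lambda>b. mu b powr r * (b \<bullet> ?L x))" for x
    using l2_inner[of x] unfolding l2_def
    by (rule summable_on_cong[THEN iffD1, rotated]) (simp add: eq)
  have inv1: "dg (\<lambda>b. mu b powr r) (?L x) = x" for x
    by (rule basis_eqI) (simp add: inner_dg[OF l2L] eq)
  have inv2: "?L (dg (\<lambda>b. mu b powr r) v) = v" if "l2 (\<lambda>b. mu b powr r * (b \<bullet> v))" for v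
    by (rule basis_eqI) (simp add: inner_dg_bdd[OF bdd] inner_dg[OF that] mu_powr_cancel)
  have "linear (\<lambda>x. j (?L x))"
    using linear_compose[OF bounded_linear.linear[OF bounded_linear_dg[OF bdd]] linear_j]
    by (simp add: comp_def)
  moreover have "range (\<lambda>x. j (?L x)) = Hs r"
  proof -
    have "range ?L = {v. l2 (\<lambda>b. mu b powr r * (b \<bullet> v))}"
      using l2L inv2 by (auto intro: range_eqI[OF sym])
    then show ?thesis unfolding Hs_r by (simp add: image_image[symmetric])
  qed
  moreover have "nrm r (j (?L x)) = norm x" for x using nrm_r[OF l2L] inv1 by simp
  ultimately show ?thesis using inv2
    unfolding isometry_onto_def by (intro exI[of _ "\<lambda>x. j (?L x)"]) auto
qed

definition V :: "real \<Rightarrow> 'h \<Rightarrow> 'e" where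
  "V r = (SOME V. isometry_onto V (Hs r) (nrm r) \<and>
     (\<forall>v. l2 (\<lambda>b. mu b powr r * (b \<bullet> v)) \<longrightarrow> V (dg (\<lambda>b. mu b powr r) v) = j v))"

lemma V_isometry: "isometry_onto (V r) (Hs r) (nrm r)"
  and V_dg: "l2 (\<lambda>b. mu b powr r * (b \<bullet> v)) \<Longrightarrow> V r (dg (\<lambda>b. mu b powr r) v) = j v"
  using someI_ex[OF coordinates_exist[of r]] unfolding V_def[symmetric] by auto

sublocale V: banach_coordinates "V r" "Hs r" "nrm r" for r
  by unfold_locales (rule V_isometry)

text \<open>This is the only way in which the coordinates of different spaces are compared: through elements of
  \<open>range j\<close>, whose coefficients are known.\<close>

lemma V_eq_j:
  assumes "\<And>b. b \<in> B \<Longrightarrow> b \<bullet> g = mu b powr r * (b \<bullet> v)"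
  shows "V r g = j v"
proof -
  have l: "l2 (\<lambda>b. mu b powr r * (b \<bullet> v))"
    using l2_inner[of g] unfolding l2_def
    by (rule summable_on_cong[THEN iffD1, rotated]) (simp add: assms)
  have "g = dg (\<lambda>b. mu b powr r) v" by (rule basis_eqI) (simp add: inner_dg[OF l] assms)
  then show ?thesis using V_dg[OF l] by simp
qed

lemma semigroup_op_eq_dg: "semigroup_op B A t = dg (\<lambda>b. exp ((\<kappa> - mu b) * t))"
  unfolding semigroup_op_def opfun_def dg_def fun_eq_iff
  by (auto intro!: infsum_cong simp: eigenvalue mult.commute)

lemma smoothing_multiplier_le:
  assumes "0 \<le> a" "a \<le> 1" "0 < t" "b \<in> B"
  shows "mu b powr a * exp ((\<kappa> - mu b) * t) \<le> exp (\<kappa> * t) * t powr - a"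
proof -
  have "mu b powr a * exp ((\<kappa> - mu b) * t) = exp (\<kappa> * t) * (mu b powr a * exp (- (mu b * t)))"
    by (simp add: left_diff_distrib exp_diff exp_minus field_simps)
  also have "\<dots> \<le> exp (\<kappa> * t) * t powr - a"
    using assms by (intro mult_left_mono powr_mult_exp_le mu_pos) auto
  finally show ?thesis .
qed

lemma bdd_mult_smoothing:
  assumes "0 \<le> a" "a \<le> 1" "0 < t"
  shows "bdd_mult (\<lambda>b. mu b powr a * exp ((\<kappa> - mu b) * t))"
  by (rule bdd_multI[of _ "exp (\<kappa> * t) * t powr - a"]) (simp add: smoothing_multiplier_le assms)

text \<open>On \<open>range j\<close> the semigroup acts on coordinates as a bounded diagonal operator, so the continuous
  extension acts in the same way on all coordinates. For \<open>t > 0\<close> the image is in \<open>range j\<close> again, because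
  the unbounded factor \<open>mu b powr - r\<close> is compensated for by the exponential.\<close>

lemma ext_semigroup_V:
  assumes r: "- 1 \<le> r" "r \<le> 0" and t: "0 < t"
  shows "ext_semigroup B A j (Hs r) (nrm r) t (V r g) = j (dg (\<lambda>b. mu b powr - r * exp ((\<kappa> - mu b) * t)) g)"
proof -
  let ?L = "dg (\<lambda>b. mu b powr r)" and ?S = "dg (\<lambda>b. exp ((\<kappa> - mu b) * t))"
    and ?z = "dg (\<lambda>b. mu b powr - r * exp ((\<kappa> - mu b) * t)) g"
  have bL: "bdd_mult (\<lambda>b. mu b powr r)" by (rule bdd_mult_mu_powr[OF r(2)])
  have bS: "bdd_mult (\<lambda>b. exp ((\<kappa> - mu b) * t))"
    using mu_pos t by (intro bdd_multI[of _ "exp (\<kappa> * t)"]) (simp add: less_imp_le)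
  have bz: "bdd_mult (\<lambda>b. mu b powr - r * exp ((\<kappa> - mu b) * t))"
    using r t by (intro bdd_mult_smoothing) auto
  have jV: "j v = V r (?L v)" for v
    by (rule V_eq_j[symmetric]) (simp add: inner_dg_bdd[OF bL])
  have comm: "?L (?S v) = ?S (?L v)" for v
    by (rule basis_eqI) (simp add: inner_dg_bdd[OF bL] inner_dg_bdd[OF bS])
  have jz: "j ?z = V r (?S g)"
    by (rule V_eq_j[symmetric])
      (simp add: inner_dg_bdd[OF bS] inner_dg_bdd[OF bz] mult.assoc mu_powr_cancel)
  have 1: "limitin (ntop (Hs r) (nrm r)) (\<lambda>n. j (?S (v n))) (j ?z) sequentially"
    if "limitin (ntop (Hs r) (nrm r)) (\<lambda>n. j (v n)) (V r g) sequentially" for v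
  proof -
    have "(\<lambda>n. ?L (v n)) \<longlonglongrightarrow> g" using that unfolding jV V.limitin_V .
    then have "(\<lambda>n. ?S (?L (v n))) \<longlonglongrightarrow> ?S g"
      by (rule bounded_linear.tendsto[OF bounded_linear_dg[OF bS]])
    then show ?thesis unfolding jz jV[of "?S _"] comm V.limitin_V .
  qed
  have "g \<in> closure (range ?L)" using range_dg_dense[OF bL] mu_pos by force
  then obtain u where u: "\<forall>n. u n \<in> range ?L" "u \<longlonglongrightarrow> g"
    unfolding closure_sequential by blast
  then have "\<forall>n. \<exists>w. u n = ?L w" by auto
  then obtain v where "\<forall>n. u n = ?L (v n)" by metis
  then have "u = (\<lambda>n. ?L (v n))" by auto
  with u have "(\<lambda>n. ?L (v n)) \<longlonglongrightarrow> g" by simp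
  then have v: "limitin (ntop (Hs r) (nrm r)) (\<lambda>n. j (v n)) (V r g) sequentially"
    unfolding jV V.limitin_V .
  show ?thesis
    unfolding ext_semigroup_def extend_op_def semigroup_op_eq_dg
  proof (rule the_equality)
    fix y assume "\<forall>v. limitin (ntop (Hs r) (nrm r)) (\<lambda>n. j (v n)) (V r g) sequentially \<longrightarrow>
      limitin (ntop (Hs r) (nrm r)) (\<lambda>n. j (?S (v n))) y sequentially"
    with v have "limitin (ntop (Hs r) (nrm r)) (\<lambda>n. j (?S (v n))) y sequentially" by blast
    moreover have "j w \<in> Hs r" for w by (simp add: jV)
    ultimately show "y = j ?z"
      using norm_on_tendsto_unique[OF V.norm_on _ _ 1[OF v]] by simp
  qed (use 1 in blast)
qed

end

section \<open>Integrals with a weakly singular kernel\<close>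

abbreviation time_measure :: "real \<Rightarrow> real measure" where
  "time_measure t \<equiv> restrict_space lborel {0<..<t}"

text \<open>The factor by which convolution with \<open>s powr - a\<close> is bounded with respect to the supremum norm with
  weight \<open>exp (- \<mu> * t)\<close>. Making it small by the choice of \<open>\<mu>\<close> replaces working on short time intervals.\<close>

definition kernel_mass :: "real \<Rightarrow> real \<Rightarrow> real \<Rightarrow> real" where
  "kernel_mass T a \<mu> = (\<integral>s. s powr - a * exp (- \<mu> * s) \<partial>time_measure T)"

lemma integrable_time_reflect:
  fixes f :: "real \<Rightarrow> 'a::{banach, second_countable_topology}"
  assumes "integrable (time_measure t) f"
  shows "integrable (time_measure t) (\<lambda>s. f (t - s))"
    and "(\<integral>s. f (t - s) \<partial>time_measure t) = (\<integral>s. f s \<partial>time_measure t)"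
proof -
  let ?g = "\<lambda>s. indicator {0<..<t} s *\<^sub>R f s"
  have g: "integrable lborel ?g" using assms by (subst (asm) integrable_restrict_space) auto
  have eq: "?g (t + (-1) * s) = indicator {0<..<t} s *\<^sub>R f (t - s)" for s
    by (auto simp: indicator_def)
  show "integrable (time_measure t) (\<lambda>s. f (t - s))"
    using lborel_integrable_real_affine[OF g, of "-1" t] unfolding eq
    by (subst integrable_restrict_space) auto
  show "(\<integral>s. f (t - s) \<partial>time_measure t) = (\<integral>s. f s \<partial>time_measure t)"
    using lborel_integral_real_affine[of "-1" ?g t] unfolding eq
    by (simp add: integral_restrict_space)
qed

lemma integrable_time_powr:
  assumes "a < 1"
  shows "integrable (time_measure t) (\<lambda>s. s powr - a)"
proof (cases "0 \<le> t")
  case True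
  have "((\<lambda>s. s powr - a) has_integral integral {0..t} (\<lambda>s. s powr - a)) {0..t}"
    using True assms by (intro integrable_integral integrable_on_powr_from_0) auto
  then have "((\<lambda>s. s powr - a) has_integral integral {0..t} (\<lambda>s. s powr - a)) {0<..<t}"
    using has_integral_Icc_iff_Ioo by blast
  then have "(\<integral>\<^sup>+s. ennreal (indicator {0<..<t} s * s powr - a) \<partial>lborel) = ennreal (integral {0..t} (\<lambda>s. s powr - a))"
    by (intro nn_integral_has_integral_lebesgue) auto
  then have "(\<integral>\<^sup>+s. ennreal (indicator {0<..<t} s * s powr - a) \<partial>lborel) < \<infinity>"
    by (simp add: ennreal_less_top)
  then have "integrable lborel (\<lambda>s. indicator {0<..<t} s * s powr - a)"
    by (intro integrableI_nonneg) auto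
  then show ?thesis by (subst integrable_restrict_space) auto
next
  case False
  then have "{0<..<t} = {}" by auto
  then show ?thesis by (subst integrable_restrict_space) auto
qed

lemma integrable_time_kernel:
  assumes "a < 1" "0 \<le> \<mu>"
  shows "integrable (time_measure t) (\<lambda>s. s powr - a * exp (- \<mu> * s))"
proof (rule Bochner_Integration.integrable_bound[OF integrable_time_powr[OF assms(1)]])
  show "(\<lambda>s. s powr - a * exp (- \<mu> * s)) \<in> borel_measurable (time_measure t)"
    by (intro measurable_restrict_space1) auto
  show "AE s in time_measure t. norm (s powr - a * exp (- \<mu> * s)) \<le> norm (s powr - a)"
    using assms(2) by (intro AE_I2) (auto simp: space_restrict_space abs_mult intro!: mult_left_le)
qed

lemma kernel_mass_small:
  assumes "a < 1" "0 < e"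
  shows "\<exists>\<mu>\<ge>0. kernel_mass T a \<mu> \<le> e"
proof -
  have "(\<lambda>n. kernel_mass T a (real n)) \<longlonglongrightarrow> (\<integral>s. 0 \<partial>time_measure T)"
    unfolding kernel_mass_def
  proof (rule integral_dominated_convergence[OF _ _ integrable_time_powr[OF assms(1)]])
    show "(\<lambda>s. s powr - a * exp (- real n * s)) \<in> borel_measurable (time_measure T)" for n
      by (intro measurable_restrict_space1) auto
    show "AE s in time_measure T. (\<lambda>n. s powr - a * exp (- real n * s)) \<longlonglongrightarrow> 0"
    proof (rule AE_I2)
      fix s assume "s \<in> space (time_measure T)"
      then have s: "0 < s" by (auto simp: space_restrict_space)
      have "(\<lambda>n. exp (- s) ^ n) \<longlonglongrightarrow> 0" using s by (intro LIMSEQ_power_zero) simp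
      moreover have "exp (- s) ^ n = exp (- real n * s)" for n
        by (simp add: exp_of_nat_mult[symmetric])
      ultimately show "(\<lambda>n. s powr - a * exp (- real n * s)) \<longlonglongrightarrow> 0"
        using tendsto_mult_right_zero by force
    qed
    show "AE s in time_measure T. norm (s powr - a * exp (- real n * s)) \<le> s powr - a" for n
      by (intro AE_I2) (auto simp: space_restrict_space abs_mult intro!: mult_left_le)
  qed auto
  then have "eventually (\<lambda>n. kernel_mass T a (real n) < e) sequentially"
    using assms(2) by (auto dest!: order_tendstoD(2)[of _ _ _ e])
  then obtain n where "kernel_mass T a (real n) < e" by (auto simp: eventually_sequentially)
  then show ?thesis by (intro exI[of _ "real n"]) auto
qed

lemma kernel_mass_contraction:
  assumes a: "a < 1" and c: "0 \<le> c"
  shows "\<exists>\<mu>\<ge>0. c * kernel_mass T a \<mu> \<le> 1/2"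
proof -
  obtain \<mu> where \<mu>: "0 \<le> \<mu>" "kernel_mass T a \<mu> \<le> 1 / (2 * (c + 1))"
    using kernel_mass_small[OF a, of "1 / (2 * (c + 1))" T] c by auto
  have "c * kernel_mass T a \<mu> \<le> c * (1 / (2 * (c + 1)))"
    using \<mu>(2) c by (rule mult_left_mono)
  also have "\<dots> \<le> 1/2" using c by (simp add: field_simps)
  finally show ?thesis using \<mu>(1) by blast
qed

lemma kernel_convolution_bound:
  assumes a: "a < 1" "0 \<le> \<mu>" and t: "t \<le> T"
  shows "integrable (time_measure t) (\<lambda>s. (t - s) powr - a * exp (\<mu> * s))"
    and "(\<integral>s. (t - s) powr - a * exp (\<mu> * s) \<partial>time_measure t) \<le> exp (\<mu> * t) * kernel_mass T a \<mu>"
proof -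
  let ?k = "\<lambda>s. s powr - a * exp (- \<mu> * s)"
  note k = integrable_time_kernel[OF a]
  have eq: "(t - s) powr - a * exp (\<mu> * s) = exp (\<mu> * t) * ?k (t - s)" for s
    by (simp add: right_diff_distrib exp_diff exp_minus field_simps)
  show "integrable (time_measure t) (\<lambda>s. (t - s) powr - a * exp (\<mu> * s))"
    unfolding eq by (intro integrable_mult_right integrable_time_reflect(1)[OF k])
  have "(\<integral>s. (t - s) powr - a * exp (\<mu> * s) \<partial>time_measure t) = exp (\<mu> * t) * (\<integral>s. ?k s \<partial>time_measure t)"
    unfolding eq using integrable_time_reflect(2)[OF k, of t] by (simp only: integral_mult_right_zero)
  also have "(\<integral>s. ?k s \<partial>time_measure t) \<le> kernel_mass T a \<mu>"
  proof -
    have "integrable lborel (\<lambda>s. indicator {0<..<r} s *\<^sub>R ?k s)" for r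
      using k[of r] by (subst (asm) integrable_restrict_space) auto
    then show ?thesis
      unfolding kernel_mass_def using t
      by (subst (1 2) integral_restrict_space) (auto intro!: integral_mono simp: indicator_def)
  qed
  finally show "(\<integral>s. (t - s) powr - a * exp (\<mu> * s) \<partial>time_measure t) \<le> exp (\<mu> * t) * kernel_mass T a \<mu>"
    by (simp add: mult_left_mono)
qed

text \<open>Two kernels are admitted because the error of the scheme stems both from approximating the semigroup
  and from the argument of the nonlinearity.\<close>

lemma norm_integral_kernel_le:
  fixes F :: "real \<Rightarrow> 'a::{banach, second_countable_topology}"
  assumes F: "has_bochner_integral (time_measure t) F y" and t: "t \<le> T"
    and a: "a\<^sub>1 < 1" "a\<^sub>2 < 1" "0 \<le> \<mu>\<^sub>1" "0 \<le> \<mu>\<^sub>2" "0 \<le> c\<^sub>1" "0 \<le> c\<^sub>2"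
    and bound: "\<And>s. 0 < s \<Longrightarrow> s < t \<Longrightarrow>
      norm (F s) \<le> c\<^sub>1 * ((t - s) powr - a\<^sub>1 * exp (\<mu>\<^sub>1 * s)) + c\<^sub>2 * ((t - s) powr - a\<^sub>2 * exp (\<mu>\<^sub>2 * s))"
  shows "norm y \<le> c\<^sub>1 * (exp (\<mu>\<^sub>1 * t) * kernel_mass T a\<^sub>1 \<mu>\<^sub>1) + c\<^sub>2 * (exp (\<mu>\<^sub>2 * t) * kernel_mass T a\<^sub>2 \<mu>\<^sub>2)"
proof -
  let ?b = "\<lambda>s. c\<^sub>1 * ((t - s) powr - a\<^sub>1 * exp (\<mu>\<^sub>1 * s)) + c\<^sub>2 * ((t - s) powr - a\<^sub>2 * exp (\<mu>\<^sub>2 * s))"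
  note k1 = kernel_convolution_bound[OF a(1,3) t] and k2 = kernel_convolution_bound[OF a(2,4) t]
  have y: "y = (\<integral>s. F s \<partial>time_measure t)" and iF: "integrable (time_measure t) F"
    using F by (auto simp: has_bochner_integral_iff)
  have "norm y \<le> (\<integral>s. norm (F s) \<partial>time_measure t)" unfolding y by (rule integral_norm_bound)
  also have "\<dots> \<le> (\<integral>s. ?b s \<partial>time_measure t)"
    using bound k1 k2 iF
    by (intro integral_mono_AE AE_I2 Bochner_Integration.integrable_add integrable_mult_right) (auto simp: space_restrict_space)
  also have "\<dots> = c\<^sub>1 * (\<integral>s. (t - s) powr - a\<^sub>1 * exp (\<mu>\<^sub>1 * s) \<partial>time_measure t)
      + c\<^sub>2 * (\<integral>s. (t - s) powr - a\<^sub>2 * exp (\<mu>\<^sub>2 * s) \<partial>time_measure t)"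
    by (subst Bochner_Integration.integral_add) (auto intro!: k1 k2)
  also have "\<dots> \<le> c\<^sub>1 * (exp (\<mu>\<^sub>1 * t) * kernel_mass T a\<^sub>1 \<mu>\<^sub>1) + c\<^sub>2 * (exp (\<mu>\<^sub>2 * t) * kernel_mass T a\<^sub>2 \<mu>\<^sub>2)"
    using k1(2) k2(2) a by (intro add_mono mult_left_mono) auto
  finally show ?thesis .
qed

section \<open>Mild integral equations\<close>

text \<open>Measurability is required for the compositions \<open>r \<mapsto> K r (g r)\<close> since only these are integrated; the
  indicator discards \<open>r \<le> 0\<close>, where \<open>K\<close> is arbitrary.\<close>

definition singular_kernel :: "(real \<Rightarrow> 'h::{banach, second_countable_topology} \<Rightarrow> 'h) \<Rightarrow> real \<Rightarrow> real \<Rightarrow> real \<Rightarrow> bool" where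
  "singular_kernel K C a T \<longleftrightarrow> 0 \<le> C \<and> 0 \<le> a \<and> a < 1 \<and>
     (\<forall>r>0. bounded_linear (K r)) \<and>
     (\<forall>r v. 0 < r \<and> r \<le> T \<longrightarrow> norm (K r v) \<le> C * r powr - a * norm v) \<and>
     (\<forall>g\<in>borel_measurable borel. (\<lambda>r. indicator {0<..} r *\<^sub>R K r (g r)) \<in> borel_measurable borel)"

definition mild_eq :: "(real \<Rightarrow> 'h::{banach, second_countable_topology} \<Rightarrow> 'h) \<Rightarrow> ('h \<Rightarrow> 'h) \<Rightarrow>
    (real \<Rightarrow> 'h) \<Rightarrow> (real \<Rightarrow> 'h) \<Rightarrow> real \<Rightarrow> bool" where
  "mild_eq K f z x t \<longleftrightarrow>
     has_bochner_integral (time_measure t) (\<lambda>s. K (t - s) (f (x s))) (x t - z t)"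

lemma singular_kernelD:
  assumes "singular_kernel K C a T"
  shows "0 \<le> C" "0 \<le> a" "a < 1" "0 < r \<Longrightarrow> bounded_linear (K r)"
    "0 < r \<Longrightarrow> r \<le> T \<Longrightarrow> norm (K r v) \<le> C * r powr - a * norm v"
    "g \<in> borel_measurable borel \<Longrightarrow> (\<lambda>r. indicator {0<..} r *\<^sub>R K r (g r)) \<in> borel_measurable borel"
  using assms unfolding singular_kernel_def by auto

text \<open>After the reflection \<open>r = t - s\<close> the kernel no longer depends on \<open>t\<close>; this is what makes
  dominated convergence in \<open>t\<close> applicable although the kernel is singular.\<close>

lemma mild_integral_reflected:
  fixes g :: "real \<Rightarrow> 'h::{banach, second_countable_topology}"
  assumes K: "singular_kernel K C a T" and g: "g \<in> borel_measurable borel" "\<And>s. norm (g s) \<le> G" and t: "t \<le> T"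
  shows "integrable (time_measure t) (\<lambda>r. K r (g (t - r)))"
    and "has_bochner_integral (time_measure t) (\<lambda>s. K (t - s) (g s)) (\<integral>r. K r (g (t - r)) \<partial>time_measure t)"
proof -
  note K' = singular_kernelD[OF K]
  have G: "0 \<le> G" using g(2)[of 0] norm_ge_zero order_trans by blast
  show i: "integrable (time_measure t) (\<lambda>r. K r (g (t - r)))"
  proof (rule Bochner_Integration.integrable_bound)
    show "integrable (time_measure t) (\<lambda>r. C * G * r powr - a)"
      by (intro integrable_mult_right integrable_time_powr K')
    have "(\<lambda>r. indicator {0<..<t} r *\<^sub>R (indicator {0<..} r *\<^sub>R K r (g (t - r)))) \<in> borel_measurable borel"
      using g(1) by (intro borel_measurable_scaleR K'(6)) auto
    also have "(\<lambda>r. indicator {0<..<t} r *\<^sub>R (indicator {0<..} r *\<^sub>R K r (g (t - r)))) = 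
        (\<lambda>r. indicator {0<..<t} r *\<^sub>R K r (g (t - r)))" by (auto simp: indicator_def)
    finally show "(\<lambda>r. K r (g (t - r))) \<in> borel_measurable (time_measure t)"
      by (subst borel_measurable_restrict_space_iff) auto
    show "AE r in time_measure t. norm (K r (g (t - r))) \<le> norm (C * G * r powr - a)"
    proof (rule AE_I2)
      fix r assume "r \<in> space (time_measure t)"
      then have r: "0 < r" "r < t" by (auto simp: space_restrict_space)
      have "norm (K r (g (t - r))) \<le> C * r powr - a * norm (g (t - r))"
        using K'(5) r t by auto
      also have "\<dots> \<le> C * r powr - a * G" using K'(1) g(2) by (intro mult_left_mono) auto
      finally show "norm (K r (g (t - r))) \<le> norm (C * G * r powr - a)"
        using K'(1) G by (simp add: abs_mult ac_simps)
    qed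
  qed
  show "has_bochner_integral (time_measure t) (\<lambda>s. K (t - s) (g s)) (\<integral>r. K r (g (t - r)) \<partial>time_measure t)"
    using integrable_time_reflect[OF i] by (simp add: has_bochner_integral_iff)
qed

lemma continuous_on_mild_integral:
  fixes g :: "real \<Rightarrow> 'h::{banach, second_countable_topology}"
  assumes K: "singular_kernel K C a T" and g: "continuous_on UNIV g" "\<And>s. norm (g s) \<le> G"
  shows "continuous_on {0..T} (\<lambda>t. \<integral>s. K (t - s) (g s) \<partial>time_measure t)"
proof (rule continuous_on_sequentiallyI)
  fix u t assume u: "\<forall>n. u n \<in> {0..T}" and t: "t \<in> {0..T}" and ut: "u \<longlonglongrightarrow> t"
  note K' = singular_kernelD[OF K]
  have gm: "g \<in> borel_measurable borel" using g(1) by (rule borel_measurable_continuous_onI)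
  have G: "0 \<le> G" using g(2)[of 0] norm_ge_zero order_trans by blast
  have eq: "(\<integral>s. K (t - s) (g s) \<partial>time_measure t) = (\<integral>r. indicator {0<..<t} r *\<^sub>R K r (g (t - r)) \<partial>lborel)"
    if "t \<in> {0..T}" for t
    using mild_integral_reflected(2)[OF K gm g(2), of t] that
    by (auto simp: has_bochner_integral_iff integral_restrict_space)
  have m: "(\<lambda>r. indicator {0<..<t} r *\<^sub>R K r (g (t - r))) \<in> borel_measurable lborel" if "t \<in> {0..T}" for t
  proof -
    have "integrable (time_measure t) (\<lambda>r. K r (g (t - r)))"
      using mild_integral_reflected(1)[OF K gm g(2), of t] that by simp
    then show ?thesis by (subst (asm) integrable_restrict_space) auto
  qed
  have "(\<lambda>n. \<integral>r. indicator {0<..<u n} r *\<^sub>R K r (g (u n - r)) \<partial>lborel) \<longlonglongrightarrow>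
    (\<integral>r. indicator {0<..<t} r *\<^sub>R K r (g (t - r)) \<partial>lborel)"
  proof (rule integral_dominated_convergence[where w="\<lambda>r. C * G * (indicator {0<..<T} r * r powr - a)"])
    show "integrable lborel (\<lambda>r. C * G * (indicator {0<..<T} r * r powr - a))"
      using integrable_time_powr[OF K'(3), of T]
      by (subst (asm) integrable_restrict_space) (auto intro: integrable_mult_right)
    show "AE r in lborel. norm (indicator {0<..<u n} r *\<^sub>R K r (g (u n - r))) \<le> C * G * (indicator {0<..<T} r * r powr - a)" for n
    proof (rule AE_I2)
      fix r
      show "norm (indicator {0<..<u n} r *\<^sub>R K r (g (u n - r))) \<le> C * G * (indicator {0<..<T} r * r powr - a)"
      proof (cases "r \<in> {0<..<u n}")
        case True
        moreover have "u n \<le> T" using u by auto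
        ultimately have r: "0 < r" "r < T" by auto
        have "norm (K r (g (u n - r))) \<le> C * r powr - a * norm (g (u n - r))" using K'(5) r by auto
        also have "\<dots> \<le> C * r powr - a * G" using K'(1) g(2) by (intro mult_left_mono) auto
        finally show ?thesis using True r by (simp add: ac_simps)
      qed (use K'(1) G in auto)
    qed
    show "AE r in lborel. (\<lambda>n. indicator {0<..<u n} r *\<^sub>R K r (g (u n - r))) \<longlonglongrightarrow> indicator {0<..<t} r *\<^sub>R K r (g (t - r))"
      using AE_lborel_singleton[of t]
    proof eventually_elim
      fix r assume rt: "r \<noteq> t"
      show "(\<lambda>n. indicator {0<..<u n} r *\<^sub>R K r (g (u n - r))) \<longlonglongrightarrow> indicator {0<..<t} r *\<^sub>R K r (g (t - r))"
      proof (cases "0 < r \<and> r < t")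
        case True
        have "(\<lambda>n. g (u n - r)) \<longlonglongrightarrow> g (t - r)"
          using g(1) by (intro continuous_on_tendsto_compose[OF g(1)] tendsto_intros ut) auto
        then have "(\<lambda>n. K r (g (u n - r))) \<longlonglongrightarrow> K r (g (t - r))"
          using True by (intro bounded_linear.tendsto[OF K'(4)]) auto
        moreover have "eventually (\<lambda>n. r < u n) sequentially"
          using order_tendstoD(1)[OF ut] True by auto
        then have "eventually (\<lambda>n. K r (g (u n - r)) = indicator {0<..<u n} r *\<^sub>R K r (g (u n - r))) sequentially"
          by eventually_elim (use True in auto)
        ultimately show ?thesis using True by (auto intro: Lim_transform_eventually)
      next
        case False
        have "eventually (\<lambda>n. r \<notin> {0<..<u n}) sequentially"
        proof (cases "0 < r")
          case True
          with False rt have "t < r" by auto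
          from order_tendstoD(2)[OF ut this] show ?thesis by eventually_elim auto
        qed auto
        then have "eventually (\<lambda>n. 0 = indicator {0<..<u n} r *\<^sub>R K r (g (u n - r))) sequentially"
          by eventually_elim auto
        then show ?thesis using False by (auto intro: Lim_transform_eventually[OF tendsto_const])
      qed
    qed
  qed (use m u t in auto)
  then show "(\<lambda>n. \<integral>s. K (u n - s) (g s) \<partial>time_measure (u n)) \<longlonglongrightarrow> (\<integral>s. K (t - s) (g s) \<partial>time_measure t)"
    using eq u t by simp
qed

text \<open>The weighted difference \<open>e\<close> attains its maximum at some \<open>t0\<close>. The contraction property gives
  \<open>e t \<le> e t0 / 2\<close> wherever both equations hold, and by continuity on the closure, so \<open>e t0 = 0\<close>. The
  equations are demanded on a dense set only, since a process satisfies its equation almost surely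
  at each single time.\<close>

lemma mild_solution_unique:
  fixes f :: "'h::{banach, second_countable_topology} \<Rightarrow> 'h"
  assumes K: "singular_kernel K C a T" and x: "continuous_on {0..T} x" and y: "continuous_on {0..T} y"
    and T: "0 \<le> T" and L: "0 \<le> L"
    and D: "D \<subseteq> {0..T}" "{0..T} \<subseteq> closure D"
    and eqs: "\<And>t. t \<in> D \<Longrightarrow> mild_eq K f z x t" "\<And>t. t \<in> D \<Longrightarrow> mild_eq K f z y t"
    and lip: "\<And>s. s \<in> {0..T} \<Longrightarrow> norm (f (x s) - f (y s)) \<le> L * norm (x s - y s)"
    and t: "t \<in> {0..T}"
  shows "x t = y t"
proof -
  note K' = singular_kernelD[OF K]
  obtain \<mu> where \<mu>: "0 \<le> \<mu>" and CLJ: "C * L * kernel_mass T a \<mu> \<le> 1/2"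
    using kernel_mass_contraction[OF K'(3) mult_nonneg_nonneg[OF K'(1) L]] by blast
  define e where "e = (\<lambda>t. exp (- \<mu> * t) * norm (x t - y t))"
  have e_cont: "continuous_on {0..T} e" unfolding e_def by (intro continuous_intros x y)
  obtain t0 where t0: "t0 \<in> {0..T}" "\<And>t. t \<in> {0..T} \<Longrightarrow> e t \<le> e t0"
    using continuous_attains_sup[OF compact_Icc _ e_cont] T by auto
  have diff: "norm (x s - y s) \<le> e t0 * exp (\<mu> * s)" if "s \<in> {0..T}" for s
    using t0(2)[OF that] unfolding e_def by (simp add: exp_minus field_simps)
  have half: "e t \<le> e t0 / 2" if t: "t \<in> D" for t
  proof -
    have tT: "0 \<le> t" "t \<le> T" using t D by auto
    have "has_bochner_integral (time_measure t) (\<lambda>s. K (t - s) (f (x s)) - K (t - s) (f (y s))) ((x t - z t) - (y t - z t))"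
      using eqs[OF t] unfolding mild_eq_def by (rule has_bochner_integral_diff)
    then have hb: "has_bochner_integral (time_measure t) (\<lambda>s. K (t - s) (f (x s)) - K (t - s) (f (y s))) (x t - y t)"
      by simp
    have "norm (x t - y t) \<le> 0 * (exp (0 * t) * kernel_mass T 0 0) + (C * L * e t0) * (exp (\<mu> * t) * kernel_mass T a \<mu>)"
    proof (rule norm_integral_kernel_le[OF hb tT(2)])
      fix s assume s: "0 < s" "s < t"
      have "norm (K (t - s) (f (x s)) - K (t - s) (f (y s))) = norm (K (t - s) (f (x s) - f (y s)))"
        using linear_diff[OF bounded_linear.linear[OF K'(4)], of "t - s"] s by simp
      also have "\<dots> \<le> C * (t - s) powr - a * norm (f (x s) - f (y s))"
        using K'(5) s tT by auto
      also have "\<dots> \<le> C * (t - s) powr - a * (L * (e t0 * exp (\<mu> * s)))"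
        using K'(1) lip[of s] diff[of s] s tT L
        by (intro mult_left_mono) (auto intro: order_trans mult_left_mono)
      finally show "norm (K (t - s) (f (x s)) - K (t - s) (f (y s))) \<le>
          0 * ((t - s) powr - 0 * exp (0 * s)) + (C * L * e t0) * ((t - s) powr - a * exp (\<mu> * s))"
        by (simp add: ac_simps)
    qed (use K' L \<mu> in \<open>auto simp: e_def\<close>)
    also have "\<dots> = (C * L * kernel_mass T a \<mu>) * (e t0 * exp (\<mu> * t))" by simp
    also have "\<dots> \<le> 1/2 * (e t0 * exp (\<mu> * t))"
      by (intro mult_right_mono CLJ) (simp add: e_def)
    finally have "exp (- \<mu> * t) * norm (x t - y t) \<le> exp (- \<mu> * t) * (1/2 * (e t0 * exp (\<mu> * t)))"
      by (intro mult_left_mono) auto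
    also have "\<dots> = e t0 / 2" by (simp add: exp_minus field_simps)
    finally show ?thesis by (simp only: e_def)
  qed
  have "closed {t \<in> {0..T}. e t \<le> e t0 / 2}"
    using continuous_on_closed_Collect_le[OF e_cont continuous_on_const, of "e t0 / 2"] by simp
  then have "closure D \<subseteq> {t \<in> {0..T}. e t \<le> e t0 / 2}"
    using half D(1) by (intro closure_minimal) auto
  then have "t0 \<in> {t \<in> {0..T}. e t \<le> e t0 / 2}" using D(2) t0(1) by blast
  then have "e t0 \<le> 0" by simp
  then have "norm (x t - y t) \<le> 0"
    using order_trans[OF diff[OF t] mult_nonpos_nonneg[of "e t0" "exp (\<mu> * t)"]] by fastforce
  then show ?thesis by simp
qed

text \<open>Banach's fixed point theorem for bounded continuous functions on the real line. The unknown is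
  \<open>exp (- \<mu> * t) *\<^sub>R x t\<close>, so that the weighted norm becomes the supremum norm, and \<open>cl\<close> extends functions
  on \<open>{0..T}\<close> by constants.\<close>

lemma mild_solution_exists:
  fixes f :: "'h::{banach, second_countable_topology} \<Rightarrow> 'h"
  assumes K: "singular_kernel K C a T" and z: "continuous_on {0..T} z" and T: "0 \<le> T"
    and L: "0 \<le> L" "\<And>u v. norm (f u - f v) \<le> L * norm (u - v)"
  shows "\<exists>x. continuous_on {0..T} x \<and> (\<forall>t\<in>{0..T}. mild_eq K f z x t)"
proof -
  note K' = singular_kernelD[OF K]
  obtain \<mu> where \<mu>: "0 \<le> \<mu>" and CLJ: "C * L * kernel_mass T a \<mu> \<le> 1/2"
    using kernel_mass_contraction[OF K'(3) mult_nonneg_nonneg[OF K'(1) L(1)]] by blast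
  have f_cont: "continuous_on S f" for S
    by (intro lipschitz_on_continuous_on[of L] lipschitz_onI) (auto simp: dist_norm L)
  define cl where "cl = (\<lambda>s. max 0 (min T s))"
  have cl: "cl s \<in> {0..T}" "s \<in> {0..T} \<Longrightarrow> cl s = s" for s using T unfolding cl_def by auto
  have cl_cont: "continuous_on UNIV cl" unfolding cl_def by (intro continuous_intros)
  define g where "g = (\<lambda>(w :: real \<Rightarrow>\<^sub>C 'h) s. f (exp (\<mu> * cl s) *\<^sub>R w s))"
  have g_cont: "continuous_on UNIV (g w)" for w
    unfolding g_def by (intro continuous_on_compose2[OF f_cont[of UNIV]] continuous_intros cl_cont) auto
  have g_bdd: "\<exists>G. \<forall>s. norm (g w s) \<le> G" for w
  proof (intro exI allI)
    fix s
    have "norm (g w s) \<le> norm (f 0) + norm (g w s - f 0)" by norm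
    also have "norm (g w s - f 0) \<le> L * norm (exp (\<mu> * cl s) *\<^sub>R w s)"
      unfolding g_def using L(2)[of "exp (\<mu> * cl s) *\<^sub>R w s" 0] by simp
    also have "\<dots> \<le> L * (exp (\<mu> * T) * norm w)"
      using cl(1)[of s] \<mu>(1) L(1) by (auto intro!: mult_left_mono mult_mono norm_bounded)
    finally show "norm (g w s) \<le> norm (f 0) + L * (exp (\<mu> * T) * norm w)" by simp
  qed
  define I where "I = (\<lambda>w t. \<integral>s. K (t - s) (g w s) \<partial>time_measure t)"
  have I_cont: "continuous_on {0..T} (I w)" for w
    using g_bdd[of w] continuous_on_mild_integral[OF K g_cont] unfolding I_def by blast
  have I_hb: "has_bochner_integral (time_measure t) (\<lambda>s. K (t - s) (g w s)) (I w t)" if "t \<in> {0..T}" for w t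
  proof -
    obtain G where "\<And>s. norm (g w s) \<le> G" using g_bdd by blast
    from mild_integral_reflected(2)[OF K borel_measurable_continuous_onI[OF g_cont] this, of t] that
    show ?thesis unfolding I_def by (auto simp: has_bochner_integral_iff)
  qed
  define P where "P = (\<lambda>w t. exp (- \<mu> * cl t) *\<^sub>R (z (cl t) + I w (cl t)))"
  have P_bcontfun: "P w \<in> bcontfun" for w
  proof -
    have c: "continuous_on {0..T} (\<lambda>t. exp (- \<mu> * t) *\<^sub>R (z t + I w t))"
      by (intro continuous_intros z I_cont)
    then have "bounded ((\<lambda>t. exp (- \<mu> * t) *\<^sub>R (z t + I w t)) ` {0..T})"
      by (intro compact_imp_bounded compact_continuous_image) auto
    then obtain b where "\<forall>y\<in>(\<lambda>t. exp (- \<mu> * t) *\<^sub>R (z t + I w t)) ` {0..T}. norm y \<le> b"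
      unfolding bounded_iff by blast
    then have "norm (exp (- \<mu> * t) *\<^sub>R (z t + I w t)) \<le> b" if "t \<in> {0..T}" for t
      using that by blast
    moreover have "continuous_on UNIV (P w)"
      unfolding P_def by (rule continuous_on_compose2[OF c cl_cont]) (use cl(1) in blast)
    ultimately show ?thesis
      using cl(1) unfolding P_def by (intro bcontfun_normI[of _ b]) auto
  qed
  have "dist (Bcontfun (P u)) (Bcontfun (P v)) \<le> 1/2 * dist u v" for u v
  proof (rule dist_bound)
    fix t'
    define t where "t = cl t'"
    have t: "0 \<le> t" "t \<le> T" using cl[of t'] unfolding t_def by auto
    have hb: "has_bochner_integral (time_measure t) (\<lambda>s. K (t - s) (g u s) - K (t - s) (g v s)) (I u t - I v t)"
      using t by (intro has_bochner_integral_diff I_hb) auto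
    have "norm (I u t - I v t) \<le> 0 * (exp (0 * t) * kernel_mass T 0 0) + (C * L * dist u v) * (exp (\<mu> * t) * kernel_mass T a \<mu>)"
    proof (rule norm_integral_kernel_le[OF hb t(2)])
      fix s assume s: "0 < s" "s < t"
      have "norm (g u s - g v s) \<le> L * norm (exp (\<mu> * cl s) *\<^sub>R u s - exp (\<mu> * cl s) *\<^sub>R v s)"
        unfolding g_def by (rule L)
      also have "\<dots> = L * (exp (\<mu> * s) * dist (u s) (v s))"
        using s t cl(2)[of s] by (simp add: scaleR_diff_right[symmetric] dist_norm)
      also have "\<dots> \<le> L * (exp (\<mu> * s) * dist u v)"
        using L(1) by (intro mult_left_mono dist_bounded) auto
      finally have gg: "norm (g u s - g v s) \<le> L * (exp (\<mu> * s) * dist u v)" .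
      have "norm (K (t - s) (g u s) - K (t - s) (g v s)) = norm (K (t - s) (g u s - g v s))"
        using linear_diff[OF bounded_linear.linear[OF K'(4)], of "t - s"] s by simp
      also have "\<dots> \<le> C * (t - s) powr - a * norm (g u s - g v s)"
        using K'(5) s t by auto
      also have "\<dots> \<le> C * (t - s) powr - a * (L * (exp (\<mu> * s) * dist u v))"
        using gg K'(1) by (intro mult_left_mono) auto
      finally show "norm (K (t - s) (g u s) - K (t - s) (g v s)) \<le>
          0 * ((t - s) powr - 0 * exp (0 * s)) + (C * L * dist u v) * ((t - s) powr - a * exp (\<mu> * s))"
        by (simp add: ac_simps)
    qed (use K' L \<mu> in auto)
    also have "\<dots> = (C * L * kernel_mass T a \<mu>) * (dist u v * exp (\<mu> * t))" by simp
    also have "\<dots> \<le> 1/2 * (dist u v * exp (\<mu> * t))" by (intro mult_right_mono CLJ) simp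
    finally have "exp (- \<mu> * t) * norm (I u t - I v t) \<le> exp (- \<mu> * t) * (1/2 * (dist u v * exp (\<mu> * t)))"
      by (intro mult_left_mono) auto
    also have "\<dots> = 1/2 * dist u v" by (simp add: exp_minus field_simps)
    also have "exp (- \<mu> * t) * norm (I u t - I v t) = dist (P u t') (P v t')"
      unfolding P_def t_def[symmetric] by (simp add: dist_norm scaleR_diff_right[symmetric])
    finally show "dist (Bcontfun (P u) t') (Bcontfun (P v) t') \<le> 1/2 * dist u v"
      by (simp add: Bcontfun_inverse[OF P_bcontfun])
  qed
  then have "\<exists>!w. Bcontfun (P w) = w"
    by (intro banach_fix_type[of "1/2"]) auto
  then obtain w where w: "Bcontfun (P w) = w" by blast
  then have w: "apply_bcontfun w t = P w t" for t
    using Bcontfun_inverse[OF P_bcontfun[of w]] by simp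
  define x where "x = (\<lambda>t. exp (\<mu> * t) *\<^sub>R w t)"
  have x_eq: "x t = z t + I w t" if "t \<in> {0..T}" for t
    unfolding x_def w P_def using cl(2)[OF that] by (simp add: exp_minus)
  have "mild_eq K f z x t" if t: "t \<in> {0..T}" for t
  proof -
    have "has_bochner_integral (time_measure t) (\<lambda>s. K (t - s) (f (x s))) (I w t)"
      using I_hb[OF t, of w]
    proof (rule has_bochner_integral_cong[THEN iffD1, rotated -1])
      show "K (t - s) (g w s) = K (t - s) (f (x s))" if "s \<in> space (time_measure t)" for s
        using that t cl(2)[of s] by (auto simp: space_restrict_space g_def x_def)
    qed auto
    then show ?thesis unfolding mild_eq_def using x_eq[OF t] by simp
  qed
  moreover have "continuous_on {0..T} x" unfolding x_def by (intro continuous_intros continuous_on_apply_bcontfun)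
  ultimately show ?thesis by blast
qed

section \<open>Convergence of the truncated exponential Euler scheme\<close>

lemma floor_divide_bounds:
  fixes h t :: real
  assumes "0 < h"
  shows "of_int \<lfloor>t / h\<rfloor> * h \<le> t" "t < of_int \<lfloor>t / h\<rfloor> * h + h"
proof -
  have "of_int \<lfloor>t / h\<rfloor> * h \<le> t / h * h" "t / h * h < (of_int \<lfloor>t / h\<rfloor> + 1) * h"
    using assms by (intro mult_right_mono mult_strict_right_mono; linarith)+
  then show "of_int \<lfloor>t / h\<rfloor> * h \<le> t" "t < of_int \<lfloor>t / h\<rfloor> * h + h"
    using assms by (simp_all add: distrib_right)
qed

lemma round_down_eq:
  assumes "0 < h"
  shows "round_down h t = of_int \<lfloor>t / h\<rfloor> * h"
  unfolding round_down_def
proof (rule Greatest_equality)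
  show "of_int \<lfloor>t / h\<rfloor> * h \<in> {..t} \<inter> range (\<lambda>k::int. of_int k * h)"
    using floor_divide_bounds[OF assms] by auto
  fix y assume "y \<in> {..t} \<inter> range (\<lambda>k::int. of_int k * h)"
  then obtain k :: int where k: "y = of_int k * h" "of_int k * h \<le> t" by auto
  then have "k \<le> \<lfloor>t / h\<rfloor>" using assms by (simp add: le_floor_iff field_simps)
  then show "y \<le> of_int \<lfloor>t / h\<rfloor> * h" using k assms by (simp add: mult_right_mono)
qed

lemma round_down_grid:
  assumes "0 < h" "0 \<le> t"
  shows "round_down h t = real (nat \<lfloor>t / h\<rfloor>) * h" "0 \<le> round_down h t" "round_down h t \<le> t" "t < round_down h t + h"
proof -
  have f: "0 \<le> \<lfloor>t / h\<rfloor>" using assms by simp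
  show "round_down h t = real (nat \<lfloor>t / h\<rfloor>) * h" using f by (simp add: round_down_eq[OF assms(1)])
  show "0 \<le> round_down h t" using f assms by (simp add: round_down_eq)
  show "round_down h t \<le> t" "t < round_down h t + h"
    using floor_divide_bounds[OF assms(1), of t] by (simp_all add: round_down_eq[OF assms(1)])
qed

definition truncated_scheme :: "(real \<Rightarrow> 'h::{banach, second_countable_topology} \<Rightarrow> 'h) \<Rightarrow> ('h \<Rightarrow> 'h) \<Rightarrow> real \<Rightarrow> real \<Rightarrow>
    (real \<Rightarrow> 'h) \<Rightarrow> (real \<Rightarrow> 'h) \<Rightarrow> real \<Rightarrow> bool" where
  "truncated_scheme K f h chi z y t \<longleftrightarrow>
     has_bochner_integral (time_measure t)
       (\<lambda>s. K (t - s) (of_bool (norm (y (round_down h s)) + norm (z (round_down h s)) \<le> h powr - chi)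
          *\<^sub>R f (y (round_down h s)))) (y t - z t)"

text \<open>The kernels \<open>K\<close> and \<open>K'\<close> belong to the semigroup and to its Galerkin projection. They are close with a
  small factor \<open>c\<close> only at the price of an exponent \<open>a'\<close> larger than \<open>a\<close>.\<close>

definition kernel_approx :: "(real \<Rightarrow> 'h::{banach, second_countable_topology} \<Rightarrow> 'h) \<Rightarrow> (real \<Rightarrow> 'h \<Rightarrow> 'h) \<Rightarrow>
    real \<Rightarrow> real \<Rightarrow> real \<Rightarrow> real \<Rightarrow> real \<Rightarrow> bool" where
  "kernel_approx K K' C a c a' T \<longleftrightarrow> a' < 1 \<and> 0 \<le> c \<and> (\<forall>r>0. bounded_linear (K' r)) \<and>
     (\<forall>r v. 0 < r \<and> r \<le> T \<longrightarrow> norm (K' r v) \<le> C * r powr - a * norm v) \<and>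
     (\<forall>r v. 0 < r \<and> r \<le> T \<longrightarrow> norm (K r v - K' r v) \<le> c * r powr - a' * norm v)"

lemma kernel_approxD:
  assumes "kernel_approx K K' C a c a' T"
  shows "a' < 1" "0 \<le> c" "0 < r \<Longrightarrow> bounded_linear (K' r)"
    "0 < r \<Longrightarrow> r \<le> T \<Longrightarrow> norm (K' r v) \<le> C * r powr - a * norm v"
    "0 < r \<Longrightarrow> r \<le> T \<Longrightarrow> norm (K r v - K' r v) \<le> c * r powr - a' * norm v"
  using assms unfolding kernel_approx_def by auto

text \<open>The error of the scheme against the solution for a globally Lipschitz nonlinearity \<open>f\<close>
  which agrees with the true one \<open>f'\<close> on a ball. The weight \<open>exp (\<mu> t)\<close>, with \<open>\<mu>\<close> so large
  that the kernel has small mass, replaces a Gronwall inequality.\<close>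

lemma scheme_error_step:
  fixes f f' :: "'h::{banach, second_countable_topology} \<Rightarrow> 'h"
  assumes K: "singular_kernel K C a T"
    and Kn: "kernel_approx K Kn C a c a' T" and \<mu>: "0 \<le> \<mu>"
    and lip: "L-lipschitz_on UNIV f" and agree: "\<forall>u. norm u \<le> R \<longrightarrow> f u = f' u"
    and h: "0 < h"
    and x: "mild_eq K f z x t" and y: "truncated_scheme Kn f' h chi z' y t" and t: "0 \<le> t" "t \<le> T"
    and G: "\<And>s. 0 < s \<Longrightarrow> s < t \<Longrightarrow> norm (f (x s)) \<le> G" "0 \<le> G"
    and w: "\<And>s. 0 < s \<Longrightarrow> s < t \<Longrightarrow> norm (x s - x (round_down h s)) \<le> w" "0 \<le> w"
    and ball: "\<And>s. 0 < s \<Longrightarrow> s < t \<Longrightarrow> norm (y (round_down h s)) \<le> R"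
    and ind: "\<And>s. 0 < s \<Longrightarrow> s < t \<Longrightarrow> norm (y (round_down h s)) + norm (z' (round_down h s)) \<le> h powr - chi"
    and E: "\<And>s. 0 < s \<Longrightarrow> s < t \<Longrightarrow> norm (x (round_down h s) - y (round_down h s)) \<le> E * exp (\<mu> * round_down h s)" "0 \<le> E"
  shows "norm (x t - y t) \<le> norm (z t - z' t) + c * G * kernel_mass T a' 0 + (C * L * kernel_mass T a \<mu>) * ((w + E) * exp (\<mu> * t))"
proof -
  note K' = singular_kernelD[OF K] and Kn' = kernel_approxD[OF Kn]
  have L: "0 \<le> L" "norm (f u - f v) \<le> L * norm (u - v)" for u v
    using lipschitz_on_nonneg[OF lip] lipschitz_onD[OF lip, of u v] by (auto simp: dist_norm)
  let ?g = "\<lambda>s. of_bool (norm (y (round_down h s)) + norm (z' (round_down h s)) \<le> h powr - chi) *\<^sub>R f' (y (round_down h s))"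
  have "has_bochner_integral (time_measure t) (\<lambda>s. K (t - s) (f (x s)) - Kn (t - s) (?g s)) ((x t - z t) - (y t - z' t))"
    using x y unfolding mild_eq_def truncated_scheme_def by (rule has_bochner_integral_diff)
  then have "norm ((x t - z t) - (y t - z' t)) \<le> c * G * (exp (0 * t) * kernel_mass T a' 0) + (C * L * (w + E)) * (exp (\<mu> * t) * kernel_mass T a \<mu>)"
  proof (rule norm_integral_kernel_le[OF _ t(2)])
    fix s assume s: "0 < s" "s < t"
    have g: "?g s = f (y (round_down h s))" using ind[OF s] agree ball[OF s] by simp
    have "norm (x s - y (round_down h s)) \<le> norm (x s - x (round_down h s)) + norm (x (round_down h s) - y (round_down h s))"
      using norm_triangle_ineq[of "x s - x (round_down h s)" "x (round_down h s) - y (round_down h s)"] by simp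
    also have "\<dots> \<le> w + E * exp (\<mu> * round_down h s)" using w(1) E(1) s by (intro add_mono) auto
    also have "\<dots> \<le> w * exp (\<mu> * s) + E * exp (\<mu> * s)"
    proof -
      have "exp (\<mu> * round_down h s) \<le> exp (\<mu> * s)" "1 \<le> exp (\<mu> * s)"
        using \<mu> s round_down_grid(3)[OF h, of s] by (auto intro: mult_left_mono)
      then show ?thesis
        using w(2) E(2) by (intro add_mono mult_left_mono) (auto simp: mult_le_cancel_left1)
    qed
    finally have 1: "norm (x s - y (round_down h s)) \<le> (w + E) * exp (\<mu> * s)" by (simp add: distrib_right)
    have "norm (f (x s) - ?g s) \<le> L * norm (x s - y (round_down h s))" unfolding g by (rule L)
    also have "\<dots> \<le> L * ((w + E) * exp (\<mu> * s))" using 1 L(1) by (rule mult_left_mono)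
    finally have 2: "norm (f (x s) - ?g s) \<le> L * ((w + E) * exp (\<mu> * s))" .
    have "K (t - s) (f (x s)) - Kn (t - s) (?g s) =
        (K (t - s) (f (x s)) - Kn (t - s) (f (x s))) + Kn (t - s) (f (x s) - ?g s)"
      using linear_diff[OF bounded_linear.linear[OF Kn'(3)], of "t - s"] s by simp
    also have "norm \<dots> \<le> c * (t - s) powr - a' * norm (f (x s)) + C * (t - s) powr - a * norm (f (x s) - ?g s)"
      using Kn'(4,5) s t by (intro norm_triangle_le add_mono) auto
    also have "\<dots> \<le> c * (t - s) powr - a' * G + C * (t - s) powr - a * (L * ((w + E) * exp (\<mu> * s)))"
      using G(1)[OF s] 2 K'(1) Kn'(2) by (intro add_mono mult_left_mono) auto
    finally show "norm (K (t - s) (f (x s)) - Kn (t - s) (?g s)) \<le>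
        c * G * ((t - s) powr - a' * exp (0 * s)) + (C * L * (w + E)) * ((t - s) powr - a * exp (\<mu> * s))"
      by (simp add: ac_simps)
  qed (use K' L Kn'(1,2) \<mu> w E G in auto)
  moreover have "norm (x t - y t) \<le> norm (z t - z' t) + norm ((x t - z t) - (y t - z' t))"
    using norm_triangle_ineq[of "z t - z' t" "(x t - z t) - (y t - z' t)"] by (simp add: algebra_simps)
  ultimately show ?thesis by (simp add: algebra_simps)
qed

text \<open>The error is propagated from grid point to grid point: the value at \<open>t\<close> depends on earlier grid values
  only, so \<open>scheme_error_step\<close> reproduces the bound \<open>E * exp (\<mu> * t)\<close>, because the factor \<open>1/2\<close> leaves room for
  the consistency errors. Once \<open>h\<close> is small, the truncation is inactive on the ball of radius \<open>R\<close>.\<close>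

lemma scheme_error_while_bounded:
  fixes f f' :: "'h::{banach, second_countable_topology} \<Rightarrow> 'h"
  assumes K: "singular_kernel K C a T" and T: "0 < T"
    and Kn: "\<And>n. kernel_approx K (Kn n) C a (c n) a' T" "c \<longlonglongrightarrow> 0" and chi: "0 < chi"
    and lip: "L-lipschitz_on UNIV f" and agree: "\<forall>u. norm u \<le> R \<longrightarrow> f u = f' u"
    and h: "\<And>n. 0 < h n" "h \<longlonglongrightarrow> 0"
    and x: "\<And>t. t \<in> {0..T} \<Longrightarrow> mild_eq K f z x t" "continuous_on {0..T} x"
    and y: "\<And>n t. t \<in> {0..T} \<Longrightarrow> truncated_scheme (Kn n) f' (h n) chi (z' n) (y n) t"
    and z: "continuous_on {0..T} z" and z': "uniform_limit {0..T} z' z sequentially" and e: "0 < e"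
  shows "\<forall>\<^sub>F n in sequentially. \<forall>t\<in>{0..T}. (\<forall>k. real k * h n < t \<longrightarrow> norm (y n (real k * h n)) \<le> R) \<longrightarrow> norm (x t - y n t) \<le> e"
proof -
  note K' = singular_kernelD[OF K]
  have L: "0 \<le> L" by (rule lipschitz_on_nonneg[OF lip])
  obtain \<mu> where \<mu>: "0 \<le> \<mu>" and CLJ: "C * L * kernel_mass T a \<mu> \<le> 1/2"
    using kernel_mass_contraction[OF K'(3) mult_nonneg_nonneg[OF K'(1) L]] by blast
  (* The consistency errors are made so small that they add up as in
     \<open>E/8 + E/8 + (E/4 + E)/2 < E\<close>. *)
  define E where "E = e * exp (- \<mu> * T)"
  have E: "0 < E" using e by (simp add: E_def)
  have f_cont: "continuous_on S f" for S
    using continuous_on_subset[OF lipschitz_on_continuous_on[OF lip]] by blast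
  have "bounded ((\<lambda>s. f (x s)) ` {0..T})"
    by (intro compact_imp_bounded compact_continuous_image continuous_on_compose2[OF f_cont[of UNIV] x(2)]) auto
  then obtain G where G: "\<And>s. s \<in> {0..T} \<Longrightarrow> norm (f (x s)) \<le> G" unfolding bounded_iff by blast
  have G0: "0 \<le> G" using order_trans[OF norm_ge_zero G[of 0]] T by simp
  have "bounded (z ` {0..T})" by (intro compact_imp_bounded compact_continuous_image z) auto
  then obtain Z where Z: "\<And>s. s \<in> {0..T} \<Longrightarrow> norm (z s) \<le> Z" unfolding bounded_iff by blast
  obtain d where d: "0 < d" "\<And>s s'. s \<in> {0..T} \<Longrightarrow> s' \<in> {0..T} \<Longrightarrow> dist s' s < d \<Longrightarrow> dist (x s') (x s) < E/4"
    using compact_uniformly_continuous[OF x(2)] E unfolding uniformly_continuous_on_def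
    by (metis compact_Icc divide_pos_pos zero_less_numeral)
  have ev1: "\<forall>\<^sub>F n in sequentially. h n < d" using h(2) d(1) by (rule order_tendstoD)
  define b where "b = max 1 (R + (Z + 1))"
  have b: "0 < b" "R + (Z + 1) \<le> b" by (auto simp: b_def)
  have "\<forall>\<^sub>F n in sequentially. h n < b powr (- 1 / chi)"
    using h(2) b(1) by (intro order_tendstoD(2)[of _ 0]) auto
  then have ev2: "\<forall>\<^sub>F n in sequentially. R + (Z + 1) \<le> h n powr - chi"
  proof eventually_elim
    case (elim n)
    then have "(b powr (- 1 / chi)) powr - chi \<le> h n powr - chi"
      using h(1)[of n] chi by (intro powr_mono2') auto
    then show ?case using b chi by (simp add: powr_powr)
  qed
  have ev3: "\<forall>\<^sub>F n in sequentially. \<forall>t\<in>{0..T}. dist (z' n t) (z t) < min 1 (E/8)"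
    using uniform_limitD[OF z', of "min 1 (E/8)"] E by simp
  have "(\<lambda>n. c n * G * kernel_mass T a' 0) \<longlonglongrightarrow> 0"
    using Kn(2) by (intro tendsto_mult_left_zero)
  then have ev4: "\<forall>\<^sub>F n in sequentially. c n * G * kernel_mass T a' 0 < E/8"
    using E by (intro order_tendstoD(2)[of _ 0]) auto
  show ?thesis
    using ev1 ev2 ev3 ev4
  proof eventually_elim
    case (elim n)
    have step: "norm (x t - y n t) \<le> E * exp (\<mu> * t)"
      if t: "t \<in> {0..T}" and ball: "\<forall>k. real k * h n < t \<longrightarrow> norm (y n (real k * h n)) \<le> R"
        and IH: "\<forall>k. real k * h n < t \<longrightarrow> norm (x (real k * h n) - y n (real k * h n)) \<le> E * exp (\<mu> * (real k * h n))" for t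
    proof -
      have rd: "\<exists>k. round_down (h n) s = real k * h n \<and> real k * h n < t \<and> round_down (h n) s \<in> {0..T} \<and> \<bar>s - round_down (h n) s\<bar> < h n"
        if "0 < s" "s < t" for s
      proof -
        have "0 \<le> s" using that by simp
        note g = round_down_grid[OF h(1)[of n] this]
        show ?thesis
          by (rule exI[of _ "nat \<lfloor>s / h n\<rfloor>"], unfold g(1)[symmetric]) (use g(2-4) that t in auto)
      qed
      have "norm (x t - y n t) \<le> norm (z t - z' n t) + c n * G * kernel_mass T a' 0 + (C * L * kernel_mass T a \<mu>) * ((E/4 + E) * exp (\<mu> * t))"
      proof (rule scheme_error_step[OF K Kn(1)[of n] \<mu> lip agree h(1) x(1)[OF t] y[OF t]])
        fix s assume s: "0 < s" "s < t"
        obtain k where k: "round_down (h n) s = real k * h n" "real k * h n < t" "round_down (h n) s \<in> {0..T}" "\<bar>s - round_down (h n) s\<bar> < h n"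
          using rd[OF s] by blast
        show "norm (f (x s)) \<le> G" using G s t by auto
        show "norm (x s - x (round_down (h n) s)) \<le> E/4"
          using d(2)[of "round_down (h n) s" s] k(3,4) s t elim(1) by (auto simp: dist_norm)
        show *: "norm (y n (round_down (h n) s)) \<le> R" using ball k by auto
        have "norm (z' n (round_down (h n) s)) \<le> norm (z (round_down (h n) s)) + dist (z' n (round_down (h n) s)) (z (round_down (h n) s))"
          by norm
        also have "\<dots> \<le> Z + 1" using Z[OF k(3)] bspec[OF elim(3) k(3)] by auto
        finally show "norm (y n (round_down (h n) s)) + norm (z' n (round_down (h n) s)) \<le> h n powr - chi"
          using * elim(2) by linarith
        show "norm (x (round_down (h n) s) - y n (round_down (h n) s)) \<le> E * exp (\<mu> * round_down (h n) s)"
          using IH k by auto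
      qed (use t E G0 in auto)
      also have "\<dots> \<le> E/8 + E/8 + 1/2 * ((E/4 + E) * exp (\<mu> * t))"
      proof (intro add_mono mult_right_mono CLJ)
        have "dist (z' n t) (z t) \<le> E/8"
          using less_le_trans[OF bspec[OF elim(3) t] min.cobounded2] by (rule less_imp_le)
        then show "norm (z t - z' n t) \<le> E/8" by (simp only: dist_norm norm_minus_commute)
      qed (use elim(4) E in auto)
      also have "\<dots> \<le> (E/8 + E/8) * exp (\<mu> * t) + 1/2 * ((E/4 + E) * exp (\<mu> * t))"
        using \<mu>(1) t E by (intro add_right_mono) (simp add: mult_le_cancel_left1)
      also have "\<dots> \<le> E * exp (\<mu> * t)" using E by (simp add: algebra_simps)
      finally show ?thesis .
    qed
    show ?case
    proof (intro ballI impI)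
      fix t assume t: "t \<in> {0..T}" and ball: "\<forall>k. real k * h n < t \<longrightarrow> norm (y n (real k * h n)) \<le> R"
      have grid: "real k * h n < t \<longrightarrow> norm (x (real k * h n) - y n (real k * h n)) \<le> E * exp (\<mu> * (real k * h n))" for k
      proof (induction k rule: less_induct)
        case (less k)
        show ?case
        proof
          assume kt: "real k * h n < t"
          show "norm (x (real k * h n) - y n (real k * h n)) \<le> E * exp (\<mu> * (real k * h n))"
          proof (rule step)
            show "real k * h n \<in> {0..T}" using kt t h(1)[of n] by auto
            show "\<forall>i. real i * h n < real k * h n \<longrightarrow> norm (y n (real i * h n)) \<le> R"
              using ball kt by auto
            show "\<forall>i. real i * h n < real k * h n \<longrightarrow> norm (x (real i * h n) - y n (real i * h n)) \<le> E * exp (\<mu> * (real i * h n))"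
            proof (intro allI impI)
              fix i assume i: "real i * h n < real k * h n"
              have "real i * h n < t" using i kt by linarith
              moreover have "i < k" using i h(1)[of n] by simp
              ultimately show "norm (x (real i * h n) - y n (real i * h n)) \<le> E * exp (\<mu> * (real i * h n))"
                using less.IH by blast
            qed
          qed
        qed
      qed
      have "norm (x t - y n t) \<le> E * exp (\<mu> * t)" using step[OF t ball] grid by blast
      also have "\<dots> \<le> E * exp (\<mu> * T)" using E \<mu>(1) t by (auto intro: mult_left_mono)
      also have "\<dots> = e" by (simp add: E_def exp_minus)
      finally show "norm (x t - y n t) \<le> e" .
    qed
  qed
qed

text \<open>Composition with this retraction makes a map that is Lipschitz on bounded sets globally Lipschitz,
  and does not change it on the ball of radius \<open>R\<close>.\<close>

definition radial_retraction :: "real \<Rightarrow> 'h::real_normed_vector \<Rightarrow> 'h" where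
  "radial_retraction R v = (R / max R (norm v)) *\<^sub>R v"

lemma radial_retraction_id: "0 < R \<Longrightarrow> norm v \<le> R \<Longrightarrow> radial_retraction R v = v"
  unfolding radial_retraction_def by simp

lemma norm_radial_retraction: "0 < R \<Longrightarrow> norm (radial_retraction R v) \<le> R"
  unfolding radial_retraction_def by (auto simp: max_def field_simps)

lemma radial_retraction_lipschitz:
  assumes R: "0 < R"
  shows "norm (radial_retraction R u - radial_retraction R v) \<le> 2 * norm (u - v)"
proof -
  define m n where "m = max R (norm u)" and "n = max R (norm v)"
  have mn: "R \<le> m" "R \<le> n" "norm v \<le> n" "0 < m" "0 < n" "\<bar>n - m\<bar> \<le> norm (u - v)"
    using R norm_triangle_ineq3[of u v] unfolding m_def n_def by auto
  have "radial_retraction R u - radial_retraction R v = (R / m) *\<^sub>R (u - v) + (R / m - R / n) *\<^sub>R v"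
    unfolding radial_retraction_def m_def n_def by (simp add: algebra_simps)
  also have "norm \<dots> \<le> R / m * norm (u - v) + \<bar>R / m - R / n\<bar> * norm v"
    using R mn by (intro norm_triangle_le) simp
  also have "R / m - R / n = R / m * ((n - m) / n)" using mn by (simp add: field_simps)
  also have "\<bar>R / m * ((n - m) / n)\<bar> * norm v = R / m * (\<bar>n - m\<bar> * (norm v / n))"
    using R mn by (simp add: abs_mult)
  also have "R / m * norm (u - v) + R / m * (\<bar>n - m\<bar> * (norm v / n)) \<le> 1 * norm (u - v) + 1 * (norm (u - v) * 1)"
    using R mn by (intro add_mono mult_mono) (auto simp: field_simps)
  finally show ?thesis by simp
qed

text \<open>A bound on a subsequence suffices: it identifies the solution of the equation with the
  nonlinearity cut off at a larger radius as a solution of the original equation, and this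
  solution in turn controls all members of the sequence.\<close>

lemma scheme_converges_if_frequently_bounded:
  fixes f :: "'h::{banach, second_countable_topology} \<Rightarrow> 'h"
  assumes K: "singular_kernel K C a T" and T: "0 < T"
    and Kn: "\<And>n. kernel_approx K (Kn n) C a (c n) a' T" "c \<longlonglongrightarrow> 0" and chi: "0 < chi"
    and f: "\<And>R. \<exists>L. \<forall>u v. norm u \<le> R \<longrightarrow> norm v \<le> R \<longrightarrow> norm (f u - f v) \<le> L * norm (u - v)"
    and h: "\<And>n. 0 < h n" "h \<longlonglongrightarrow> 0"
    and y: "\<And>n t. t \<in> {0..T} \<Longrightarrow> truncated_scheme (Kn n) f (h n) chi (z' n) (y n) t"
    and z: "continuous_on {0..T} z" and z': "uniform_limit {0..T} z' z sequentially"
    and bounded: "\<exists>\<^sub>F n in sequentially. \<forall>t\<in>{0..T}. norm (y n t) \<le> R\<^sub>0"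
  shows "\<exists>x. continuous_on {0..T} x \<and> (\<forall>t\<in>{0..T}. mild_eq K f z x t) \<and> uniform_limit {0..T} y x sequentially"
proof -
  have R0: "0 \<le> R\<^sub>0"
    using frequently_ex[OF bounded] T norm_ge_zero order_trans by (metis atLeastAtMost_iff less_imp_le order_refl)
  (* The margin 1 is what keeps the whole sequence in the ball of radius \<open>R\<close> once it is close
     to the limit, which is bounded by \<open>R\<^sub>0\<close>. *)
  define R where "R = R\<^sub>0 + 1"
  have R: "0 < R" using R0 by (simp add: R_def)
  obtain L where L: "\<And>u v. norm u \<le> R \<Longrightarrow> norm v \<le> R \<Longrightarrow> norm (f u - f v) \<le> L * norm (u - v)"
    using f[of R] by blast
  define g where "g = (\<lambda>u. f (radial_retraction R u))"
  have g_lip: "norm (g u - g v) \<le> (2 * \<bar>L\<bar>) * norm (u - v)" for u v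
  proof -
    have "norm (g u - g v) \<le> L * norm (radial_retraction R u - radial_retraction R v)"
      unfolding g_def using L norm_radial_retraction[OF R] by blast
    also have "\<dots> \<le> \<bar>L\<bar> * (2 * norm (u - v))"
      by (intro mult_mono radial_retraction_lipschitz R) auto
    finally show ?thesis by simp
  qed
  then have lip: "(2 * \<bar>L\<bar>)-lipschitz_on UNIV g"
    by (intro lipschitz_onI) (auto simp: dist_norm)
  have g_f: "\<forall>u. norm u \<le> R \<longrightarrow> g u = f u"
    by (simp add: g_def radial_retraction_id[OF R])
  obtain x where x: "continuous_on {0..T} x" "\<And>t. t \<in> {0..T} \<Longrightarrow> mild_eq K g z x t"
    using mild_solution_exists[OF K z _ _ g_lip] T by auto
  have err: "\<forall>\<^sub>F n in sequentially. \<forall>t\<in>{0..T}. (\<forall>k. real k * h n < t \<longrightarrow> norm (y n (real k * h n)) \<le> R) \<longrightarrow> norm (x t - y n t) \<le> e"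
    if e: "0 < e" for e
    by (rule scheme_error_while_bounded[OF K T Kn chi lip g_f h x(2,1) y z z' e])
  have x_bound: "norm (x t) \<le> R\<^sub>0" if t: "t \<in> {0..T}" for t
  proof (rule field_le_epsilon)
    fix e :: real assume "0 < e"
    obtain n where n: "\<forall>t\<in>{0..T}. norm (y n t) \<le> R\<^sub>0"
      "\<forall>t\<in>{0..T}. (\<forall>k. real k * h n < t \<longrightarrow> norm (y n (real k * h n)) \<le> R) \<longrightarrow> norm (x t - y n t) \<le> e"
      using frequently_ex[OF frequently_eventually_frequently[OF bounded err[OF \<open>0 < e\<close>]]] by blast
    have "norm (y n (real k * h n)) \<le> R" if "real k * h n < t" for k
      using bspec[OF n(1), of "real k * h n"] that t h(1)[of n] R_def by auto
    then have "norm (x t - y n t) \<le> e" using n(2) t by blast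
    moreover have "norm (x t) \<le> norm (y n t) + norm (x t - y n t)" by norm
    ultimately show "norm (x t) \<le> R\<^sub>0 + e" using bspec[OF n(1) t] by linarith
  qed
  have "mild_eq K f z x t" if t: "t \<in> {0..T}" for t
    using x(2)[OF t] unfolding mild_eq_def
  proof (rule has_bochner_integral_cong[THEN iffD1, rotated -1])
    fix s assume "s \<in> space (time_measure t)"
    then have "s \<in> {0..T}" using t by (auto simp: space_restrict_space)
    then show "K (t - s) (g (x s)) = K (t - s) (f (x s))"
      using x_bound[of s] g_f by (simp add: R_def)
  qed auto
  moreover have "uniform_limit {0..T} y x sequentially"
  proof (rule uniform_limitI)
    fix e :: real assume "0 < e"
    then have e: "0 < min (e/2) 1" by simp
    have "\<forall>\<^sub>F n in sequentially. \<forall>t\<in>{0..T}. (\<forall>k. real k * h n < t \<longrightarrow> norm (y n (real k * h n)) \<le> R) \<longrightarrow> norm (x t - y n t) \<le> min (e/2) 1"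
      by (rule err[OF e])
    then show "\<forall>\<^sub>F n in sequentially. \<forall>t\<in>{0..T}. dist (y n t) (x t) < e"
    proof eventually_elim
      case (elim n)
      have near: "norm (x t - y n t) \<le> min (e/2) 1" if "t \<in> {0..T}" "\<forall>k. real k * h n < t \<longrightarrow> norm (y n (real k * h n)) \<le> R" for t
        using elim that by blast
      have grid: "real k * h n \<le> T \<longrightarrow> norm (y n (real k * h n)) \<le> R" for k
      proof (induction k rule: less_induct)
        case (less k)
        show ?case
        proof
          assume kT: "real k * h n \<le> T"
          then have k: "real k * h n \<in> {0..T}" using h(1)[of n] by auto
          have "norm (x (real k * h n) - y n (real k * h n)) \<le> min (e/2) 1"
          proof (intro near[OF k] allI impI)
            fix i assume i: "real i * h n < real k * h n"
            have "real i * h n \<le> T" using i kT by linarith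
            moreover have "i < k" using i h(1)[of n] by simp
            ultimately show "norm (y n (real i * h n)) \<le> R" using less.IH by blast
          qed
          moreover have "norm (y n (real k * h n)) \<le> norm (x (real k * h n)) + norm (x (real k * h n) - y n (real k * h n))"
            by norm
          ultimately show "norm (y n (real k * h n)) \<le> R"
            using x_bound[OF k] unfolding R_def by linarith
        qed
      qed
      show ?case
      proof
        fix t assume t: "t \<in> {0..T}"
        then have "norm (x t - y n t) \<le> min (e/2) 1" using grid by (intro near) auto
        then show "dist (y n t) (x t) < e" using \<open>0 < e\<close> dist_norm[of "x t" "y n t"] dist_commute[of "x t" "y n t"] by linarith
      qed
    qed
  qed
  ultimately show ?thesis using x(1) by blast
qed

section \<open>Piecewise continuous right-hand sides\<close>

text \<open>The scheme freezes its nonlinearity between grid points, so right-hand sides jump on a finite set \<open>S\<close>.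
  The jumps affect neither integrals nor the continuity of primitives.\<close>

definition piecewise_continuous :: "real \<Rightarrow> real set \<Rightarrow> (real \<Rightarrow> real) \<Rightarrow> bool" where
  "piecewise_continuous T S g \<longleftrightarrow> finite S \<and> continuous_on ({0..T} - S) g \<and> bounded (g ` {0..T})"

lemma piecewise_continuousI:
  "finite S \<Longrightarrow> continuous_on {0..T} g \<Longrightarrow> piecewise_continuous T S g"
  unfolding piecewise_continuous_def
  by (intro conjI compact_imp_bounded compact_continuous_image continuous_on_subset[of "{0..T}" g "{0..T} - S"]) auto

lemma piecewise_continuous_mult:
  assumes "piecewise_continuous T S f" "piecewise_continuous T S g"
  shows "piecewise_continuous T S (\<lambda>t. f t * g t)"
proof -
  obtain a b where "\<forall>t\<in>{0..T}. \<bar>f t\<bar> \<le> a" "\<forall>t\<in>{0..T}. \<bar>g t\<bar> \<le> b"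
    using assms unfolding piecewise_continuous_def bounded_iff by auto
  then have "\<forall>t\<in>{0..T}. \<bar>f t * g t\<bar> \<le> a * b"
    unfolding abs_mult by (auto intro!: mult_mono intro: order_trans[OF abs_ge_zero])
  then have "bounded ((\<lambda>t. f t * g t) ` {0..T})" unfolding bounded_iff by auto
  then show ?thesis
    using assms unfolding piecewise_continuous_def by (intro conjI continuous_on_mult) simp_all
qed

lemma piecewise_continuous_add:
  assumes "piecewise_continuous T S f" "piecewise_continuous T S g"
  shows "piecewise_continuous T S (\<lambda>t. f t + g t)"
  using assms unfolding piecewise_continuous_def
  by (intro conjI continuous_on_add bounded_plus_comp) simp_all

lemma piecewise_continuous_set_integrable:
  assumes g: "piecewise_continuous T S g" and ab: "0 \<le> a" "b \<le> T"
  shows "set_integrable lborel {a..b} g"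
proof -
  let ?g = "\<lambda>t. indicator {a..b} t *\<^sub>R g t"
  have S: "finite S" and c: "continuous_on ({0..T} - S) g" using g unfolding piecewise_continuous_def by auto
  obtain G where "\<forall>x\<in>g ` {0..T}. norm x \<le> G"
    using g unfolding piecewise_continuous_def bounded_iff by blast
  then have G: "\<bar>g t\<bar> \<le> G" if "t \<in> {0..T}" for t using that by force
  have "continuous_on ({a<..<b} - S) ?g"
    by (rule continuous_on_eq[OF continuous_on_subset[OF c]]) (use ab in auto)
  moreover have "continuous_on (- {a..b} - S) ?g"
    by (rule continuous_on_eq[OF continuous_on_const[of _ 0]]) auto
  moreover have "open ({a<..<b} - S)" "open (- {a..b} - S)"
    by (intro open_Diff open_Compl open_greaterThanLessThan closed_atLeastAtMost finite_imp_closed S)+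
  ultimately have "continuous_on (({a<..<b} - S) \<union> (- {a..b} - S)) ?g"
    by (intro continuous_on_open_Un)
  then have "continuous_on (- (S \<union> {a, b})) ?g" by (rule continuous_on_subset) auto
  then have m: "?g \<in> borel_measurable borel"
    using S by (intro borel_measurable_continuous_countable_exceptions[of "S \<union> {a, b}"]) (auto intro: countable_finite)
  show ?thesis unfolding set_integrable_def
  proof (rule Bochner_Integration.integrable_bound)
    show "integrable lborel (\<lambda>t. indicator {a..b} t *\<^sub>R G)"
      by (intro integrable_real_indicator[THEN integrable_scaleR_left]) (auto simp: emeasure_lborel_Icc_eq)
    have "norm (indicator {a..b} t *\<^sub>R g t) \<le> norm (indicator {a..b} t *\<^sub>R G)" for t
      using G[of t] ab by (cases "t \<in> {a..b}") auto
    then show "AE t in lborel. norm (indicator {a..b} t *\<^sub>R g t) \<le> norm (indicator {a..b} t *\<^sub>R G)"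
      by simp
  qed (use m in simp)
qed

lemma piecewise_continuous_integral:
  assumes g: "piecewise_continuous T S g" and ab: "0 \<le> a" "b \<le> T"
  shows "g integrable_on {a..b}" "(LBINT t:{a..b}. g t) = integral {a..b} g"
  using set_borel_integral_eq_integral[OF piecewise_continuous_set_integrable[OF assms]] by auto

lemma piecewise_continuous_primitive:
  assumes g: "piecewise_continuous T S g"
  shows "continuous_on {0..T} (\<lambda>t. integral {0..t} g)"
    and "t \<in> {0<..<T} - S \<Longrightarrow> ((\<lambda>t. integral {0..t} g) has_real_derivative g t) (at t)"
proof -
  note i = piecewise_continuous_integral(1)[OF g order_refl order_refl]
  show "continuous_on {0..T} (\<lambda>t. integral {0..t} g)" by (rule indefinite_integral_continuous_1[OF i])
  assume t: "t \<in> {0<..<T} - S"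
  have S: "finite S" and c: "continuous_on ({0..T} - S) g" using g unfolding piecewise_continuous_def by auto
  have "open ({0<..<T} - S)" using S by (auto intro!: open_Diff finite_imp_closed)
  then have "t \<in> interior ({0..T} - S)" using t by (intro interiorI[of "{0<..<T} - S"]) auto
  moreover have "((\<lambda>u. integral {0..u} g) has_vector_derivative g t) (at t within ({0..T} - S))"
    using t c S by (intro integral_has_vector_derivative_continuous_at[OF i]) (auto simp: continuous_on_eq_continuous_within)
  ultimately have "((\<lambda>u. integral {0..u} g) has_vector_derivative g t) (at t)"
    using at_within_interior by metis
  then show "((\<lambda>t. integral {0..t} g) has_real_derivative g t) (at t)"
    unfolding has_real_derivative_iff_has_vector_derivative .
qed

lemma nonincreasing_off_finite:
  fixes Q :: "real \<Rightarrow> real"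
  assumes "finite S" "a \<le> b" "continuous_on {a..b} Q"
    and "\<And>t. t \<in> {a<..<b} - S \<Longrightarrow> (Q has_real_derivative Q' t) (at t)"
    and "\<And>t. t \<in> {a<..<b} - S \<Longrightarrow> Q' t \<le> 0"
  shows "Q b \<le> Q a"
proof -
  have "(Q' has_integral (Q b - Q a)) {a..b}"
    using assms(1-4) by (intro fundamental_theorem_of_calculus_interior_strong[of S])
      (auto simp: has_real_derivative_iff_has_vector_derivative)
  then have "((\<lambda>t. if t \<in> S \<union> {a, b} then 0 else Q' t) has_integral (Q b - Q a)) {a..b}"
    by (rule has_integral_spike_finite[of "S \<union> {a, b}", rotated 2]) (use assms(1) in auto)
  from has_integral_neg[OF this] have "0 \<le> - (Q b - Q a)"
    by (rule has_integral_nonneg) (use assms(5) in auto)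
  then show ?thesis by simp
qed

text \<open>With a primitive \<open>P\<close> of \<open>\<phi> + k\<close>, the function \<open>exp (- P t) * N t - \<integral> exp (- P r) * \<beta> r dr\<close> is
  nonincreasing. In the conclusion the integrals are enlarged up to \<open>T\<close>, which makes the right-hand side
  independent of \<open>t\<close>.\<close>

lemma gronwall_off_finite:
  assumes N: "continuous_on {0..T} N" "N 0 = 0"
    and \<phi>: "piecewise_continuous T S \<phi>" "\<And>s. s \<in> {0..T} \<Longrightarrow> 0 \<le> \<phi> s"
    and \<beta>: "piecewise_continuous T S \<beta>" "\<And>s. s \<in> {0..T} \<Longrightarrow> 0 \<le> \<beta> s" and k: "0 \<le> k"
    and N': "\<And>s. s \<in> {0<..<T} - S \<Longrightarrow> (N has_real_derivative N' s) (at s)"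
      "\<And>s. s \<in> {0<..<T} - S \<Longrightarrow> N' s \<le> (\<phi> s + k) * N s + \<beta> s"
    and t: "t \<in> {0..T}"
  shows "N t \<le> exp (k * T) * (LBINT r:{0..T}. exp (LBINT u:{r..T}. \<phi> u) * \<beta> r)"
proof -
  have S: "finite S" using \<phi>(1) unfolding piecewise_continuous_def by auto
  define P where "P = (\<lambda>t. integral {0..t} \<phi> + k * t)"
  have P_cont: "continuous_on {0..T} P"
    unfolding P_def by (intro continuous_intros piecewise_continuous_primitive(1)[OF \<phi>(1)])
  have P_deriv: "(P has_real_derivative \<phi> s + k) (at s)" if "s \<in> {0<..<T} - S" for s
    unfolding P_def using piecewise_continuous_primitive(2)[OF \<phi>(1) that]
    by (auto intro!: derivative_eq_intros)
  have g: "piecewise_continuous T S (\<lambda>r. exp (- P r) * \<beta> r)"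
    using S by (intro piecewise_continuous_mult \<beta>(1) piecewise_continuousI continuous_intros P_cont)
  have w: "piecewise_continuous T S (\<lambda>r. exp (integral {r..T} \<phi>) * \<beta> r)"
    using S by (intro piecewise_continuous_mult \<beta>(1) piecewise_continuousI continuous_intros
        indefinite_integral_continuous_1' piecewise_continuous_integral(1)[OF \<phi>(1)]) auto
  define Q where "Q = (\<lambda>t. exp (- P t) * N t - integral {0..t} (\<lambda>r. exp (- P r) * \<beta> r))"
  have "Q t \<le> Q 0"
  proof (rule nonincreasing_off_finite[OF S, where Q = Q and a = 0 and b = t and Q' = "\<lambda>s. exp (- P s) * N' s - exp (- P s) * (\<phi> s + k) * N s - exp (- P s) * \<beta> s"])
    show "continuous_on {0..t} Q"
      unfolding Q_def using t
      by (intro continuous_on_subset[of "{0..T}" _ "{0..t}"] continuous_intros P_cont N piecewise_continuous_primitive(1)[OF g]) auto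
    fix s assume "s \<in> {0<..<t} - S"
    then have s: "s \<in> {0<..<T} - S" using t by auto
    show "(Q has_real_derivative exp (- P s) * N' s - exp (- P s) * (\<phi> s + k) * N s - exp (- P s) * \<beta> s) (at s)"
      unfolding Q_def
      by (rule derivative_eq_intros P_deriv[OF s] N'(1)[OF s] piecewise_continuous_primitive(2)[OF g s] refl)+ (simp add: algebra_simps)
    have "exp (- P s) * (N' s - (\<phi> s + k) * N s - \<beta> s) \<le> 0"
      using N'(2)[OF s] by (intro mult_nonneg_nonpos) auto
    then show "exp (- P s) * N' s - exp (- P s) * (\<phi> s + k) * N s - exp (- P s) * \<beta> s \<le> 0"
      by (simp add: algebra_simps)
  qed (use t in auto)
  then have "exp (- P t) * N t \<le> integral {0..t} (\<lambda>r. exp (- P r) * \<beta> r)"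
    unfolding Q_def by (simp add: N(2))
  then have "N t \<le> exp (P t) * integral {0..t} (\<lambda>r. exp (- P r) * \<beta> r)"
    by (simp add: exp_minus field_simps)
  also have "\<dots> = integral {0..t} (\<lambda>r. exp (P t) * (exp (- P r) * \<beta> r))" by simp
  also have "\<dots> \<le> integral {0..t} (\<lambda>r. exp (k * T) * (exp (integral {r..T} \<phi>) * \<beta> r))"
  proof (rule integral_le)
    show "(\<lambda>r. exp (P t) * (exp (- P r) * \<beta> r)) integrable_on {0..t}"
      "(\<lambda>r. exp (k * T) * (exp (integral {r..T} \<phi>) * \<beta> r)) integrable_on {0..t}"
      using piecewise_continuous_integral(1)[OF g] piecewise_continuous_integral(1)[OF w] t
      by (auto intro!: integrable_on_cmult_left)
    fix r assume r: "r \<in> {0..t}"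
    note i = piecewise_continuous_integral(1)[OF \<phi>(1)]
    have "P t - P r = integral {r..t} \<phi> + k * (t - r)"
      using Henstock_Kurzweil_Integration.integral_combine[of 0 r t \<phi>] i[of 0 t] r t unfolding P_def by (auto simp: algebra_simps)
    also have "integral {r..t} \<phi> \<le> integral {r..T} \<phi>"
      using r t by (intro integral_subset_le i) (auto intro: \<phi>(2))
    also have "k * (t - r) \<le> k * T" using r t k by (intro mult_left_mono) auto
    finally have "exp (P t - P r) \<le> exp (k * T) * exp (integral {r..T} \<phi>)"
      by (simp add: exp_add[symmetric])
    then have "exp (P t - P r) * \<beta> r \<le> exp (k * T) * exp (integral {r..T} \<phi>) * \<beta> r"
      using \<beta>(2) r t by (intro mult_right_mono) auto
    then show "exp (P t) * (exp (- P r) * \<beta> r) \<le> exp (k * T) * (exp (integral {r..T} \<phi>) * \<beta> r)"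
      by (simp add: exp_diff exp_minus field_simps)
  qed
  also have "\<dots> = exp (k * T) * integral {0..t} (\<lambda>r. exp (integral {r..T} \<phi>) * \<beta> r)" by simp
  also have "\<dots> \<le> exp (k * T) * integral {0..T} (\<lambda>r. exp (integral {r..T} \<phi>) * \<beta> r)"
    using t \<beta>(2) by (intro mult_left_mono integral_subset_le piecewise_continuous_integral(1)[OF w]) auto
  also have "integral {0..T} (\<lambda>r. exp (integral {r..T} \<phi>) * \<beta> r) = (LBINT r:{0..T}. exp (integral {r..T} \<phi>) * \<beta> r)"
    using piecewise_continuous_integral(2)[OF w] by simp
  also have "\<dots> = (LBINT r:{0..T}. exp (LBINT u:{r..T}. \<phi> u) * \<beta> r)"
    by (intro set_lebesgue_integral_cong) (auto simp: piecewise_continuous_integral(2)[OF \<phi>(1)])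
  finally show ?thesis .
qed

text \<open>Each coefficient of the scheme is such a convolution. It solves a linear differential equation off the
  jumps of \<open>c\<close>, and variation of constants can be started at any time \<open>r\<close>.\<close>

lemma exponential_convolution:
  assumes c: "piecewise_continuous T S c"
    and y: "\<And>t. t \<in> {0..T} \<Longrightarrow> has_bochner_integral (time_measure t) (\<lambda>s. exp (- l * (t - s)) * c s) (y t)"
  shows "continuous_on {0..T} y" "0 \<le> T \<Longrightarrow> y 0 = 0"
    and "t \<in> {0<..<T} - S \<Longrightarrow> (y has_real_derivative c t - l * y t) (at t)"
    and "0 \<le> r \<Longrightarrow> r \<le> t \<Longrightarrow> t \<le> T \<Longrightarrow>
      y t = exp (- l * (t - r)) * y r + integral {r..t} (\<lambda>s. exp (- l * (t - s)) * c s)"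
proof -
  have S: "finite S" using c unfolding piecewise_continuous_def by auto
  let ?g = "\<lambda>s. exp (l * s) * c s"
  have g: "piecewise_continuous T S ?g"
    using S by (intro piecewise_continuous_mult c piecewise_continuousI continuous_intros)
  have y_eq: "y t = exp (- l * t) * integral {0..t} ?g" if t: "t \<in> {0..T}" for t
  proof -
    have "has_bochner_integral lborel (\<lambda>s. indicator {0<..<t} s *\<^sub>R (exp (- l * (t - s)) * c s)) (y t)"
      using y[OF t] by (subst (asm) has_bochner_integral_restrict_space) auto
    then have "set_integrable lborel {0<..<t} (\<lambda>s. exp (- l * (t - s)) * c s)"
      and "(LBINT s:{0<..<t}. exp (- l * (t - s)) * c s) = y t"
      by (auto simp: has_bochner_integral_iff set_integrable_def set_lebesgue_integral_def)
    then have "y t = integral {0<..<t} (\<lambda>s. exp (- l * (t - s)) * c s)"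
      using set_borel_integral_eq_integral(2) by metis
    also have "\<dots> = integral {0..t} (\<lambda>s. exp (- l * t) * ?g s)"
      unfolding integral_open_interval_real by (simp add: algebra_simps exp_diff exp_minus field_simps)
    finally show ?thesis by simp
  qed
  have "continuous_on {0..T} (\<lambda>t. exp (- l * t) * integral {0..t} ?g)"
    by (intro continuous_intros piecewise_continuous_primitive(1)[OF g])
  then show "continuous_on {0..T} y" by (rule continuous_on_eq) (simp add: y_eq)
  show "y 0 = 0" if "0 \<le> T" using y_eq[of 0] that by simp
  show "(y has_real_derivative c t - l * y t) (at t)" if t: "t \<in> {0<..<T} - S"
  proof -
    have "((\<lambda>t. exp (- l * t) * integral {0..t} ?g) has_real_derivative c t - l * (exp (- l * t) * integral {0..t} ?g)) (at t)"
      by (rule derivative_eq_intros piecewise_continuous_primitive(2)[OF g t] refl)+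
        (simp add: exp_minus field_simps)
    moreover have "\<forall>\<^sub>F s in nhds t. y s = exp (- l * s) * integral {0..s} ?g"
      using t by (intro eventually_nhds_in_open[of "{0<..<T}", THEN eventually_mono]) (auto simp: y_eq)
    ultimately show ?thesis
      using y_eq[of t] t by (subst DERIV_cong_ev[OF refl _ refl]) auto
  qed
  assume r: "0 \<le> r" "r \<le> t" "t \<le> T"
  have "integral {0..t} ?g = integral {0..r} ?g + integral {r..t} ?g"
    using r by (intro Henstock_Kurzweil_Integration.integral_combine[symmetric] piecewise_continuous_integral(1)[OF g]) auto
  then have "y t = exp (- l * t) * integral {0..r} ?g + exp (- l * t) * integral {r..t} ?g"
    using y_eq[of t] r by (simp add: algebra_simps)
  also have "exp (- l * t) * integral {0..r} ?g = exp (- l * (t - r)) * y r"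
    using y_eq[of r] r by (simp add: exp_add[symmetric] algebra_simps)
  also have "exp (- l * t) * integral {r..t} ?g = integral {r..t} (\<lambda>s. exp (- l * t) * ?g s)"
    by simp
  also have "(\<lambda>s. exp (- l * t) * ?g s) = (\<lambda>s. exp (- l * (t - s)) * c s)"
  proof -
    have "exp (- l * t) * exp (l * s) = exp (- l * (t - s))" for s
      by (simp add: exp_add[symmetric] algebra_simps)
    then show ?thesis by (simp only: mult.assoc[symmetric])
  qed
  finally show "y t = exp (- l * (t - r)) * y r + integral {r..t} (\<lambda>s. exp (- l * (t - s)) * c s)" .
qed

section \<open>Elementary estimates for the energy method\<close>

lemma powr_le_powr_scaled:
  fixes h T a b :: real
  assumes "0 < h" "h \<le> T" "b \<le> a"
  shows "h powr a \<le> T powr (a - b) * h powr b"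
proof -
  have "h powr a = h powr (a - b) * h powr b" using assms by (simp add: powr_add[symmetric])
  also have "\<dots> \<le> T powr (a - b) * h powr b"
    using assms by (intro mult_right_mono powr_mono2) auto
  finally show ?thesis .
qed

lemma one_minus_exp_le_powr:
  fixes x b :: real
  assumes "0 \<le> x" "0 \<le> b" "b \<le> 1"
  shows "1 - exp (- x) \<le> x powr b"
proof (cases "x \<le> 1")
  case True
  have "1 - exp (- x) \<le> x" using exp_ge_add_one_self[of "- x"] by simp
  also have "x \<le> x powr b"
  proof (cases "x = 0")
    case False
    then show ?thesis using powr_mono'[of b 1 x] assms True by simp
  qed simp
  finally show ?thesis .
next
  case False
  have "1 - exp (- x) \<le> 1" by simp
  also have "1 \<le> x powr b" using False assms by (simp add: ge_one_powr_ge_zero)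
  finally show ?thesis .
qed

text \<open>Regularity in time of order \<open>b\<close> costs a power \<open>b\<close> of the eigenvalue \<open>m\<close>. The shift by \<open>k\<close> changes the
  constant only, because \<open>\<tau> \<le> T\<close> and \<open>m \<ge> \<delta>\<close> allow to bound \<open>\<tau>\<close> by a multiple of \<open>(m * \<tau>) powr b\<close>.\<close>

lemma semigroup_increment_le:
  fixes m k \<tau> T b \<delta> :: real
  assumes m: "0 < \<delta>" "\<delta> \<le> m" and \<tau>: "0 \<le> \<tau>" "\<tau> \<le> T" and b: "0 \<le> b" "b \<le> 1"
  shows "\<bar>exp (- (m - k) * \<tau>) - 1\<bar> \<le> (exp (\<bar>k\<bar> * T) * (1 + \<bar>k\<bar> * (T powr (1 - b) * \<delta> powr - b))) * \<tau> powr b * m powr b"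
proof -
  have m0: "0 < m" using m by simp
  have e: "exp (k * \<tau>) \<le> exp (\<bar>k\<bar> * T)"
  proof -
    have "k * \<tau> \<le> \<bar>k\<bar> * \<tau>" using \<tau> by (intro mult_right_mono) auto
    also have "\<dots> \<le> \<bar>k\<bar> * T" using \<tau> by (intro mult_left_mono) auto
    finally show ?thesis by simp
  qed
  have "exp (- (m - k) * \<tau>) = exp (k * \<tau>) * exp (- (m * \<tau>))"
    by (simp add: exp_add[symmetric] algebra_simps)
  then have "exp (- (m - k) * \<tau>) - 1 = exp (k * \<tau>) * (exp (- (m * \<tau>)) - 1) + (exp (k * \<tau>) - 1)"
    by (simp add: algebra_simps)
  then have "\<bar>exp (- (m - k) * \<tau>) - 1\<bar> \<le> \<bar>exp (k * \<tau>) * (exp (- (m * \<tau>)) - 1)\<bar> + \<bar>exp (k * \<tau>) - 1\<bar>"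
    by (metis abs_triangle_ineq)
  also have "\<bar>exp (k * \<tau>) * (exp (- (m * \<tau>)) - 1)\<bar> = exp (k * \<tau>) * (1 - exp (- (m * \<tau>)))"
    using m0 \<tau> by (simp add: abs_mult)
  also have "\<dots> \<le> exp (\<bar>k\<bar> * T) * (m * \<tau>) powr b"
    using e one_minus_exp_le_powr[of "m * \<tau>" b] m0 \<tau> b by (intro mult_mono) auto
  also have "\<bar>exp (k * \<tau>) - 1\<bar> \<le> \<bar>k\<bar> * \<tau> * exp (\<bar>k\<bar> * T)"
  proof (cases "0 \<le> k")
    case True
    have "1 - k * \<tau> \<le> exp (- (k * \<tau>))" using exp_ge_add_one_self[of "- (k * \<tau>)"] by simp
    then have "exp (k * \<tau>) * (1 - k * \<tau>) \<le> exp (k * \<tau>) * exp (- (k * \<tau>))" by (intro mult_left_mono) auto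
    then have "exp (k * \<tau>) - 1 \<le> k * \<tau> * exp (k * \<tau>)" by (simp add: exp_minus algebra_simps)
    also have "\<dots> \<le> k * \<tau> * exp (\<bar>k\<bar> * T)" using e True \<tau> by (intro mult_left_mono) auto
    finally show ?thesis using True \<tau> by simp
  next
    case False
    have "exp (k * \<tau>) \<le> 1" using False \<tau> by (simp add: mult_nonpos_nonneg)
    then have "\<bar>exp (k * \<tau>) - 1\<bar> = 1 - exp (k * \<tau>)" by simp
    also have "\<dots> \<le> - (k * \<tau>)" using exp_ge_add_one_self[of "k * \<tau>"] by linarith
    also have "\<dots> = \<bar>k\<bar> * \<tau> * 1" using False by simp
    also have "\<dots> \<le> \<bar>k\<bar> * \<tau> * exp (\<bar>k\<bar> * T)" using \<tau> by (intro mult_left_mono) auto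
    finally show ?thesis .
  qed
  also have "\<bar>k\<bar> * \<tau> * exp (\<bar>k\<bar> * T) \<le> \<bar>k\<bar> * (T powr (1 - b) * \<delta> powr - b * (m * \<tau>) powr b) * exp (\<bar>k\<bar> * T)"
  proof -
    have "\<tau> \<le> T powr (1 - b) * \<delta> powr - b * (m * \<tau>) powr b"
    proof (cases "\<tau> = 0")
      case False
      then have t: "0 < \<tau>" using \<tau> by simp
      have "\<tau> \<le> T powr (1 - b) * \<tau> powr b" using powr_le_powr_scaled[OF t \<tau>(2) b(2)] t by simp
      also have "\<tau> powr b = \<delta> powr - b * (\<delta> powr b * \<tau> powr b)" using m(1) by (simp add: powr_minus)
      also have "T powr (1 - b) * (\<delta> powr - b * (\<delta> powr b * \<tau> powr b)) \<le> T powr (1 - b) * (\<delta> powr - b * (m powr b * \<tau> powr b))"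
        using m b by (intro mult_left_mono mult_right_mono powr_mono2) auto
      finally show ?thesis using m0 t by (simp add: powr_mult)
    qed simp
    then show ?thesis by (intro mult_left_mono mult_right_mono) auto
  qed
  finally show ?thesis using m0 \<tau> by (simp add: powr_mult algebra_simps)
qed

lemma exp_shift_le:
  fixes m k \<tau> T :: real
  assumes "0 < m" "0 \<le> \<tau>" "\<tau> \<le> T"
  shows "exp (- (m - k) * \<tau>) \<le> exp (\<bar>k\<bar> * T) * exp (- m * \<tau>)"
proof -
  have "k * \<tau> \<le> \<bar>k\<bar> * \<tau>" using assms by (intro mult_right_mono) auto
  also have "\<dots> \<le> \<bar>k\<bar> * T" using assms by (intro mult_left_mono) auto
  finally show ?thesis by (simp add: exp_add[symmetric] algebra_simps)
qed

text \<open>Integration in time gains a full power of \<open>m\<close>; what is not spent on \<open>m powr a\<close> remains as a power of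
  the length of the interval.\<close>

lemma semigroup_integral_le:
  fixes m k r t T a :: real
  assumes m: "0 < m" and t: "r \<le> t" "t - r \<le> T" and a: "0 \<le> a" "a \<le> 1"
  shows "m powr a * integral {r..t} (\<lambda>s. exp (- (m - k) * (t - s))) \<le> exp (\<bar>k\<bar> * T) * (t - r) powr (1 - a)"
    and "0 \<le> integral {r..t} (\<lambda>s. exp (- (m - k) * (t - s)))"
proof -
  have hi: "((\<lambda>s. exp (- m * (t - s))) has_integral (exp (- m * (t - t)) / m - exp (- m * (t - r)) / m)) {r..t}"
    using t m by (intro fundamental_theorem_of_calculus)
      (auto intro!: derivative_eq_intros simp: has_real_derivative_iff_has_vector_derivative[symmetric])
  have "integral {r..t} (\<lambda>s. exp (- (m - k) * (t - s))) \<le> integral {r..t} (\<lambda>s. exp (\<bar>k\<bar> * T) * exp (- m * (t - s)))"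
    using t m by (intro integral_le integrable_continuous_real continuous_intros exp_shift_le) auto
  also have "\<dots> = exp (\<bar>k\<bar> * T) * ((1 - exp (- (m * (t - r)))) / m)"
    using integral_unique[OF hi] by (simp add: diff_divide_distrib)
  also have "\<dots> \<le> exp (\<bar>k\<bar> * T) * ((m * (t - r)) powr (1 - a) / m)"
    using one_minus_exp_le_powr[of "m * (t - r)" "1 - a"] m t a by (intro mult_left_mono divide_right_mono) auto
  finally have "m powr a * integral {r..t} (\<lambda>s. exp (- (m - k) * (t - s))) \<le>
      m powr a * (exp (\<bar>k\<bar> * T) * ((m * (t - r)) powr (1 - a) / m))"
    by (intro mult_left_mono) auto
  also have "\<dots> = exp (\<bar>k\<bar> * T) * (t - r) powr (1 - a)"
    using m t by (simp add: powr_mult powr_diff)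
  finally show "m powr a * integral {r..t} (\<lambda>s. exp (- (m - k) * (t - s))) \<le> exp (\<bar>k\<bar> * T) * (t - r) powr (1 - a)" .
  show "0 \<le> integral {r..t} (\<lambda>s. exp (- (m - k) * (t - s)))"
    by (intro Henstock_Kurzweil_Integration.integral_nonneg integrable_continuous_real continuous_intros) auto
qed

lemma L2_set_le_linear_combination:
  fixes f g k :: "'i \<Rightarrow> real"
  assumes "0 \<le> A" "0 \<le> C" "\<And>b. b \<in> J \<Longrightarrow> \<bar>f b\<bar> \<le> A * \<bar>g b\<bar> + C * \<bar>k b\<bar>"
  shows "L2_set f J \<le> A * L2_set g J + C * L2_set k J"
proof -
  have "L2_set f J = L2_set (\<lambda>b. \<bar>f b\<bar>) J" unfolding L2_set_def by simp
  also have "\<dots> \<le> L2_set (\<lambda>b. A * \<bar>g b\<bar> + C * \<bar>k b\<bar>) J"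
    using assms by (intro L2_set_mono) auto
  also have "\<dots> \<le> L2_set (\<lambda>b. A * \<bar>g b\<bar>) J + L2_set (\<lambda>b. C * \<bar>k b\<bar>) J" by (rule L2_set_triangle_ineq)
  also have "\<dots> = A * L2_set g J + C * L2_set k J"
    unfolding L2_set_right_distrib[OF assms(1), symmetric] L2_set_right_distrib[OF assms(2), symmetric]
    by (simp add: L2_set_def)
  finally show ?thesis .
qed

text \<open>Minkowski's inequality for integrals, by duality: the vector of integrals is paired with itself.\<close>

lemma L2_set_integral_le:
  fixes c :: "real \<Rightarrow> 'i \<Rightarrow> real"
  assumes J: "finite J" and t: "r \<le> t" and c: "\<And>b. b \<in> J \<Longrightarrow> continuous_on {r..t} (\<lambda>s. c s b)"
    and C: "\<And>s. s \<in> {r..t} \<Longrightarrow> L2_set (c s) J \<le> C"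
  shows "L2_set (\<lambda>b. integral {r..t} (\<lambda>s. c s b)) J \<le> C * (t - r)"
proof -
  let ?v = "\<lambda>b. integral {r..t} (\<lambda>s. c s b)"
  let ?n = "L2_set ?v J"
  have "?n * ?n = (\<Sum>b\<in>J. ?v b * ?v b)"
    by (simp add: L2_set_def sum_nonneg power2_eq_square[symmetric])
  also have "\<dots> = (\<Sum>b\<in>J. integral {r..t} (\<lambda>s. ?v b * c s b))" by simp
  also have "\<dots> = integral {r..t} (\<lambda>s. \<Sum>b\<in>J. ?v b * c s b)"
    using J c by (intro Henstock_Kurzweil_Integration.integral_sum[symmetric] integrable_continuous_real continuous_intros) auto
  also have "\<dots> \<le> integral {r..t} (\<lambda>s. ?n * C)"
  proof (rule integral_le)
    show "(\<lambda>s. \<Sum>b\<in>J. ?v b * c s b) integrable_on {r..t}"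
      using c by (intro integrable_continuous_real continuous_intros) auto
    show "(\<lambda>s. ?n * C) integrable_on {r..t}" by (intro integrable_continuous_real continuous_intros)
    fix s assume s: "s \<in> {r..t}"
    have "(\<Sum>b\<in>J. ?v b * c s b) \<le> (\<Sum>b\<in>J. \<bar>?v b\<bar> * \<bar>c s b\<bar>)"
      by (intro sum_mono) (simp add: abs_mult[symmetric])
    also have "\<dots> \<le> ?n * L2_set (c s) J" by (rule L2_set_mult_ineq)
    also have "\<dots> \<le> ?n * C" using C[OF s] by (intro mult_left_mono) auto
    finally show "(\<Sum>b\<in>J. ?v b * c s b) \<le> ?n * C" .
  qed
  also have "\<dots> = ?n * (C * (t - r))" using t by simp
  finally have "?n * ?n \<le> ?n * (C * (t - r))" .
  moreover have "0 \<le> C * (t - r)" using C[of r] t by (intro mult_nonneg_nonneg order_trans[OF L2_set_nonneg C[of r]]) auto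
  ultimately show ?thesis
    by (cases "?n = 0") (auto simp: mult_le_cancel_left L2_set_nonneg less_le)
qed

text \<open>The dissipation \<open>\<Sum> p b (z b)\<^sup>2\<close> absorbs both the coercivity defect and the error committed by
  evaluating the nonlinearity at the last grid point \<open>x\<^sub>r = z\<^sub>r + q\<close> instead of \<open>z + q\<close>.\<close>

lemma coercivity_with_frozen_argument:
  fixes F :: "('i \<Rightarrow> real) \<Rightarrow> 'i \<Rightarrow> real" and m p z zr q :: "'i \<Rightarrow> real" and J :: "'i set"
  defines "nrm \<equiv> \<lambda>s (v :: 'i \<Rightarrow> real). L2_set (\<lambda>b. m b powr s * v b) J"
  assumes J: "finite J" and \<delta>: "0 < \<delta>" "\<And>b. b \<in> J \<Longrightarrow> \<delta> \<le> m b"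
    and p: "\<And>b. b \<in> J \<Longrightarrow> 0 < p b" "\<And>b. b \<in> J \<Longrightarrow> m b \<le> c\<^sub>0 * p b" "0 < c\<^sub>0"
    and \<alpha>: "0 \<le> \<alpha>" "\<alpha> \<le> 1/2" and \<phi>': "\<phi>' < 1" and \<theta>: "0 \<le> \<theta>" "0 \<le> vartheta"
    and coercive: "(\<Sum>b\<in>J. z b * F (\<lambda>b. z b + q b) b) \<le> f * (\<Sum>b\<in>J. (z b)\<^sup>2) + \<phi>' * (\<Sum>b\<in>J. p b * (z b)\<^sup>2) + g"
    and lip: "\<And>v w. nrm (- \<alpha>) (\<lambda>b. F v b - F w b) \<le> \<theta> * (1 + nrm \<rho> v powr vartheta + nrm \<rho> w powr vartheta) * nrm \<rho> (\<lambda>b. v b - w b)"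
    and X: "nrm \<rho> (\<lambda>b. zr b + q b) \<le> X" and d: "nrm \<rho> (\<lambda>b. z b - zr b) \<le> d"
    and E: "\<theta> * (1 + X powr vartheta + (X + d) powr vartheta) * d \<le> E"
  shows "(\<Sum>b\<in>J. z b * F (\<lambda>b. zr b + q b) b) \<le>
    f * (\<Sum>b\<in>J. (z b)\<^sup>2) + (\<Sum>b\<in>J. p b * (z b)\<^sup>2) + g + \<delta> powr (2 * \<alpha> - 1) * c\<^sub>0 / (4 * (1 - \<phi>')) * E\<^sup>2"
proof -
  define A where "A = (\<Sum>b\<in>J. p b * (z b)\<^sup>2)"
  define c where "c = \<delta> powr (2 * \<alpha> - 1) * c\<^sub>0"
  have c: "0 < c" using \<delta> p(3) by (simp add: c_def)
  have nn: "0 \<le> nrm s v" for s v by (simp add: nrm_def)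
  define D where "D = nrm (- \<alpha>) (\<lambda>b. F (\<lambda>b. zr b + q b) b - F (\<lambda>b. z b + q b) b)"
  have D0: "0 \<le> D" by (simp add: D_def nn)
  have X0: "0 \<le> X" and d0: "0 \<le> d" using X d nn order_trans by blast+
  have "nrm \<rho> (\<lambda>b. z b + q b) \<le> nrm \<rho> (\<lambda>b. zr b + q b) + nrm \<rho> (\<lambda>b. z b - zr b)"
  proof -
    have eq: "(\<lambda>b. m b powr \<rho> * (z b + q b)) = (\<lambda>b. m b powr \<rho> * (zr b + q b) + m b powr \<rho> * (z b - zr b))"
      by (simp add: algebra_simps)
    show ?thesis unfolding nrm_def eq by (rule L2_set_triangle_ineq)
  qed
  then have Y: "nrm \<rho> (\<lambda>b. z b + q b) \<le> X + d" using X d by linarith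
  have "nrm \<rho> (\<lambda>b. (zr b + q b) - (z b + q b)) = nrm \<rho> (\<lambda>b. z b - zr b)"
    unfolding nrm_def L2_set_def by (simp add: power_mult_distrib power2_commute)
  then have "D \<le> \<theta> * (1 + nrm \<rho> (\<lambda>b. zr b + q b) powr vartheta + nrm \<rho> (\<lambda>b. z b + q b) powr vartheta) * nrm \<rho> (\<lambda>b. z b - zr b)"
    using lip[of "\<lambda>b. zr b + q b" "\<lambda>b. z b + q b"] unfolding D_def by simp
  also have "\<dots> \<le> \<theta> * (1 + X powr vartheta + (X + d) powr vartheta) * d"
    using X Y d \<theta> nn by (intro mult_mono add_mono powr_mono2) (auto intro!: mult_nonneg_nonneg add_nonneg_nonneg)
  finally have DE: "D \<le> E" using E by linarith
  have za: "(nrm \<alpha> z)\<^sup>2 \<le> c * A"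
  proof -
    have "(nrm \<alpha> z)\<^sup>2 = (\<Sum>b\<in>J. m b powr (2 * \<alpha>) * (z b)\<^sup>2)"
      unfolding nrm_def L2_set_def
      by (simp add: sum_nonneg power_mult_distrib power2_eq_square[of "_ powr _"] powr_add[symmetric])
    also have "\<dots> \<le> (\<Sum>b\<in>J. c * (p b * (z b)\<^sup>2))"
    proof (rule sum_mono)
      fix b assume b: "b \<in> J"
      have m: "0 < m b" using \<delta> b by (meson less_le_trans)
      have "m b powr (2 * \<alpha>) = m b powr (2 * \<alpha> - 1) * m b" using m by (simp add: powr_diff)
      also have "\<dots> \<le> \<delta> powr (2 * \<alpha> - 1) * (c\<^sub>0 * p b)"
        using \<delta> b \<alpha> p m by (intro mult_mono powr_mono2') auto
      finally have "m b powr (2 * \<alpha>) \<le> c * p b" by (simp add: c_def)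
      then show "m b powr (2 * \<alpha>) * (z b)\<^sup>2 \<le> c * (p b * (z b)\<^sup>2)"
        by (metis mult.assoc mult_right_mono zero_le_power2)
    qed
    finally show ?thesis by (simp add: A_def sum_distrib_left)
  qed
  have "(\<Sum>b\<in>J. z b * (F (\<lambda>b. zr b + q b) b - F (\<lambda>b. z b + q b) b)) \<le> nrm \<alpha> z * D"
  proof -
    have "(\<Sum>b\<in>J. z b * (F (\<lambda>b. zr b + q b) b - F (\<lambda>b. z b + q b) b)) \<le>
        (\<Sum>b\<in>J. \<bar>m b powr \<alpha> * z b\<bar> * \<bar>m b powr - \<alpha> * (F (\<lambda>b. zr b + q b) b - F (\<lambda>b. z b + q b) b)\<bar>)"
    proof (rule sum_mono)
      fix b assume b: "b \<in> J"
      have m: "0 < m b" using \<delta> b by (meson less_le_trans)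
      have "z b * e \<le> \<bar>m b powr \<alpha> * z b\<bar> * \<bar>m b powr - \<alpha> * e\<bar>" for e
      proof -
        have "\<bar>m b powr \<alpha> * z b\<bar> * \<bar>m b powr - \<alpha> * e\<bar> = \<bar>z b * e\<bar>"
          using m by (simp add: abs_mult powr_minus field_simps)
        then show ?thesis by simp
      qed
      then show "z b * (F (\<lambda>b. zr b + q b) b - F (\<lambda>b. z b + q b) b) \<le>
          \<bar>m b powr \<alpha> * z b\<bar> * \<bar>m b powr - \<alpha> * (F (\<lambda>b. zr b + q b) b - F (\<lambda>b. z b + q b) b)\<bar>" .
    qed
    also have "\<dots> \<le> nrm \<alpha> z * D" unfolding nrm_def D_def by (rule L2_set_mult_ineq)
    finally show ?thesis .
  qed
  also have "nrm \<alpha> z * D \<le> (1 - \<phi>') * A + c / (4 * (1 - \<phi>')) * D\<^sup>2"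
  proof -
    (* Young's inequality, with the weight chosen such that exactly the part \<open>(1 - \<phi>') * A\<close> of the
       dissipation that the coercivity condition leaves over is used up. *)
    define e where "e = (1 - \<phi>') / c"
    have e: "0 < e" using \<phi>' c by (simp add: e_def)
    have "0 \<le> (2 * e * nrm \<alpha> z - D)\<^sup>2" by simp
    then have "4 * e * (nrm \<alpha> z * D) \<le> 4 * e * (e * (nrm \<alpha> z)\<^sup>2) + D\<^sup>2" by (simp add: power2_eq_square algebra_simps)
    then have "nrm \<alpha> z * D \<le> e * (nrm \<alpha> z)\<^sup>2 + D\<^sup>2 / (4 * e)" using e by (simp add: field_simps)
    also have "e * (nrm \<alpha> z)\<^sup>2 \<le> e * (c * A)" using za e by (intro mult_left_mono) auto
    finally show ?thesis using c \<phi>' by (simp add: e_def mult.commute)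
  qed
  also have "c / (4 * (1 - \<phi>')) * D\<^sup>2 \<le> c / (4 * (1 - \<phi>')) * E\<^sup>2"
    using DE D0 c \<phi>' by (intro mult_left_mono power_mono) auto
  finally have "(\<Sum>b\<in>J. z b * F (\<lambda>b. zr b + q b) b) - (\<Sum>b\<in>J. z b * F (\<lambda>b. z b + q b) b) \<le>
      (1 - \<phi>') * A + c / (4 * (1 - \<phi>')) * E\<^sup>2"
    by (simp add: sum_subtractf algebra_simps)
  then show ?thesis using coercive unfolding A_def[symmetric] c_def[symmetric] by (simp add: algebra_simps)
qed

text \<open>The truncation level \<open>h powr - chi\<close> is chosen such that the gain \<open>h powr (chi vartheta)\<close> in the increment of
  the scheme over one step compensates for the local Lipschitz constant.\<close>

lemma truncation_balances_lipschitz: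
  fixes T chi vartheta \<beta> \<sigma> :: real
  assumes T: "0 < T" and vartheta: "0 < vartheta" and chi: "0 < chi" "chi * (1 + vartheta) \<le> \<beta>" "chi * (1 + 2 * vartheta) \<le> \<sigma>" and \<beta>: "\<beta> \<le> 1"
    and c: "0 \<le> c\<^sub>1" "0 \<le> c\<^sub>2" "0 \<le> c\<^sub>3" "0 \<le> c\<^sub>4" "0 \<le> a\<^sub>0" "0 \<le> a\<^sub>1" "0 \<le> D" "0 \<le> \<theta>"
  shows "\<exists>C\<ge>0. \<forall>h. 0 < h \<longrightarrow> h \<le> T \<longrightarrow>
    (let X = D * h powr - chi;
         d = c\<^sub>1 * h powr \<beta> * h powr - chi + c\<^sub>2 * h powr \<sigma> * (a\<^sub>0 + a\<^sub>1 * (1 + X powr vartheta) * X) + c\<^sub>3 * h powr \<beta> + c\<^sub>4 * h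
     in \<theta> * (1 + X powr vartheta + (X + d) powr vartheta) * d \<le> C)"
proof -
  define g where "g = chi * vartheta"
  define k\<^sub>1 where "k\<^sub>1 = T powr (\<beta> - chi - g)"
  define k\<^sub>2 where "k\<^sub>2 = T powr (\<sigma> - g)"
  define k\<^sub>3 where "k\<^sub>3 = T powr (\<sigma> - chi - g)"
  define k\<^sub>4 where "k\<^sub>4 = T powr (\<sigma> - chi - g - g)"
  define k\<^sub>5 where "k\<^sub>5 = T powr (\<beta> - g)"
  define k\<^sub>6 where "k\<^sub>6 = T powr (1 - g)"
  define k\<^sub>7 where "k\<^sub>7 = T powr (g + chi)"
  define M where "M = c\<^sub>1 * k\<^sub>1 + c\<^sub>2 * (a\<^sub>0 * k\<^sub>2 + a\<^sub>1 * (D * k\<^sub>3 + D powr vartheta * D * k\<^sub>4)) + c\<^sub>3 * k\<^sub>5 + c\<^sub>4 * k\<^sub>6"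
  have M: "0 \<le> M" unfolding M_def k\<^sub>1_def k\<^sub>2_def k\<^sub>3_def k\<^sub>4_def k\<^sub>5_def k\<^sub>6_def using c by (intro add_nonneg_nonneg mult_nonneg_nonneg) auto
  define C where "C = \<theta> * (T powr g + D powr vartheta + (D + M * k\<^sub>7) powr vartheta) * M"
  have C: "0 \<le> C" unfolding C_def using c M by (intro mult_nonneg_nonneg add_nonneg_nonneg) auto
  have g0: "0 < g" using chi vartheta by (simp add: g_def)
  have exps: "g \<le> \<beta> - chi" "g \<le> \<sigma> - chi - g" "g \<le> \<sigma> - chi" "g \<le> \<sigma>" "g \<le> \<beta>" "g \<le> 1" "- chi \<le> g"
    using chi \<beta> g0 by (auto simp: g_def algebra_simps)
  have "\<theta> * (1 + X powr vartheta + (X + d) powr vartheta) * d \<le> C"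
    if h: "0 < h" "h \<le> T" and X: "X = D * h powr - chi"
      and d: "d = c\<^sub>1 * h powr \<beta> * h powr - chi + c\<^sub>2 * h powr \<sigma> * (a\<^sub>0 + a\<^sub>1 * (1 + X powr vartheta) * X) + c\<^sub>3 * h powr \<beta> + c\<^sub>4 * h" for h X d
  proof -
    note le = powr_le_powr_scaled[OF h]
    have X0: "0 \<le> X" using X c by simp
    have Xp: "X powr vartheta = D powr vartheta * h powr - g"
      unfolding X using c h by (simp add: powr_mult powr_powr g_def)
    have "d = c\<^sub>1 * h powr (\<beta> - chi) + c\<^sub>2 * (a\<^sub>0 * h powr \<sigma> + a\<^sub>1 * (D * h powr (\<sigma> - chi) + D powr vartheta * D * h powr (\<sigma> - chi - g))) + c\<^sub>3 * h powr \<beta> + c\<^sub>4 * h powr 1"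
      unfolding d Xp unfolding X using h by (simp add: powr_diff powr_minus powr_add field_simps)
    also have "\<dots> \<le> c\<^sub>1 * (k\<^sub>1 * h powr g) + c\<^sub>2 * (a\<^sub>0 * (k\<^sub>2 * h powr g) + a\<^sub>1 * (D * (k\<^sub>3 * h powr g) + D powr vartheta * D * (k\<^sub>4 * h powr g))) + c\<^sub>3 * (k\<^sub>5 * h powr g) + c\<^sub>4 * (k\<^sub>6 * h powr g)"
      unfolding k\<^sub>1_def k\<^sub>2_def k\<^sub>3_def k\<^sub>4_def k\<^sub>5_def k\<^sub>6_def
      using c exps by (intro add_mono mult_left_mono le) auto
    also have "\<dots> = M * h powr g" by (simp add: M_def algebra_simps)
    finally have dM: "d \<le> M * h powr g" .
    have d0: "0 \<le> d" unfolding d using c h X0 by (intro add_nonneg_nonneg mult_nonneg_nonneg) auto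
    have "M * h powr g \<le> M * (k\<^sub>7 * h powr - chi)"
      using le[OF exps(7)] M unfolding k\<^sub>7_def by (intro mult_left_mono) auto
    then have "X + d \<le> D * h powr - chi + M * (k\<^sub>7 * h powr - chi)"
      unfolding X using dM by linarith
    also have "\<dots> = (D + M * k\<^sub>7) * h powr - chi" by (simp add: algebra_simps)
    finally have "(X + d) powr vartheta \<le> ((D + M * k\<^sub>7) * h powr - chi) powr vartheta"
      using X0 d0 vartheta by (intro powr_mono2) auto
    also have "\<dots> = (D + M * k\<^sub>7) powr vartheta * h powr - g"
      using c M h by (simp add: powr_mult powr_powr g_def k\<^sub>7_def)
    finally have Xd: "(X + d) powr vartheta \<le> (D + M * k\<^sub>7) powr vartheta * h powr - g" .
    have one: "1 \<le> T powr g * h powr - g"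
      using le[of "- g" 0] g0 h by simp
    have "\<theta> * (1 + X powr vartheta + (X + d) powr vartheta) * d \<le>
        \<theta> * (T powr g * h powr - g + D powr vartheta * h powr - g + (D + M * k\<^sub>7) powr vartheta * h powr - g) * (M * h powr g)"
      using one Xd Xp dM d0 c by (intro mult_mono add_mono) (auto intro!: mult_nonneg_nonneg add_nonneg_nonneg)
    also have "\<dots> = C * (h powr - g * h powr g)" by (simp add: C_def algebra_simps)
    also have "\<dots> = C" using h by (simp add: powr_minus)
    finally show ?thesis .
  qed
  then show ?thesis using C unfolding Let_def by blast
qed

section \<open>The energy estimate\<close>

definition grid :: "real \<Rightarrow> real \<Rightarrow> real set" where
  "grid T h = (\<lambda>k. real k * h) ` {..nat \<lfloor>T / h\<rfloor>}"

lemma round_down_in_grid: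
  assumes "0 < h" "t \<in> {0..T}"
  shows "round_down h t \<in> grid T h"
proof -
  have "\<lfloor>t / h\<rfloor> \<le> \<lfloor>T / h\<rfloor>" using assms by (intro floor_mono divide_right_mono) auto
  then show ?thesis
    using round_down_grid(1)[of h t] assms unfolding grid_def
    by (intro image_eqI[of _ _ "nat \<lfloor>t / h\<rfloor>"]) (simp_all only: atMost_iff nat_mono atLeastAtMost_iff)
qed

lemma round_down_const:
  assumes "0 < h" "0 \<le> t" "round_down h t \<le> s" "s < round_down h t + h"
  shows "round_down h s = round_down h t"
proof -
  define k where "k = \<lfloor>t / h\<rfloor>"
  have "of_int k * h \<le> s" "s < (of_int k + 1) * h"
    using assms unfolding round_down_eq[OF assms(1)] k_def by (auto simp: distrib_right)
  then have "of_int k \<le> s / h" "s / h < of_int k + 1" using assms(1) by (simp_all add: field_simps)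
  then have "\<lfloor>s / h\<rfloor> = k" by (simp add: floor_unique)
  then show ?thesis using assms(1) by (simp add: round_down_eq k_def)
qed

lemma piecewise_continuous_step:
  assumes h: "0 < h"
  shows "piecewise_continuous T (grid T h) (\<lambda>s. f (round_down h s))"
  unfolding piecewise_continuous_def
proof (intro conjI)
  show fin: "finite (grid T h)" by (simp add: grid_def)
  have "(\<lambda>s. f (round_down h s)) ` {0..T} \<subseteq> f ` grid T h"
    using round_down_in_grid[OF h] by auto
  then show "bounded ((\<lambda>s. f (round_down h s)) ` {0..T})"
    using fin by (meson finite_imageI finite_imp_bounded bounded_subset)
  show "continuous_on ({0..T} - grid T h) (\<lambda>s. f (round_down h s))"
  proof (rule continuous_at_imp_continuous_on, rule ballI)
    fix t assume t: "t \<in> {0..T} - grid T h"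
    then have "round_down h t \<noteq> t" using round_down_in_grid[OF h, of t T] by auto
    then have "t \<in> {round_down h t<..<round_down h t + h}"
      using round_down_grid(3,4)[OF h, of t] t by auto
    then have "\<forall>\<^sub>F s in nhds t. s \<in> {round_down h t<..<round_down h t + h}"
      by (intro eventually_nhds_in_open) auto
    then have "\<forall>\<^sub>F s in nhds t. f (round_down h s) = f (round_down h t)"
    proof eventually_elim
      case (elim s)
      then have "round_down h s = round_down h t"
        using t by (intro round_down_const[OF h]) auto
      then show ?case by simp
    qed
    then have "isCont (\<lambda>s. f (round_down h s)) t \<longleftrightarrow> isCont (\<lambda>_. f (round_down h t)) t"
      by (rule isCont_cong)
    then show "isCont (\<lambda>s. f (round_down h s)) t" by simp
  qed
qed

text \<open>The norm of \<open>H\<^sub>s\<close> in terms of the coefficients with respect to finitely many eigenvectors.\<close>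

definition wnorm :: "('i \<Rightarrow> real) \<Rightarrow> 'i set \<Rightarrow> real \<Rightarrow> ('i \<Rightarrow> real) \<Rightarrow> real" where
  "wnorm m J s v = L2_set (\<lambda>b. m b powr s * v b) J"

lemma wnorm_nonneg: "0 \<le> wnorm m J s v"
  by (simp add: wnorm_def)

lemma wnorm_add: "wnorm m J s (\<lambda>b. v b + w b) \<le> wnorm m J s v + wnorm m J s w"
  unfolding wnorm_def distrib_left by (rule L2_set_triangle_ineq)

lemma wnorm_diff: "wnorm m J s (\<lambda>b. v b - w b) \<le> wnorm m J s v + wnorm m J s w"
proof -
  have "wnorm m J s (\<lambda>b. v b + - w b) \<le> wnorm m J s v + wnorm m J s (\<lambda>b. - w b)" by (rule wnorm_add)
  then show ?thesis by (simp add: wnorm_def L2_set_def)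
qed

lemma wnorm_embedding:
  assumes "0 < \<delta>" "\<And>b. b \<in> J \<Longrightarrow> \<delta> \<le> m b" "s \<le> s'"
  shows "wnorm m J s v \<le> \<delta> powr (s - s') * wnorm m J s' v"
proof -
  have "L2_set (\<lambda>b. m b powr s * v b) J \<le> \<delta> powr (s - s') * L2_set (\<lambda>b. m b powr s' * v b) J + 0 * L2_set (\<lambda>b. 0) J"
  proof (rule L2_set_le_linear_combination)
    fix b assume b: "b \<in> J"
    then have m: "0 < m b" using assms by (meson less_le_trans)
    have "m b powr s = m b powr (s - s') * m b powr s'" using m by (simp add: powr_add[symmetric])
    also have "\<dots> \<le> \<delta> powr (s - s') * m b powr s'"
      using assms b m by (intro mult_right_mono powr_mono2') auto
    finally show "\<bar>m b powr s * v b\<bar> \<le> \<delta> powr (s - s') * \<bar>m b powr s' * v b\<bar> + 0 * \<bar>0\<bar>"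
      by (simp add: abs_mult mult.assoc[symmetric] mult_right_mono)
  qed auto
  then show ?thesis by (simp add: wnorm_def)
qed

text \<open>Here \<open>m b\<close> are the eigenvalues of \<open>\<kappa> - A\<close>, while \<open>m b - \<kappa> + \<eta>\<close> are those of \<open>\<eta> - A\<close>; \<open>K\<close> bounds the noise
  and \<open>F\<^sub>0\<close> the nonlinearity at 0. The constants below are built from these parameters alone, which is why
  the energy estimate is uniform in the number of eigenvectors and in the step size.\<close>

locale energy_setting =
  fixes B :: "'i set" and m :: "'i \<Rightarrow> real"
    and \<delta> \<delta>' \<kappa> \<eta> T \<alpha> \<rho> \<sigma> vartheta chi \<theta> \<phi>' K F\<^sub>0 :: real
  assumes m_ge: "0 < \<delta>" "\<And>b. b \<in> B \<Longrightarrow> \<delta> \<le> m b"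
    and p_ge: "0 < \<delta>'" "\<And>b. b \<in> B \<Longrightarrow> \<delta>' \<le> m b - \<kappa> + \<eta>"
    and nonneg: "0 \<le> \<kappa>" "0 \<le> \<eta>" "0 \<le> \<theta>" "0 \<le> K" "0 \<le> F\<^sub>0"
    and T: "0 < T" and \<alpha>: "0 \<le> \<alpha>" "\<alpha> \<le> 1/2" and \<rho>: "- \<alpha> \<le> \<rho>" "\<rho> < \<sigma>" "\<sigma> < 1 - \<alpha>"
    and vartheta: "0 < vartheta" and chi: "0 < chi" "chi * (1 + vartheta) \<le> \<sigma> - \<rho>" "chi * (1 + 2 * vartheta) \<le> 1 - \<alpha> - \<rho>"
    and \<phi>': "\<phi>' < 1"
begin

text \<open>The constants of, in this order, the increments of the semigroup generated by \<open>A\<close> and by \<open>A - \<eta>\<close>, the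
  difference of noise and shifted noise, and the use of Young's inequality.\<close>

definition increment_const :: "real \<Rightarrow> real" where
  "increment_const k = exp (\<bar>k\<bar> * T) * (1 + \<bar>k\<bar> * (T powr (1 - (\<sigma> - \<rho>)) * \<delta> powr - (\<sigma> - \<rho>)))"

definition shift_const :: real where
  "shift_const = exp (\<bar>\<kappa> - \<eta>\<bar> * T) * \<eta> * K"

definition coercivity_const :: real where
  "coercivity_const = \<delta> powr (2 * \<alpha> - 1) * (1 + \<kappa> / \<delta>') / (4 * (1 - \<phi>'))"

text \<open>The data of one Galerkin scheme, in coordinates with respect to the eigenvectors in \<open>J\<close>: the
  approximation \<open>x\<close>, the noise \<open>z\<close> and its shifted version \<open>q\<close>, for which \<open>x - q\<close> solves an equation
  with dissipation \<open>\<eta> - A\<close>.\<close>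

definition galerkin_data ::
  "'i set \<Rightarrow> real \<Rightarrow> (real \<Rightarrow> 'i \<Rightarrow> real) \<Rightarrow> (real \<Rightarrow> 'i \<Rightarrow> real) \<Rightarrow> (real \<Rightarrow> 'i \<Rightarrow> real) \<Rightarrow>
   (('i \<Rightarrow> real) \<Rightarrow> 'i \<Rightarrow> real) \<Rightarrow> (('i \<Rightarrow> real) \<Rightarrow> real) \<Rightarrow> (('i \<Rightarrow> real) \<Rightarrow> real) \<Rightarrow> bool" where
  "galerkin_data J h x z q F \<phi> \<Phi> \<longleftrightarrow>
     finite J \<and> J \<subseteq> B \<and> 0 < h \<and> h \<le> T \<and>
     (\<forall>t\<in>{0..T}. \<forall>b\<in>J. has_bochner_integral (time_measure t)
        (\<lambda>s. exp (- (m b - \<kappa>) * (t - s)) *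
          (of_bool (wnorm m J \<sigma> (x (round_down h s)) + wnorm m J \<sigma> (z (round_down h s)) \<le> h powr - chi) * F (x (round_down h s)) b))
        (x t b - z t b)) \<and>
     (\<forall>t\<in>{0..T}. \<forall>b\<in>J. has_bochner_integral (time_measure t)
        (\<lambda>s. exp (- (m b - (\<kappa> - \<eta>)) * (t - s)) * (\<eta> * z s b)) (z t b - q t b)) \<and>
     (\<forall>b\<in>J. continuous_on {0..T} (\<lambda>t. z t b)) \<and>
     (\<forall>t\<in>{0..T}. wnorm m J \<sigma> (z t) \<le> K) \<and>
     wnorm m J (- \<alpha>) (F (\<lambda>b. 0)) \<le> F\<^sub>0 \<and>
     (\<forall>v w. wnorm m J (- \<alpha>) (\<lambda>b. F v b - F w b) \<le>
        \<theta> * (1 + wnorm m J \<rho> v powr vartheta + wnorm m J \<rho> w powr vartheta) * wnorm m J \<rho> (\<lambda>b. v b - w b)) \<and>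
     (\<forall>v w. (\<Sum>b\<in>J. v b * F (\<lambda>b. v b + w b) b) \<le>
        \<phi> w * (\<Sum>b\<in>J. (v b)\<^sup>2) + \<phi>' * (\<Sum>b\<in>J. (m b - \<kappa> + \<eta>) * (v b)\<^sup>2) + \<Phi> w) \<and>
     (\<forall>v. 0 \<le> \<phi> v \<and> 0 \<le> \<Phi> v)"

context
  fixes J h x z q F \<phi> \<Phi>
  assumes data: "galerkin_data J h x z q F \<phi> \<Phi>"
begin

lemma data_facts:
  shows J: "finite J" "J \<subseteq> B" and h: "0 < h" "h \<le> T"
    and x_eq: "t \<in> {0..T} \<Longrightarrow> b \<in> J \<Longrightarrow> has_bochner_integral (time_measure t)
        (\<lambda>s. exp (- (m b - \<kappa>) * (t - s)) *
          (of_bool (wnorm m J \<sigma> (x (round_down h s)) + wnorm m J \<sigma> (z (round_down h s)) \<le> h powr - chi) * F (x (round_down h s)) b))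
        (x t b - z t b)"
    and q_eq: "t \<in> {0..T} \<Longrightarrow> b \<in> J \<Longrightarrow> has_bochner_integral (time_measure t)
        (\<lambda>s. exp (- (m b - (\<kappa> - \<eta>)) * (t - s)) * (\<eta> * z s b)) (z t b - q t b)"
    and z_cont: "b \<in> J \<Longrightarrow> continuous_on {0..T} (\<lambda>t. z t b)"
    and z_bound: "t \<in> {0..T} \<Longrightarrow> wnorm m J \<sigma> (z t) \<le> K"
    and F_0: "wnorm m J (- \<alpha>) (F (\<lambda>b. 0)) \<le> F\<^sub>0"
    and F_lip: "wnorm m J (- \<alpha>) (\<lambda>b. F v b - F w b) \<le>
        \<theta> * (1 + wnorm m J \<rho> v powr vartheta + wnorm m J \<rho> w powr vartheta) * wnorm m J \<rho> (\<lambda>b. v b - w b)"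
    and F_coercive: "(\<Sum>b\<in>J. v b * F (\<lambda>b. v b + w b) b) \<le>
        \<phi> w * (\<Sum>b\<in>J. (v b)\<^sup>2) + \<phi>' * (\<Sum>b\<in>J. (m b - \<kappa> + \<eta>) * (v b)\<^sup>2) + \<Phi> w"
    and \<phi>_\<Phi>_nonneg: "0 \<le> \<phi> v" "0 \<le> \<Phi> v"
  using data unfolding galerkin_data_def by blast+

lemma m_ge_J: "b \<in> J \<Longrightarrow> \<delta> \<le> m b" and m_pos_J: "b \<in> J \<Longrightarrow> 0 < m b"
  using m_ge J(2) by (auto intro: less_le_trans)

abbreviation (input) "active r \<equiv> wnorm m J \<sigma> (x r) + wnorm m J \<sigma> (z r) \<le> h powr - chi"

lemma scheme_convolution:
  assumes "b \<in> J"
  shows "continuous_on {0..T} (\<lambda>t. x t b - z t b)" "x 0 b = z 0 b"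
    and "t \<in> {0<..<T} - grid T h \<Longrightarrow> ((\<lambda>t. x t b - z t b) has_real_derivative
      of_bool (active (round_down h t)) * F (x (round_down h t)) b - (m b - \<kappa>) * (x t b - z t b)) (at t)"
    and "0 \<le> r \<Longrightarrow> r \<le> t \<Longrightarrow> t \<le> T \<Longrightarrow> x t b - z t b = exp (- (m b - \<kappa>) * (t - r)) * (x r b - z r b) +
      integral {r..t} (\<lambda>s. exp (- (m b - \<kappa>) * (t - s)) * (of_bool (active (round_down h s)) * F (x (round_down h s)) b))"
proof -
  note e = exponential_convolution[OF piecewise_continuous_step[OF h(1), of T "\<lambda>r. of_bool (active r) * F (x r) b"] x_eq[OF _ assms]]
  show "continuous_on {0..T} (\<lambda>t. x t b - z t b)" "x 0 b = z 0 b" using e(1,2) T by auto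
  show "t \<in> {0<..<T} - grid T h \<Longrightarrow> ((\<lambda>t. x t b - z t b) has_real_derivative
      of_bool (active (round_down h t)) * F (x (round_down h t)) b - (m b - \<kappa>) * (x t b - z t b)) (at t)"
    by (rule e(3))
  show "0 \<le> r \<Longrightarrow> r \<le> t \<Longrightarrow> t \<le> T \<Longrightarrow> x t b - z t b = exp (- (m b - \<kappa>) * (t - r)) * (x r b - z r b) +
      integral {r..t} (\<lambda>s. exp (- (m b - \<kappa>) * (t - s)) * (of_bool (active (round_down h s)) * F (x (round_down h s)) b))"
    by (rule e(4))
qed

lemma shift_convolution:
  assumes "b \<in> J"
  shows "continuous_on {0..T} (\<lambda>t. z t b - q t b)" "z 0 b = q 0 b"
    and "t \<in> {0<..<T} - grid T h \<Longrightarrow> ((\<lambda>t. z t b - q t b) has_real_derivative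
      \<eta> * z t b - (m b - (\<kappa> - \<eta>)) * (z t b - q t b)) (at t)"
    and "0 \<le> r \<Longrightarrow> r \<le> t \<Longrightarrow> t \<le> T \<Longrightarrow> z t b - q t b = exp (- (m b - (\<kappa> - \<eta>)) * (t - r)) * (z r b - q r b) +
      integral {r..t} (\<lambda>s. exp (- (m b - (\<kappa> - \<eta>)) * (t - s)) * (\<eta> * z s b))"
proof -
  have pc: "piecewise_continuous T (grid T h) (\<lambda>s. \<eta> * z s b)"
    using z_cont[OF assms] by (intro piecewise_continuousI continuous_intros) (auto simp: grid_def)
  note e = exponential_convolution[OF pc q_eq[OF _ assms]]
  show "continuous_on {0..T} (\<lambda>t. z t b - q t b)" "z 0 b = q 0 b" using e(1,2) T by auto
  show "t \<in> {0<..<T} - grid T h \<Longrightarrow> ((\<lambda>t. z t b - q t b) has_real_derivative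
      \<eta> * z t b - (m b - (\<kappa> - \<eta>)) * (z t b - q t b)) (at t)"
    by (rule e(3))
  show "0 \<le> r \<Longrightarrow> r \<le> t \<Longrightarrow> t \<le> T \<Longrightarrow> z t b - q t b = exp (- (m b - (\<kappa> - \<eta>)) * (t - r)) * (z r b - q r b) +
      integral {r..t} (\<lambda>s. exp (- (m b - (\<kappa> - \<eta>)) * (t - s)) * (\<eta> * z s b))"
    by (rule e(4))
qed

lemma q_cont: "b \<in> J \<Longrightarrow> continuous_on {0..T} (\<lambda>t. q t b)"
  using continuous_on_diff[OF z_cont[of b] shift_convolution(1)[of b]] by simp

lemma shift_integral_le:
  assumes "0 \<le> r" "r \<le> t" "t \<le> T"
  shows "wnorm m J \<sigma> (\<lambda>b. integral {r..t} (\<lambda>s. exp (- (m b - (\<kappa> - \<eta>)) * (t - s)) * (\<eta> * z s b))) \<le> shift_const * (t - r)"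
proof -
  let ?c = "\<lambda>s b. m b powr \<sigma> * (exp (- (m b - (\<kappa> - \<eta>)) * (t - s)) * (\<eta> * z s b))"
  have "L2_set (\<lambda>b. integral {r..t} (\<lambda>s. ?c s b)) J \<le> shift_const * (t - r)"
  proof (rule L2_set_integral_le[OF J(1) assms(2)])
    show "continuous_on {r..t} (\<lambda>s. ?c s b)" if "b \<in> J" for b
      using assms by (intro continuous_intros continuous_on_subset[OF z_cont[OF that]]) auto
    fix s assume s: "s \<in> {r..t}"
    have "L2_set (?c s) J \<le> (exp (\<bar>\<kappa> - \<eta>\<bar> * T) * \<eta>) * L2_set (\<lambda>b. m b powr \<sigma> * z s b) J + 0 * L2_set (\<lambda>b. 0) J"
    proof (rule L2_set_le_linear_combination)
      fix b assume b: "b \<in> J"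
      have "exp (- (m b - (\<kappa> - \<eta>)) * (t - s)) \<le> exp (\<bar>\<kappa> - \<eta>\<bar> * T) * exp (- m b * (t - s))"
        using m_pos_J[OF b] s assms by (intro exp_shift_le) auto
      also have "\<dots> \<le> exp (\<bar>\<kappa> - \<eta>\<bar> * T) * 1"
        using m_pos_J[OF b] s by (intro mult_left_mono) auto
      finally have "exp (- (m b - (\<kappa> - \<eta>)) * (t - s)) * (\<eta> * \<bar>m b powr \<sigma> * z s b\<bar>) \<le> exp (\<bar>\<kappa> - \<eta>\<bar> * T) * (\<eta> * \<bar>m b powr \<sigma> * z s b\<bar>)"
        using nonneg by (intro mult_right_mono) auto
      then show "\<bar>?c s b\<bar> \<le> (exp (\<bar>\<kappa> - \<eta>\<bar> * T) * \<eta>) * \<bar>m b powr \<sigma> * z s b\<bar> + 0 * \<bar>0\<bar>"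
        using nonneg by (simp add: abs_mult ac_simps)
    qed (use nonneg in auto)
    also have "\<dots> \<le> (exp (\<bar>\<kappa> - \<eta>\<bar> * T) * \<eta>) * K"
      using z_bound[of s] s assms nonneg unfolding wnorm_def by (auto intro!: mult_left_mono)
    finally show "L2_set (?c s) J \<le> shift_const" by (simp add: shift_const_def)
  qed
  then show ?thesis unfolding wnorm_def by simp
qed

lemma shift_le:
  assumes "t \<in> {0..T}"
  shows "wnorm m J \<sigma> (\<lambda>b. z t b - q t b) \<le> shift_const * T"
proof -
  have "z t b - q t b = integral {0..t} (\<lambda>s. exp (- (m b - (\<kappa> - \<eta>)) * (t - s)) * (\<eta> * z s b))" if "b \<in> J" for b
    using shift_convolution(4)[OF that, of 0 t] shift_convolution(2)[OF that] assms by simp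
  then have "wnorm m J \<sigma> (\<lambda>b. z t b - q t b) = wnorm m J \<sigma> (\<lambda>b. integral {0..t} (\<lambda>s. exp (- (m b - (\<kappa> - \<eta>)) * (t - s)) * (\<eta> * z s b)))"
    unfolding wnorm_def by (intro L2_set_cong) auto
  also have "\<dots> \<le> shift_const * (t - 0)" using assms by (intro shift_integral_le) auto
  also have "\<dots> \<le> shift_const * T" using assms nonneg by (intro mult_left_mono) (auto simp: shift_const_def)
  finally show ?thesis .
qed

lemma active_norm_le:
  assumes "active r"
  shows "wnorm m J \<rho> (x r) \<le> \<delta> powr - (\<sigma> - \<rho>) * h powr - chi"
proof -
  have "wnorm m J \<rho> (x r) \<le> \<delta> powr (\<rho> - \<sigma>) * wnorm m J \<sigma> (x r)"
    using m_ge(1) m_ge_J \<rho> by (intro wnorm_embedding) auto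
  also have "\<dots> \<le> \<delta> powr (\<rho> - \<sigma>) * h powr - chi"
    using assms wnorm_nonneg[of m J \<sigma> "z r"] by (intro mult_left_mono) auto
  finally show ?thesis by simp
qed

text \<open>By variation of constants from the grid point \<open>r\<close> the increment has four parts: the semigroup acting on
  \<open>x - z\<close> and on \<open>z - q\<close>, each of order \<open>h powr (\<sigma> - \<rho>)\<close> in the norm of \<open>H\<^sub>\<rho>\<close> relative to the norm of \<open>H\<^sub>\<sigma>\<close>,
  the nonlinearity, which is constant during the step and is integrated against \<open>(t - s) powr - (\<alpha> + \<rho>)\<close>,
  and the noise.\<close>

lemma increment_le:
  assumes t: "t \<in> {0..T}" and r: "r = round_down h t" and act: "active r"
  defines "X \<equiv> \<delta> powr - (\<sigma> - \<rho>) * h powr - chi"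
  shows "wnorm m J \<rho> (\<lambda>b. (x t b - q t b) - (x r b - q r b)) \<le>
    increment_const \<kappa> * h powr (\<sigma> - \<rho>) * h powr - chi
    + exp (\<kappa> * T) * h powr (1 - \<alpha> - \<rho>) * (F\<^sub>0 + \<theta> * (1 + X powr vartheta) * X)
    + (increment_const (\<kappa> - \<eta>) * (shift_const * T)) * h powr (\<sigma> - \<rho>) + (\<delta> powr - (\<sigma> - \<rho>) * shift_const) * h"
proof -
  define \<tau> where "\<tau> = t - r"
  have rt: "0 \<le> r" "r \<le> t" "t < r + h" "t \<le> T"
    using round_down_grid(2-4)[OF h(1), of t] t unfolding r by auto
  have \<tau>: "0 \<le> \<tau>" "\<tau> \<le> h" "\<tau> \<le> T" using rt unfolding \<tau>_def by auto
  define \<beta> where "\<beta> = \<sigma> - \<rho>"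
  have \<beta>: "0 < \<beta>" "\<beta> \<le> 1" using \<rho> by (auto simp: \<beta>_def)
  have C0: "0 \<le> increment_const k" for k
    unfolding increment_const_def by (intro mult_nonneg_nonneg add_nonneg_nonneg) auto
  have Sh0: "0 \<le> shift_const" using nonneg by (simp add: shift_const_def)
  have inc: "\<bar>exp (- (m b - k) * \<tau>) - 1\<bar> * (m b powr \<rho> * e) \<le> (increment_const k * \<tau> powr \<beta>) * (m b powr \<sigma> * e)"
    if b: "b \<in> J" and e: "0 \<le> e" for b k e
  proof -
    have "\<bar>exp (- (m b - k) * \<tau>) - 1\<bar> \<le> increment_const k * \<tau> powr \<beta> * m b powr \<beta>"
      using semigroup_increment_le[OF m_ge(1) m_ge_J[OF b] \<tau>(1,3), of \<beta> k] \<beta>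
      unfolding increment_const_def \<beta>_def by simp
    then have "\<bar>exp (- (m b - k) * \<tau>) - 1\<bar> * (m b powr \<rho> * e) \<le> increment_const k * \<tau> powr \<beta> * m b powr \<beta> * (m b powr \<rho> * e)"
      using e by (intro mult_right_mono) auto
    also have "\<dots> = (increment_const k * \<tau> powr \<beta>) * ((m b powr \<beta> * m b powr \<rho>) * e)" by simp
    also have "m b powr \<beta> * m b powr \<rho> = m b powr \<sigma>" by (simp add: powr_add[symmetric] \<beta>_def)
    finally show ?thesis .
  qed
  have X: "wnorm m J \<rho> (x r) \<le> X" unfolding X_def by (rule active_norm_le[OF act])
  have F_le: "wnorm m J (- \<alpha>) (F (x r)) \<le> F\<^sub>0 + \<theta> * (1 + X powr vartheta) * X"
  proof -
    have "wnorm m J (- \<alpha>) (F (x r)) \<le> wnorm m J (- \<alpha>) (F (\<lambda>b. 0)) + wnorm m J (- \<alpha>) (\<lambda>b. F (x r) b - F (\<lambda>b. 0) b)"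
      using wnorm_add[of m J "- \<alpha>" "F (\<lambda>b. 0)" "\<lambda>b. F (x r) b - F (\<lambda>b. 0) b"] by simp
    also have "\<dots> \<le> F\<^sub>0 + \<theta> * (1 + wnorm m J \<rho> (x r) powr vartheta) * wnorm m J \<rho> (x r)"
      using F_lip[of "x r" "\<lambda>b. 0"] F_0 by (simp add: wnorm_def L2_set_def)
    also have "\<dots> \<le> F\<^sub>0 + \<theta> * (1 + X powr vartheta) * X"
      using X wnorm_nonneg[of m J \<rho> "x r"] nonneg vartheta
      by (intro add_left_mono mult_mono powr_mono2) (auto intro!: mult_nonneg_nonneg add_nonneg_nonneg)
    finally show ?thesis .
  qed
  have y_le: "wnorm m J \<rho> (\<lambda>b. (x t b - z t b) - (x r b - z r b)) \<le>
      (increment_const \<kappa> * \<tau> powr \<beta>) * wnorm m J \<sigma> (\<lambda>b. x r b - z r b) + (exp (\<kappa> * T) * \<tau> powr (1 - \<alpha> - \<rho>)) * wnorm m J (- \<alpha>) (F (x r))"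
    unfolding wnorm_def
  proof (rule L2_set_le_linear_combination)
    fix b assume b: "b \<in> J"
    let ?I = "integral {r..t} (\<lambda>s. exp (- (m b - \<kappa>) * (t - s)))"
    have "integral {r..t} (\<lambda>s. exp (- (m b - \<kappa>) * (t - s)) * (of_bool (active (round_down h s)) * F (x (round_down h s)) b))
        = integral {r..t} (\<lambda>s. exp (- (m b - \<kappa>) * (t - s)) * F (x r) b)"
    proof (rule integral_cong)
      fix s assume "s \<in> {r..t}"
      then have "round_down h s = r" using round_down_const[OF h(1), of t s] rt t unfolding r by auto
      then show "exp (- (m b - \<kappa>) * (t - s)) * (of_bool (active (round_down h s)) * F (x (round_down h s)) b) = exp (- (m b - \<kappa>) * (t - s)) * F (x r) b"
        using act by simp
    qed
    also have "\<dots> = ?I * F (x r) b" by simp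
    finally have eq: "x t b - z t b = exp (- (m b - \<kappa>) * \<tau>) * (x r b - z r b) + ?I * F (x r) b"
      using scheme_convolution(4)[OF b rt(1,2,4)] unfolding \<tau>_def by simp
    have "m b powr \<rho> * ((x t b - z t b) - (x r b - z r b)) =
        (exp (- (m b - \<kappa>) * \<tau>) - 1) * (m b powr \<rho> * (x r b - z r b)) + m b powr \<rho> * (?I * F (x r) b)"
      unfolding eq by (simp add: algebra_simps)
    then have "\<bar>m b powr \<rho> * ((x t b - z t b) - (x r b - z r b))\<bar> \<le>
        \<bar>exp (- (m b - \<kappa>) * \<tau>) - 1\<bar> * (m b powr \<rho> * \<bar>x r b - z r b\<bar>) + m b powr \<rho> * (?I * \<bar>F (x r) b\<bar>)"
      using semigroup_integral_le(2)[OF m_pos_J[OF b] rt(2), of T 0 \<kappa>] rt abs_triangle_ineq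
        [of "(exp (- (m b - \<kappa>) * \<tau>) - 1) * (m b powr \<rho> * (x r b - z r b))" "m b powr \<rho> * (?I * F (x r) b)"]
      by (simp add: abs_mult)
    also have "m b powr \<rho> * (?I * \<bar>F (x r) b\<bar>) = (m b powr (\<rho> + \<alpha>) * ?I) * (m b powr - \<alpha> * \<bar>F (x r) b\<bar>)"
      using m_pos_J[OF b] by (simp add: powr_add powr_minus)
    also have "\<dots> \<le> (exp (\<bar>\<kappa>\<bar> * T) * (t - r) powr (1 - (\<rho> + \<alpha>))) * (m b powr - \<alpha> * \<bar>F (x r) b\<bar>)"
      using m_pos_J[OF b] rt \<rho> by (intro mult_right_mono semigroup_integral_le) auto
    also have "\<bar>exp (- (m b - \<kappa>) * \<tau>) - 1\<bar> * (m b powr \<rho> * \<bar>x r b - z r b\<bar>) \<le> (increment_const \<kappa> * \<tau> powr \<beta>) * (m b powr \<sigma> * \<bar>x r b - z r b\<bar>)"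
      by (rule inc[OF b]) simp
    finally show "\<bar>m b powr \<rho> * ((x t b - z t b) - (x r b - z r b))\<bar> \<le>
        (increment_const \<kappa> * \<tau> powr \<beta>) * \<bar>m b powr \<sigma> * (x r b - z r b)\<bar> + (exp (\<kappa> * T) * \<tau> powr (1 - \<alpha> - \<rho>)) * \<bar>m b powr - \<alpha> * F (x r) b\<bar>"
      using nonneg unfolding \<tau>_def abs_mult[of "m b powr \<sigma>"] abs_mult[of "m b powr - \<alpha>"]
      by (simp add: diff_diff_eq add.commute mult.assoc)
  qed (use C0 in auto)
  have w_le: "wnorm m J \<rho> (\<lambda>b. (z t b - q t b) - (z r b - q r b)) \<le>
      (increment_const (\<kappa> - \<eta>) * \<tau> powr \<beta>) * wnorm m J \<sigma> (\<lambda>b. z r b - q r b)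
      + \<delta> powr - \<beta> * wnorm m J \<sigma> (\<lambda>b. integral {r..t} (\<lambda>s. exp (- (m b - (\<kappa> - \<eta>)) * (t - s)) * (\<eta> * z s b)))"
    unfolding wnorm_def
  proof (rule L2_set_le_linear_combination)
    fix b assume b: "b \<in> J"
    let ?I = "integral {r..t} (\<lambda>s. exp (- (m b - (\<kappa> - \<eta>)) * (t - s)) * (\<eta> * z s b))"
    have eq: "z t b - q t b = exp (- (m b - (\<kappa> - \<eta>)) * \<tau>) * (z r b - q r b) + ?I"
      using shift_convolution(4)[OF b rt(1,2,4)] unfolding \<tau>_def .
    have "m b powr \<rho> * ((z t b - q t b) - (z r b - q r b)) =
        (exp (- (m b - (\<kappa> - \<eta>)) * \<tau>) - 1) * (m b powr \<rho> * (z r b - q r b)) + m b powr \<rho> * ?I"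
      unfolding eq by (simp add: algebra_simps)
    then have "\<bar>m b powr \<rho> * ((z t b - q t b) - (z r b - q r b))\<bar> \<le>
        \<bar>exp (- (m b - (\<kappa> - \<eta>)) * \<tau>) - 1\<bar> * (m b powr \<rho> * \<bar>z r b - q r b\<bar>) + m b powr \<rho> * \<bar>?I\<bar>"
      using abs_triangle_ineq[of "(exp (- (m b - (\<kappa> - \<eta>)) * \<tau>) - 1) * (m b powr \<rho> * (z r b - q r b))" "m b powr \<rho> * ?I"]
      by (simp add: abs_mult)
    also have "m b powr \<rho> * \<bar>?I\<bar> \<le> (\<delta> powr - \<beta> * m b powr \<sigma>) * \<bar>?I\<bar>"
    proof -
      have "m b powr \<rho> = m b powr - \<beta> * m b powr \<sigma>" by (simp add: powr_add[symmetric] \<beta>_def)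
      also have "\<dots> \<le> \<delta> powr - \<beta> * m b powr \<sigma>"
        using m_ge(1) m_ge_J[OF b] \<beta> by (intro mult_right_mono powr_mono2') auto
      finally show ?thesis by (intro mult_right_mono) auto
    qed
    also have "\<bar>exp (- (m b - (\<kappa> - \<eta>)) * \<tau>) - 1\<bar> * (m b powr \<rho> * \<bar>z r b - q r b\<bar>) \<le> (increment_const (\<kappa> - \<eta>) * \<tau> powr \<beta>) * (m b powr \<sigma> * \<bar>z r b - q r b\<bar>)"
      by (rule inc[OF b]) simp
    finally show "\<bar>m b powr \<rho> * ((z t b - q t b) - (z r b - q r b))\<bar> \<le>
        (increment_const (\<kappa> - \<eta>) * \<tau> powr \<beta>) * \<bar>m b powr \<sigma> * (z r b - q r b)\<bar> + \<delta> powr - \<beta> * \<bar>m b powr \<sigma> * ?I\<bar>"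
      by (simp add: abs_mult mult.assoc)
  qed (use C0 in auto)
  have "wnorm m J \<rho> (\<lambda>b. (x t b - q t b) - (x r b - q r b)) \<le>
      wnorm m J \<rho> (\<lambda>b. (x t b - z t b) - (x r b - z r b)) + wnorm m J \<rho> (\<lambda>b. (z t b - q t b) - (z r b - q r b))"
    using wnorm_add[of m J \<rho> "\<lambda>b. (x t b - z t b) - (x r b - z r b)" "\<lambda>b. (z t b - q t b) - (z r b - q r b)"]
    by (simp add: algebra_simps)
  also have "\<dots> \<le> ((increment_const \<kappa> * \<tau> powr \<beta>) * h powr - chi + (exp (\<kappa> * T) * \<tau> powr (1 - \<alpha> - \<rho>)) * (F\<^sub>0 + \<theta> * (1 + X powr vartheta) * X))
      + ((increment_const (\<kappa> - \<eta>) * \<tau> powr \<beta>) * (shift_const * T) + \<delta> powr - \<beta> * (shift_const * \<tau>))"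
  proof (intro add_mono order_trans[OF y_le] order_trans[OF w_le] mult_left_mono)
    show "wnorm m J \<sigma> (\<lambda>b. x r b - z r b) \<le> h powr - chi"
      using wnorm_diff[of m J \<sigma> "x r" "z r"] act by linarith
    show "wnorm m J \<sigma> (\<lambda>b. z r b - q r b) \<le> shift_const * T" using rt by (intro shift_le) auto
    show "wnorm m J \<sigma> (\<lambda>b. integral {r..t} (\<lambda>s. exp (- (m b - (\<kappa> - \<eta>)) * (t - s)) * (\<eta> * z s b))) \<le> shift_const * \<tau>"
      unfolding \<tau>_def by (rule shift_integral_le[OF rt(1,2,4)])
  qed (use C0 F_le in auto)
  also have "\<dots> \<le> ((increment_const \<kappa> * h powr \<beta>) * h powr - chi + (exp (\<kappa> * T) * h powr (1 - \<alpha> - \<rho>)) * (F\<^sub>0 + \<theta> * (1 + X powr vartheta) * X))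
      + ((increment_const (\<kappa> - \<eta>) * h powr \<beta>) * (shift_const * T) + \<delta> powr - \<beta> * (shift_const * h))"
    using \<tau> \<beta> C0 Sh0 T \<rho> order_trans[OF wnorm_nonneg F_le]
    by (intro add_mono mult_right_mono mult_left_mono powr_mono2) auto
  finally show ?thesis by (simp add: \<beta>_def ac_simps)
qed

text \<open>In the derivative of the squared norm of \<open>x - q\<close>, replacing \<open>\<kappa> - A\<close> by \<open>\<eta> - A\<close> as the dissipation costs
  terms in \<open>\<eta>\<close>, which go into the Gronwall exponent and into the norm of \<open>q\<close>. The dissipation itself is
  cancelled by \<open>coercivity_with_frozen_argument\<close>. The summand \<open>a\<close> stands for a further nonnegative term
  by which the integrand may be enlarged.\<close>

lemma energy_estimate:
  fixes E a
  defines "X \<equiv> \<delta> powr - (\<sigma> - \<rho>) * h powr - chi"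
  defines "d \<equiv> increment_const \<kappa> * h powr (\<sigma> - \<rho>) * h powr - chi
    + exp (\<kappa> * T) * h powr (1 - \<alpha> - \<rho>) * (F\<^sub>0 + \<theta> * (1 + X powr vartheta) * X)
    + (increment_const (\<kappa> - \<eta>) * (shift_const * T)) * h powr (\<sigma> - \<rho>) + (\<delta> powr - (\<sigma> - \<rho>) * shift_const) * h"
  assumes E: "\<theta> * (1 + X powr vartheta + (X + d) powr vartheta) * d \<le> E" and a: "0 \<le> a" and t: "t \<in> {0..T}"
  shows "(\<Sum>b\<in>J. (x t b - q t b)\<^sup>2) \<le> exp (3 * \<eta> * T) * ((2 + 2 * coercivity_const * E\<^sup>2 + \<eta>) *
    (LBINT r:{0..T}. exp (LBINT u:{r..T}. 2 * \<phi> (q (round_down h u))) *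
      (1 + \<bar>\<Phi> (q (round_down h r))\<bar> + a + (\<Sum>b\<in>J. (q r b)\<^sup>2))))"
proof -
  define u where "u = (\<lambda>t b. x t b - q t b)"
  define N where "N = (\<lambda>t. \<Sum>b\<in>J. (u t b)\<^sup>2)"
  define p where "p = (\<lambda>b. m b - \<kappa> + \<eta>)"
  define D where "D = (\<lambda>t b. (of_bool (active (round_down h t)) * F (x (round_down h t)) b - (m b - \<kappa>) * (x t b - z t b))
      + (\<eta> * z t b - (m b - (\<kappa> - \<eta>)) * (z t b - q t b)))"
  define C where "C = 2 * coercivity_const * E\<^sup>2"
  define \<beta> where "\<beta> = (\<lambda>s. 2 * \<Phi> (q (round_down h s)) + C + \<eta> * (\<Sum>b\<in>J. (q s b)\<^sup>2))"
  have c0: "0 < 1 + \<kappa> / \<delta>'" using p_ge(1) nonneg by (simp add: add_pos_nonneg)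
  have C0: "0 \<le> C" unfolding C_def coercivity_const_def using c0 \<phi>' m_ge(1)
    by (intro mult_nonneg_nonneg divide_nonneg_nonneg) auto
  have p: "0 < p b" "m b \<le> (1 + \<kappa> / \<delta>') * p b" if "b \<in> J" for b
  proof -
    have "\<delta>' \<le> p b" using p_ge(2) that J(2) by (auto simp: p_def)
    then show "0 < p b" using p_ge(1) by simp
    have "\<kappa> * 1 \<le> \<kappa> * (p b / \<delta>')" using \<open>\<delta>' \<le> p b\<close> p_ge(1) nonneg by (intro mult_left_mono) auto
    then have "p b + \<kappa> \<le> (1 + \<kappa> / \<delta>') * p b" by (simp add: algebra_simps)
    then show "m b \<le> (1 + \<kappa> / \<delta>') * p b" using nonneg by (simp add: p_def)
  qed
  have u_cont: "continuous_on {0..T} (\<lambda>t. u t b)" if "b \<in> J" for b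
    using continuous_on_add[OF scheme_convolution(1)[OF that] shift_convolution(1)[OF that]] by (simp add: u_def)
  have u_deriv: "((\<lambda>t. u t b) has_real_derivative D t b) (at t)" if "b \<in> J" "t \<in> {0<..<T} - grid T h" for b t
    using DERIV_add[OF scheme_convolution(3)[OF that] shift_convolution(3)[OF that]] by (simp add: u_def D_def)
  have N_deriv: "(N has_real_derivative (\<Sum>b\<in>J. 2 * u t b * D t b)) (at t)" if "t \<in> {0<..<T} - grid T h" for t
    unfolding N_def by (auto intro!: derivative_eq_intros u_deriv that sum.cong)
  have N_ineq: "(\<Sum>b\<in>J. 2 * u t b * D t b) \<le> (2 * \<phi> (q (round_down h t)) + 3 * \<eta>) * N t + \<beta> t"
    if t: "t \<in> {0<..<T} - grid T h" for t
  proof -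
    define r where "r = round_down h t"
    have tT: "t \<in> {0..T}" using t by auto
    define P where "P = (\<Sum>b\<in>J. p b * (u t b)\<^sup>2)"
    have P0: "0 \<le> P" unfolding P_def using p(1) by (intro sum_nonneg mult_nonneg_nonneg) (auto simp: less_imp_le)
    have N0: "0 \<le> N t" unfolding N_def by (intro sum_nonneg) auto
    have F_part: "of_bool (active r) * (\<Sum>b\<in>J. u t b * F (x r) b) \<le> \<phi> (q r) * N t + P + \<Phi> (q r) + coercivity_const * E\<^sup>2"
    proof (cases "active r")
      case True
      have "(\<Sum>b\<in>J. u t b * F (\<lambda>b. u r b + q r b) b) \<le> \<phi> (q r) * (\<Sum>b\<in>J. (u t b)\<^sup>2) + (\<Sum>b\<in>J. p b * (u t b)\<^sup>2) + \<Phi> (q r)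
          + \<delta> powr (2 * \<alpha> - 1) * (1 + \<kappa> / \<delta>') / (4 * (1 - \<phi>')) * E\<^sup>2"
      proof (rule coercivity_with_frozen_argument[OF J(1) m_ge(1) m_ge_J p(1,2) c0 \<alpha> \<phi>' nonneg(3) less_imp_le[OF vartheta]])
        show "(\<Sum>b\<in>J. u t b * F (\<lambda>b. u t b + q r b) b) \<le> \<phi> (q r) * (\<Sum>b\<in>J. (u t b)\<^sup>2) + \<phi>' * (\<Sum>b\<in>J. p b * (u t b)\<^sup>2) + \<Phi> (q r)"
          using F_coercive[of "u t" "q r"] by (simp add: p_def)
        show "L2_set (\<lambda>b. m b powr - \<alpha> * (F v b - F w b)) J \<le> \<theta> * (1 + L2_set (\<lambda>b. m b powr \<rho> * v b) J powr vartheta +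
            L2_set (\<lambda>b. m b powr \<rho> * w b) J powr vartheta) * L2_set (\<lambda>b. m b powr \<rho> * (v b - w b)) J" for v w
          using F_lip[of v w] by (simp add: wnorm_def)
        show "L2_set (\<lambda>b. m b powr \<rho> * (u r b + q r b)) J \<le> X"
          using active_norm_le[OF True] by (simp add: wnorm_def u_def X_def)
        show "L2_set (\<lambda>b. m b powr \<rho> * (u t b - u r b)) J \<le> d"
          using increment_le[OF tT r_def True] unfolding wnorm_def u_def d_def X_def .
      qed (assumption | rule E)+
      moreover have "(\<lambda>b. u r b + q r b) = x r" by (simp add: u_def)
      ultimately show ?thesis using True by (simp add: N_def P_def coercivity_const_def)
    next
      case False
      have "0 \<le> coercivity_const * E\<^sup>2" using C0 unfolding C_def by linarith
      then show ?thesis using False P0 N0 \<phi>_\<Phi>_nonneg[of "q r"] by simp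
    qed
    have "(\<Sum>b\<in>J. 2 * u t b * D t b) = (\<Sum>b\<in>J. 2 * (of_bool (active r) * (u t b * F (x r) b)) - 2 * (p b * (u t b)\<^sup>2)
        + 2 * \<eta> * (u t b)\<^sup>2 + \<eta> * (2 * u t b * q t b))"
      unfolding D_def r_def[symmetric] u_def p_def by (intro sum.cong) (auto simp: power2_eq_square algebra_simps)
    also have "\<dots> \<le> (\<Sum>b\<in>J. 2 * (of_bool (active r) * (u t b * F (x r) b)) - 2 * (p b * (u t b)\<^sup>2)
        + 2 * \<eta> * (u t b)\<^sup>2 + \<eta> * ((u t b)\<^sup>2 + (q t b)\<^sup>2))"
    proof (intro sum_mono add_left_mono mult_left_mono)
      show "2 * u t b * q t b \<le> (u t b)\<^sup>2 + (q t b)\<^sup>2" for b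
        using zero_le_power2[of "u t b - q t b"] by (simp add: power2_eq_square algebra_simps)
    qed (use nonneg in auto)
    also have "\<dots> = 2 * (of_bool (active r) * (\<Sum>b\<in>J. u t b * F (x r) b)) - 2 * P + 3 * \<eta> * N t + \<eta> * (\<Sum>b\<in>J. (q t b)\<^sup>2)"
      unfolding N_def P_def sum_distrib_left sum_subtractf[symmetric] sum.distrib[symmetric]
      by (intro sum.cong) (auto simp: algebra_simps)
    also have "\<dots> \<le> 2 * (\<phi> (q r) * N t + P + \<Phi> (q r) + coercivity_const * E\<^sup>2) - 2 * P + 3 * \<eta> * N t + \<eta> * (\<Sum>b\<in>J. (q t b)\<^sup>2)"
      by (intro add_right_mono diff_right_mono mult_left_mono F_part) auto
    also have "\<dots> = (2 * \<phi> (q r) + 3 * \<eta>) * N t + \<beta> t"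
      by (simp add: \<beta>_def C_def r_def algebra_simps)
    finally show ?thesis by (simp add: r_def)
  qed
  have fin: "finite (grid T h)" by (simp add: grid_def)
  have pc_\<phi>: "piecewise_continuous T (grid T h) (\<lambda>s. 2 * \<phi> (q (round_down h s)))"
    by (rule piecewise_continuous_step[OF h(1)])
  have pc_q: "piecewise_continuous T (grid T h) (\<lambda>s. C' * (\<Sum>b\<in>J. (q s b)\<^sup>2))" for C'
    using fin by (intro piecewise_continuousI continuous_intros q_cont)
  have pc_\<beta>: "piecewise_continuous T (grid T h) \<beta>"
    unfolding \<beta>_def
    by (intro piecewise_continuous_add pc_q piecewise_continuous_step[OF h(1)] piecewise_continuousI[OF fin] continuous_on_const)
  have \<beta>0: "0 \<le> \<beta> s" for s
    unfolding \<beta>_def using \<phi>_\<Phi>_nonneg C0 nonneg by (intro add_nonneg_nonneg mult_nonneg_nonneg sum_nonneg) auto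
  have "N t \<le> exp ((3 * \<eta>) * T) * (LBINT r:{0..T}. exp (LBINT u:{r..T}. 2 * \<phi> (q (round_down h u))) * \<beta> r)"
  proof (rule gronwall_off_finite[OF _ _ pc_\<phi> _ pc_\<beta> _ _ N_deriv N_ineq t])
    show "continuous_on {0..T} N" unfolding N_def by (intro continuous_intros u_cont)
    show "N 0 = 0" unfolding N_def u_def using scheme_convolution(2) shift_convolution(2) by simp
  qed (use \<phi>_\<Phi>_nonneg \<beta>0 nonneg in auto)
  also have "(LBINT r:{0..T}. exp (LBINT u:{r..T}. 2 * \<phi> (q (round_down h u))) * \<beta> r) \<le>
    (LBINT r:{0..T}. (2 + C + \<eta>) * (exp (LBINT u:{r..T}. 2 * \<phi> (q (round_down h u))) *
      (1 + \<bar>\<Phi> (q (round_down h r))\<bar> + a + 1 * (\<Sum>b\<in>J. (q r b)\<^sup>2))))"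
  proof (rule set_integral_mono)
    have "continuous_on {0..T} (\<lambda>r. exp (integral {r..T} (\<lambda>u. 2 * \<phi> (q (round_down h u)))))"
      by (intro continuous_intros indefinite_integral_continuous_1' piecewise_continuous_integral(1)[OF pc_\<phi>]) auto
    then have "continuous_on {0..T} (\<lambda>r. exp (LBINT u:{r..T}. 2 * \<phi> (q (round_down h u))))"
      by (rule continuous_on_eq) (use piecewise_continuous_integral(2)[OF pc_\<phi>] in simp)
    then have pc_e: "piecewise_continuous T (grid T h) (\<lambda>r. exp (LBINT u:{r..T}. 2 * \<phi> (q (round_down h u))))"
      by (rule piecewise_continuousI[OF fin])
    show "set_integrable lborel {0..T} (\<lambda>r. exp (LBINT u:{r..T}. 2 * \<phi> (q (round_down h u))) * \<beta> r)"
      by (rule piecewise_continuous_set_integrable[OF piecewise_continuous_mult[OF pc_e pc_\<beta>]]) auto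
    have "piecewise_continuous T (grid T h) (\<lambda>r. (2 + C + \<eta>) * (exp (LBINT u:{r..T}. 2 * \<phi> (q (round_down h u))) *
      (1 + \<bar>\<Phi> (q (round_down h r))\<bar> + a + 1 * (\<Sum>b\<in>J. (q r b)\<^sup>2))))"
      by (intro piecewise_continuous_mult piecewise_continuous_add pc_e pc_q
          piecewise_continuous_step[OF h(1), where f = "\<lambda>r. \<bar>\<Phi> (q r)\<bar>"] piecewise_continuousI[OF fin] continuous_on_const)
    then show "set_integrable lborel {0..T} (\<lambda>r. (2 + C + \<eta>) * (exp (LBINT u:{r..T}. 2 * \<phi> (q (round_down h u))) *
      (1 + \<bar>\<Phi> (q (round_down h r))\<bar> + a + 1 * (\<Sum>b\<in>J. (q r b)\<^sup>2))))"
      by (rule piecewise_continuous_set_integrable) auto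
    fix s
    define S where "S = (\<Sum>b\<in>J. (q s b)\<^sup>2)"
    have S0: "0 \<le> S" unfolding S_def by (intro sum_nonneg) auto
    define f where "f = \<Phi> (q (round_down h s))"
    have f0: "0 \<le> f" using \<phi>_\<Phi>_nonneg by (simp add: f_def)
    have "2 * f + C + \<eta> * S \<le> (2 + C + \<eta>) * f + (2 + C + \<eta>) * 1 + (2 + C + \<eta>) * a + (2 + C + \<eta>) * S"
    proof -
      have "2 * f \<le> (2 + C + \<eta>) * f" "\<eta> * S \<le> (2 + C + \<eta>) * S"
        using C0 nonneg f0 S0 by (auto intro!: mult_right_mono)
      moreover have "0 \<le> (2 + C + \<eta>) * a" using C0 nonneg a by simp
      ultimately show ?thesis using C0 nonneg by simp
    qed
    then have "\<beta> s \<le> (2 + C + \<eta>) * (1 + \<bar>\<Phi> (q (round_down h s))\<bar> + a + 1 * (\<Sum>b\<in>J. (q s b)\<^sup>2))"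
      using f0 unfolding \<beta>_def f_def S_def by (simp add: algebra_simps)
    then have "exp e * \<beta> s \<le> exp e * ((2 + C + \<eta>) * (1 + \<bar>\<Phi> (q (round_down h s))\<bar> + a + 1 * (\<Sum>b\<in>J. (q s b)\<^sup>2)))" for e
      by (intro mult_left_mono) auto
    then show "exp (LBINT u:{s..T}. 2 * \<phi> (q (round_down h u))) * \<beta> s \<le> (2 + C + \<eta>) * (exp (LBINT u:{s..T}. 2 * \<phi> (q (round_down h u))) *
      (1 + \<bar>\<Phi> (q (round_down h s))\<bar> + a + 1 * (\<Sum>b\<in>J. (q s b)\<^sup>2)))"
      unfolding mult.left_commute[of "2 + C + \<eta>"] .
  qed
  finally show ?thesis
    by (simp add: N_def u_def C_def mult_left_mono)
qed

end

theorem uniform_energy_bound: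
  "\<exists>C\<ge>0. \<forall>J h x z q F \<phi> \<Phi>. galerkin_data J h x z q F \<phi> \<Phi> \<longrightarrow> (\<forall>t\<in>{0..T}. \<forall>a\<ge>0.
    (\<Sum>b\<in>J. (x t b - q t b)\<^sup>2) \<le> C *
      (LBINT r:{0..T}. exp (LBINT u:{r..T}. 2 * \<phi> (q (round_down h u))) *
        (1 + \<bar>\<Phi> (q (round_down h r))\<bar> + a + (\<Sum>b\<in>J. (q r b)\<^sup>2))))"
proof -
  have pos: "0 \<le> increment_const k" "0 \<le> shift_const" "0 \<le> coercivity_const" for k
    unfolding increment_const_def shift_const_def coercivity_const_def
    using nonneg \<phi>' p_ge(1) by (auto intro!: mult_nonneg_nonneg add_nonneg_nonneg divide_nonneg_nonneg)
  obtain E where E: "0 \<le> E" "\<And>h. 0 < h \<Longrightarrow> h \<le> T \<Longrightarrow>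
    (let X = \<delta> powr - (\<sigma> - \<rho>) * h powr - chi;
         d = increment_const \<kappa> * h powr (\<sigma> - \<rho>) * h powr - chi
            + exp (\<kappa> * T) * h powr (1 - \<alpha> - \<rho>) * (F\<^sub>0 + \<theta> * (1 + X powr vartheta) * X)
            + (increment_const (\<kappa> - \<eta>) * (shift_const * T)) * h powr (\<sigma> - \<rho>) + (\<delta> powr - (\<sigma> - \<rho>) * shift_const) * h
     in \<theta> * (1 + X powr vartheta + (X + d) powr vartheta) * d \<le> E)"
    using truncation_balances_lipschitz[OF T vartheta chi, of "increment_const \<kappa>" "exp (\<kappa> * T)"
        "increment_const (\<kappa> - \<eta>) * (shift_const * T)" "\<delta> powr - (\<sigma> - \<rho>) * shift_const" F\<^sub>0 \<theta> "\<delta> powr - (\<sigma> - \<rho>)" \<theta>]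
      \<rho> pos nonneg T by auto
  let ?C = "exp (3 * \<eta> * T) * (2 + 2 * coercivity_const * E\<^sup>2 + \<eta>)"
  have "0 \<le> ?C" using pos nonneg by (intro mult_nonneg_nonneg add_nonneg_nonneg) auto
  moreover have "(\<Sum>b\<in>J. (x t b - q t b)\<^sup>2) \<le> ?C *
      (LBINT r:{0..T}. exp (LBINT u:{r..T}. 2 * \<phi> (q (round_down h u))) *
        (1 + \<bar>\<Phi> (q (round_down h r))\<bar> + a + (\<Sum>b\<in>J. (q r b)\<^sup>2)))"
    if g: "galerkin_data J h x z q F \<phi> \<Phi>" and t: "t \<in> {0..T}" and a: "0 \<le> a" for J h x z q F \<phi> \<Phi> t a
    using energy_estimate[OF g E(2)[unfolded Let_def] a t] data_facts(3,4)[OF g] by (simp add: mult.assoc)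
  ultimately show ?thesis by blast
qed

end

section \<open>The Galerkin approximations in coordinates\<close>

context onb
begin

definition fin :: "'h set \<Rightarrow> ('h \<Rightarrow> real) \<Rightarrow> 'h" where
  "fin J c = (\<Sum>b\<in>J. c b *\<^sub>R b)"

lemma inner_fin: "finite J \<Longrightarrow> J \<subseteq> B \<Longrightarrow> b \<in> B \<Longrightarrow> b \<bullet> fin J c = (if b \<in> J then c b else 0)"
  unfolding fin_def by (rule inner_basis_sum)

lemma norm_fin: "finite J \<Longrightarrow> J \<subseteq> B \<Longrightarrow> norm (fin J c) = L2_set c J"
  unfolding fin_def L2_set_def by (rule real_sqrt_unique[symmetric]) (simp_all add: norm_basis_sum)

lemma L2_set_inner_le: "finite J \<Longrightarrow> J \<subseteq> B \<Longrightarrow> L2_set (\<lambda>b. b \<bullet> v) J \<le> norm v"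
  unfolding L2_set_def by (rule real_le_lsqrt) (auto intro: sum_nonneg bessel)

lemma fin_add: "fin J (\<lambda>b. c b + d b) = fin J c + fin J d"
  unfolding fin_def by (simp add: scaleR_add_left sum.distrib)

lemma fin_diff: "fin J (\<lambda>b. c b - d b) = fin J c - fin J d"
  unfolding fin_def by (simp add: scaleR_diff_left sum_subtractf)

lemma bounded_linear_fin: "bounded_linear (\<lambda>v. fin J (\<lambda>b. b \<bullet> v))"
  unfolding fin_def
  by (intro bounded_linear_sum bounded_linear_scaleR_left[THEN bounded_linear_compose] bounded_linear_inner_right)

end

context interpolation
begin

lemma j_fin:
  assumes "finite J" "J \<subseteq> B"
  shows "j (fin J c) = V r (fin J (\<lambda>b. mu b powr r * c b))"
  by (rule V_eq_j[symmetric]) (auto simp: inner_fin[OF assms])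

lemma nrm_j_fin:
  assumes "finite J" "J \<subseteq> B"
  shows "nrm r (j (fin J c)) = wnorm mu J r c"
  unfolding j_fin[OF assms, of c r] wnorm_def by (simp add: norm_fin[OF assms])

lemma has_time_integral_V:
  assumes "\<And>s. 0 < s \<Longrightarrow> s < t \<Longrightarrow> g s = V r (G s)"
  shows "has_time_integral (Hs r) (nrm r) t g (V r Y) \<longleftrightarrow> has_bochner_integral (time_measure t) G Y"
proof -
  have sp: "g s = V r (G s)" if "s \<in> space (time_measure t)" for s
    using that assms by (auto simp: space_restrict_space)
  have 1: "g \<in> measurable (time_measure t) (nborel (Hs r) (nrm r)) \<longleftrightarrow>
      (\<lambda>s. V r (G s)) \<in> measurable (time_measure t) (nborel (Hs r) (nrm r))"
    by (rule measurable_cong) (rule sp)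
  have 2: "(\<integral>\<^sup>+s. ennreal (nrm r (g s - u s)) \<partial>time_measure t) = (\<integral>\<^sup>+s. ennreal (nrm r (V r (G s) - u s)) \<partial>time_measure t)" for u
    by (rule nn_integral_cong) (simp add: sp)
  have "has_time_integral (Hs r) (nrm r) t g (V r Y) \<longleftrightarrow>
      has_bochner_integral_in (Hs r) (nrm r) (time_measure t) (\<lambda>s. V r (G s)) (V r Y)"
    unfolding has_time_integral_def has_bochner_integral_in_def 1 2 ..
  then show ?thesis unfolding V.has_bochner_integral_in_V .
qed

end

locale galerkin = interpolation B mu \<kappa> \<delta> A j Hs nrm
  for B :: "'h::{real_inner, banach, second_countable_topology} set" and mu \<kappa> \<delta> A
    and j :: "'h \<Rightarrow> 'e::real_vector" and Hs nrm +
  fixes \<eta> T vartheta c \<theta> \<epsilon> \<alpha> \<phi>' \<gamma> \<rho> \<sigma> chi :: real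
    and F :: "'e \<Rightarrow> 'e" and P :: "nat \<Rightarrow> 'h \<Rightarrow> 'h" and Bn :: "nat \<Rightarrow> 'h set"
    and \<phi> \<Phi> :: "'e \<Rightarrow> real" and h :: "nat \<Rightarrow> real"
  assumes \<eta>: "0 \<le> \<eta>" "\<And>b. b \<in> B \<Longrightarrow> \<delta> \<le> mu b - \<kappa> + \<eta>"
    and params: "0 < T" "0 < vartheta" "0 < c" "0 \<le> \<theta>" "0 \<le> \<epsilon>"
      "0 \<le> \<alpha>" "\<alpha> \<le> 1/2" "\<phi>' < 1" "0 < \<gamma>" "\<gamma> < 1"
      "- \<alpha> \<le> \<rho>" "\<rho> < \<sigma>" "\<sigma> < 1 - max \<alpha> \<gamma>" "0 < chi"
      "chi \<le> min ((\<sigma> - \<rho>) / (1 + vartheta)) ((1 - \<alpha> - \<rho>) / (1 + 2 * vartheta))"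
    and F_cont: "continuous_map (ntop (Hs \<sigma>) (nrm \<sigma>)) (ntop (Hs (- \<alpha>)) (nrm (- \<alpha>))) F"
    and P: "\<And>n. 1 \<le> n \<Longrightarrow> finite (Bn n) \<and> Bn n \<subseteq> B \<and> (\<forall>u. P n u = (\<Sum>b\<in>Bn n. (b \<bullet> u) *\<^sub>R b))"
    and tail: "\<And>C. \<forall>\<^sub>F n in sequentially. \<forall>b\<in>B - Bn n. C \<le> mu b"
    and \<phi>_\<Phi>: "\<And>w. w \<in> Hs 1 \<Longrightarrow> 0 \<le> \<phi> w \<and> 0 \<le> \<Phi> w"
    and F_H: "\<And>n v. 1 \<le> n \<Longrightarrow> v \<in> range (P n) \<Longrightarrow> F (j v) \<in> range j"
    and F_growth: "\<And>n v. 1 \<le> n \<Longrightarrow> v \<in> range (P n) \<Longrightarrow> nrm (- \<gamma>) (F (j v)) \<le> c * (2 * \<epsilon> + (norm v)\<^sup>2)"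
    and F_coercive: "\<And>n v w. 1 \<le> n \<Longrightarrow> v \<in> range (P n) \<Longrightarrow> w \<in> range (P n) \<Longrightarrow>
          v \<bullet> P n (inv j (F (j (v + w))))
            \<le> \<phi> (j w) * (norm v)\<^sup>2 + \<phi>' * (norm (fpow B (shift_op \<eta> A) (1/2) v))\<^sup>2 + \<Phi> (j w)"
    and F_lipschitz: "\<And>n v w. 1 \<le> n \<Longrightarrow> v \<in> range (P n) \<Longrightarrow> w \<in> range (P n) \<Longrightarrow>
          nrm (- \<alpha>) (F (j v) - F (j w))
            \<le> \<theta> * (1 + nrm \<rho> (j v) powr vartheta + nrm \<rho> (j w) powr vartheta) * nrm \<rho> (j v - j w)"
    and h: "\<And>n. 1 \<le> n \<Longrightarrow> 0 < h n \<and> h n \<le> T" "h \<longlonglongrightarrow> 0"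
begin

lemma Bn: "1 \<le> n \<Longrightarrow> finite (Bn n)" "1 \<le> n \<Longrightarrow> Bn n \<subseteq> B"
  and P_fin: "1 \<le> n \<Longrightarrow> P n u = fin (Bn n) (\<lambda>b. b \<bullet> u)"
  using P by (auto simp: fin_def)

lemma inner_P: "1 \<le> n \<Longrightarrow> b \<in> B \<Longrightarrow> b \<bullet> P n u = (if b \<in> Bn n then b \<bullet> u else 0)"
  by (simp add: P_fin inner_fin Bn)

lemma bounded_linear_P:
  assumes "1 \<le> n"
  shows "bounded_linear (P n)"
proof -
  have "P n = (\<lambda>v. fin (Bn n) (\<lambda>b. b \<bullet> v))" using P_fin[OF assms] by blast
  then show ?thesis using bounded_linear_fin[of "Bn n"] by simp
qed

lemma norm_P_le: "1 \<le> n \<Longrightarrow> norm (P n u) \<le> norm u"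
  by (simp add: P_fin norm_fin Bn L2_set_inner_le)

lemma fin_in_range_P:
  assumes "1 \<le> n"
  shows "fin (Bn n) w \<in> range (P n)"
proof (rule range_eqI)
  show "fin (Bn n) w = P n (fin (Bn n) w)"
    using assms Bn[of n] by (intro basis_eqI) (simp add: inner_P inner_fin)
qed

text \<open>A basis vector \<open>b\<close> belongs to \<open>Bn n\<close> as soon as all eigenvalues outside \<open>Bn n\<close> exceed the one of \<open>b\<close>. Hence the
  contractions \<open>P n\<close> converge on \<open>span B\<close>, and on its closure.\<close>

lemma P_tendsto: "(\<lambda>n. P n v) \<longlonglongrightarrow> v"
proof -
  have ev: "\<forall>\<^sub>F n in sequentially. 1 \<le> n \<and> P n u = u" if "u \<in> span B" for u
    using that
  proof (induction rule: span_induct_alt)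
    case base
    show ?case using eventually_ge_at_top[of 1] by eventually_elim (simp add: P_fin fin_def)
  next
    case (step c b u)
    show ?case
      using tail[of "mu b + 1"] step(2)
    proof eventually_elim
      case (elim n)
      then have "b \<in> Bn n" using step(1) by force
      then have "P n b = b"
        using elim step(1) Bn[of n] by (intro basis_eqI) (auto simp: inner_P inner_basis)
      then show ?case
        using elim linear_add[OF bounded_linear.linear[OF bounded_linear_P]]
          linear_scale[OF bounded_linear.linear[OF bounded_linear_P]] by simp
    qed
  qed
  show ?thesis
  proof (rule tendstoI)
    fix e :: real assume e: "0 < e"
    have "v \<in> closure (span B)" using basis by (simp add: orthonormal_basis_def)
    then obtain u where u: "u \<in> span B" "dist u v < e/2"
      using e unfolding closure_approachable by (meson half_gt_zero)
    show "\<forall>\<^sub>F n in sequentially. dist (P n v) v < e"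
      using ev[OF u(1)]
    proof eventually_elim
      case (elim n)
      have "dist (P n v) (P n u) \<le> dist v u"
        using norm_P_le[of n "v - u"] elim linear_diff[OF bounded_linear.linear[OF bounded_linear_P], of n v u]
        by (simp add: dist_norm)
      then show ?case
        using dist_triangle[of "P n v" v "P n u"] elim u(2) by (simp add: dist_commute)
    qed
  qed
qed

text \<open>The semigroup, from the coordinates on \<open>H\<^sub>-\<^sub>\<alpha>\<close> to those on \<open>H\<^sub>\<sigma>\<close>.\<close>

definition K :: "real \<Rightarrow> 'h \<Rightarrow> 'h" where
  "K t = dg (\<lambda>b. mu b powr (\<sigma> + \<alpha>) * exp ((\<kappa> - mu b) * t))"

lemma exponents: "0 < \<sigma> + \<alpha>" "\<sigma> + \<alpha> < 1" "\<sigma> + \<gamma> < 1"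
  using params(11-13) by linarith+

lemma K_mult_bdd: "0 < t \<Longrightarrow> bdd_mult (\<lambda>b. mu b powr (\<sigma> + \<alpha>) * exp ((\<kappa> - mu b) * t))"
  using exponents by (intro bdd_mult_smoothing) auto

lemma inner_K: "0 < t \<Longrightarrow> b \<in> B \<Longrightarrow> b \<bullet> K t v = mu b powr (\<sigma> + \<alpha>) * exp ((\<kappa> - mu b) * t) * (b \<bullet> v)"
  unfolding K_def by (rule inner_dg_bdd[OF K_mult_bdd])

lemma smoothing_multiplier_le_T:
  assumes "0 \<le> a" "a \<le> 1" "0 < t" "t \<le> T" "b \<in> B"
  shows "mu b powr a * exp ((\<kappa> - mu b) * t) \<le> exp (\<kappa> * T) * t powr - a"
proof -
  have "exp (\<kappa> * t) \<le> exp (\<kappa> * T)" using assms \<kappa>_nonneg by (simp add: mult_left_mono)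
  then show ?thesis
    using smoothing_multiplier_le[OF assms(1-3,5)] by (meson mult_right_mono order_trans powr_ge_zero)
qed

lemma singular_kernel_K: "singular_kernel K (exp (\<kappa> * T)) (\<sigma> + \<alpha>) T"
  unfolding singular_kernel_def
proof (intro conjI allI ballI impI)
  show "bounded_linear (K r)" if "0 < r" for r
    unfolding K_def by (rule bounded_linear_dg[OF K_mult_bdd[OF that]])
  show "norm (K r v) \<le> exp (\<kappa> * T) * r powr - (\<sigma> + \<alpha>) * norm v" if "0 < r \<and> r \<le> T" for r v
    unfolding K_def using that exponents smoothing_multiplier_le_T[of "\<sigma> + \<alpha>" r] by (intro norm_dg_le) auto
  fix g :: "real \<Rightarrow> 'h" assume g: "g \<in> borel_measurable borel"
  (* The projections of \<open>K r (g r)\<close> are finite sums with measurable coefficients. *)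
  show "(\<lambda>r. indicator {0<..} r *\<^sub>R K r (g r)) \<in> borel_measurable borel"
  proof (rule borel_measurable_LIMSEQ_metric)
    fix r
    have "(\<lambda>n. P (Suc n) (K r (g r))) \<longlonglongrightarrow> K r (g r)" by (rule LIMSEQ_Suc[OF P_tendsto])
    then show "(\<lambda>n. indicator {0<..} r *\<^sub>R P (Suc n) (K r (g r))) \<longlonglongrightarrow> indicator {0<..} r *\<^sub>R K r (g r)"
      by (intro tendsto_intros)
  next
    fix n
    have "indicator {0<..} r *\<^sub>R P (Suc n) (K r (g r)) =
        (\<Sum>b\<in>Bn (Suc n). (indicator {0<..} r * (mu b powr (\<sigma> + \<alpha>) * exp ((\<kappa> - mu b) * r) * (b \<bullet> g r))) *\<^sub>R b)" for r
      using Bn(2)[of "Suc n"] by (cases "0 < r") (auto simp: P_fin fin_def inner_K subset_iff intro!: sum.cong)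
    then show "(\<lambda>r. indicator {0<..} r *\<^sub>R P (Suc n) (K r (g r))) \<in> borel_measurable borel"
      using g by simp
  qed
qed (use exponents in auto)

definition Kn :: "nat \<Rightarrow> real \<Rightarrow> 'h \<Rightarrow> 'h" where
  "Kn n t v = P (Suc n) (K t v)"

text \<open>The projection removes only eigenvectors with large eigenvalues, for which \<open>mu b powr - \<beta>\<close> is small. The
  complementary factor \<open>mu b powr \<beta>\<close> makes the singularity stronger, but it stays integrable if \<open>\<beta>\<close> is half
  of the distance from \<open>\<sigma> + \<alpha>\<close> to 1.\<close>

lemma kernel_approx_Kn:
  "\<exists>d a'. d \<longlonglongrightarrow> 0 \<and> (\<forall>n. kernel_approx K (Kn n) (exp (\<kappa> * T)) (\<sigma> + \<alpha>) (d n) a' T)"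
proof -
  define \<beta> where "\<beta> = (1 - (\<sigma> + \<alpha>)) / 2"
  have \<beta>: "0 < \<beta>" "\<sigma> + \<alpha> + \<beta> < 1" using exponents by (simp_all add: \<beta>_def field_simps)
  define s where "s = (\<lambda>n. Sup (insert 0 ((\<lambda>b. mu b powr - \<beta>) ` (B - Bn (Suc n)))))"
  have bdd: "bdd_above (insert 0 ((\<lambda>b. mu b powr - \<beta>) ` (B - Bn (Suc n))))" for n
    using mu_powr_le[of "- \<beta>"] \<beta> by (intro bdd_aboveI[of _ "\<delta> powr - \<beta>"]) auto
  have s_ge: "mu b powr - \<beta> \<le> s n" if "b \<in> B - Bn (Suc n)" for b n
    unfolding s_def using that by (intro cSup_upper bdd) auto
  have s0: "0 \<le> s n" for n unfolding s_def by (intro cSup_upper bdd) auto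
  have "s \<longlonglongrightarrow> 0"
  proof (rule tendstoI)
    fix e :: real assume e: "0 < e"
    define C where "C = (e/2) powr (- 1 / \<beta>)"
    have C: "0 < C" "C powr - \<beta> = e/2" using e \<beta> by (auto simp: C_def powr_powr)
    have "\<forall>\<^sub>F n in sequentially. \<forall>b\<in>B - Bn (Suc n). C \<le> mu b"
      using tail[of C] by (subst eventually_sequentially_Suc)
    then show "\<forall>\<^sub>F n in sequentially. dist (s n) 0 < e"
    proof eventually_elim
      case (elim n)
      have "s n \<le> e/2" unfolding s_def
      proof (rule cSup_least)
        fix y assume "y \<in> insert 0 ((\<lambda>b. mu b powr - \<beta>) ` (B - Bn (Suc n)))"
        then show "y \<le> e/2"
        proof
          assume "y \<in> (\<lambda>b. mu b powr - \<beta>) ` (B - Bn (Suc n))"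
          then obtain b where b: "b \<in> B - Bn (Suc n)" "y = mu b powr - \<beta>" by auto
          then have "y \<le> C powr - \<beta>" using elim C \<beta> by (auto intro!: powr_mono2')
          then show ?thesis using C by simp
        qed (use e in simp)
      qed simp
      then show ?case using s0[of n] e by (simp add: dist_real_def)
    qed
  qed
  then have lim: "(\<lambda>n. exp (\<kappa> * T) * s n) \<longlonglongrightarrow> 0" by (intro tendsto_mult_right_zero)
  note K' = singular_kernelD[OF singular_kernel_K]
  have "kernel_approx K (Kn n) (exp (\<kappa> * T)) (\<sigma> + \<alpha>) (exp (\<kappa> * T) * s n) (\<sigma> + \<alpha> + \<beta>) T" for n
    unfolding kernel_approx_def
  proof (intro conjI allI impI)
    show "bounded_linear (Kn n r)" if "0 < r" for r
      unfolding Kn_def using bounded_linear_compose[OF bounded_linear_P K'(4)[OF that], of "Suc n"] by simp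
    show "norm (Kn n r v) \<le> exp (\<kappa> * T) * r powr - (\<sigma> + \<alpha>) * norm v" if "0 < r \<and> r \<le> T" for r v
      unfolding Kn_def using norm_P_le[of "Suc n" "K r v"] K'(5)[of r v] that by simp
    show "norm (K r v - Kn n r v) \<le> exp (\<kappa> * T) * s n * r powr - (\<sigma> + \<alpha> + \<beta>) * norm v" if r: "0 < r \<and> r \<le> T" for r v
    proof (rule norm_mono)
      fix b assume b: "b \<in> B"
      show "\<bar>b \<bullet> (K r v - Kn n r v)\<bar> \<le> exp (\<kappa> * T) * s n * r powr - (\<sigma> + \<alpha> + \<beta>) * \<bar>b \<bullet> v\<bar>"
      proof (cases "b \<in> Bn (Suc n)")
        case True
        then show ?thesis using b r s0[of n] by (simp add: Kn_def inner_diff_right inner_P)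
      next
        case False
        have "mu b powr (\<sigma> + \<alpha>) * exp ((\<kappa> - mu b) * r) = mu b powr - \<beta> * (mu b powr (\<sigma> + \<alpha> + \<beta>) * exp ((\<kappa> - mu b) * r))"
          by (simp add: powr_add[symmetric] mult.assoc[symmetric])
        also have "\<dots> \<le> s n * (exp (\<kappa> * T) * r powr - (\<sigma> + \<alpha> + \<beta>))"
          using False b r s0[of n] exponents \<beta> by (intro mult_mono s_ge smoothing_multiplier_le_T) auto
        finally have "mu b powr (\<sigma> + \<alpha>) * exp ((\<kappa> - mu b) * r) * \<bar>b \<bullet> v\<bar> \<le> s n * (exp (\<kappa> * T) * r powr - (\<sigma> + \<alpha> + \<beta>)) * \<bar>b \<bullet> v\<bar>"
          by (intro mult_right_mono) auto
        then show ?thesis using b r False by (simp add: Kn_def inner_diff_right inner_P inner_K abs_mult ac_simps)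
      qed
    qed (use s0[of n] in auto)
  qed (use \<beta> s0[of n] in auto)
  then show ?thesis using lim by blast
qed

definition f :: "'h \<Rightarrow> 'h" where
  "f p = inv (V (- \<alpha>)) (F (V \<sigma> p))"

lemma F_V: "F (V \<sigma> p) = V (- \<alpha>) (f p)"
proof -
  have "F (V \<sigma> p) \<in> Hs (- \<alpha>)"
    using continuous_map_image_subset_topspace[OF F_cont] by (auto simp: image_subset_iff)
  then show ?thesis by (simp add: f_def)
qed

lemma continuous_f: "continuous_on UNIV f"
proof -
  have "continuous_map euclidean (ntop (Hs \<sigma>) (nrm \<sigma>)) (\<lambda>p. V \<sigma> p)"
    unfolding V.continuous_map_V[of _ \<sigma> "\<lambda>p. p"] by simp
  from continuous_map_compose[OF this F_cont] have "continuous_map euclidean (ntop (Hs (- \<alpha>)) (nrm (- \<alpha>))) (\<lambda>p. V (- \<alpha>) (f p))"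
    by (simp add: comp_def F_V)
  then show ?thesis unfolding V.continuous_map_V by simp
qed

lemma V_P: "1 \<le> n \<Longrightarrow> V r (P n p) = j (fin (Bn n) (\<lambda>b. mu b powr - r * (b \<bullet> p)))"
  using Bn[of n] by (intro V_eq_j) (auto simp: inner_P inner_fin mu_powr_cancel)

lemma f_lipschitz_P:
  assumes n: "1 \<le> n"
  defines "e \<equiv> \<delta> powr (\<rho> - \<sigma>)"
  shows "norm (f (P n u) - f (P n v)) \<le>
    \<theta> * (1 + (e * norm u) powr vartheta + (e * norm v) powr vartheta) * (e * norm (u - v))"
proof -
  let ?w = "\<lambda>p. fin (Bn n) (\<lambda>b. mu b powr - \<sigma> * (b \<bullet> p))"
  have e0: "0 \<le> e" by (simp add: e_def)
  have nrm_le: "nrm \<rho> (j (?w p)) \<le> e * norm p" for p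
  proof -
    have "nrm \<rho> (j (?w p)) \<le> \<delta> powr (\<rho> - \<sigma>) * wnorm mu (Bn n) \<sigma> (\<lambda>b. mu b powr - \<sigma> * (b \<bullet> p))"
      unfolding nrm_j_fin[OF Bn[OF n]] using \<delta>_pos mu_ge Bn(2)[OF n] params by (intro wnorm_embedding) auto
    also have "wnorm mu (Bn n) \<sigma> (\<lambda>b. mu b powr - \<sigma> * (b \<bullet> p)) = L2_set (\<lambda>b. b \<bullet> p) (Bn n)"
      unfolding wnorm_def by (intro L2_set_cong refl mu_powr_cancel(1)) (use Bn(2)[OF n] in blast)
    also have "\<dots> \<le> norm p" by (rule L2_set_inner_le[OF Bn[OF n]])
    finally show ?thesis by (simp add: e_def mult_left_mono)
  qed
  have nn: "0 \<le> nrm \<rho> (j (?w p))" for p unfolding nrm_j_fin[OF Bn[OF n]] by (rule wnorm_nonneg)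
  have w_diff: "j (?w u) - j (?w v) = j (?w (u - v))"
    by (simp add: linear_diff[OF linear_j, symmetric] fin_diff[symmetric] inner_diff_right right_diff_distrib)
  have "norm (f (P n u) - f (P n v)) = nrm (- \<alpha>) (V (- \<alpha>) (f (P n u) - f (P n v)))" by simp
  also have "\<dots> = nrm (- \<alpha>) (F (j (?w u)) - F (j (?w v)))"
    by (simp only: V.V_diff F_V[symmetric] V_P[OF n])
  also have "\<dots> \<le> \<theta> * (1 + nrm \<rho> (j (?w u)) powr vartheta + nrm \<rho> (j (?w v)) powr vartheta) * nrm \<rho> (j (?w u) - j (?w v))"
    by (intro F_lipschitz[OF n] fin_in_range_P[OF n])
  also have "\<dots> \<le> \<theta> * (1 + (e * norm u) powr vartheta + (e * norm v) powr vartheta) * (e * norm (u - v))"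
    unfolding w_diff using nrm_le nn params e0
    by (intro mult_mono add_mono powr_mono2) (auto intro!: mult_nonneg_nonneg add_nonneg_nonneg)
  finally show ?thesis .
qed

text \<open>The Lipschitz estimate is known on the ranges of the projections, with constants that do not depend on
  \<open>n\<close>. As \<open>f\<close> is continuous and \<open>P n u\<close> tends to \<open>u\<close>, it passes to the limit.\<close>

lemma f_locally_lipschitz: "\<exists>L. \<forall>u v. norm u \<le> R \<longrightarrow> norm v \<le> R \<longrightarrow> norm (f u - f v) \<le> L * norm (u - v)"
proof -
  define e where "e = \<delta> powr (\<rho> - \<sigma>)"
  have e0: "0 \<le> e" by (simp add: e_def)
  have "norm (f u - f v) \<le> (\<theta> * (1 + (e * R) powr vartheta + (e * R) powr vartheta) * e) * norm (u - v)"
    if uv: "norm u \<le> R" "norm v \<le> R" for u v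
  proof (rule tendsto_upperbound)
    have lim: "(\<lambda>n. f (P n w)) \<longlonglongrightarrow> f w" for w
      using continuous_on_tendsto_compose[OF continuous_f P_tendsto] by simp
    show "(\<lambda>n. norm (f (P n u) - f (P n v))) \<longlonglongrightarrow> norm (f u - f v)"
      by (intro tendsto_intros lim)
    show "\<forall>\<^sub>F n in sequentially. norm (f (P n u) - f (P n v)) \<le> (\<theta> * (1 + (e * R) powr vartheta + (e * R) powr vartheta) * e) * norm (u - v)"
      using eventually_ge_at_top[of 1]
    proof eventually_elim
      case (elim n)
      have "norm (f (P n u) - f (P n v)) \<le> \<theta> * (1 + (e * norm u) powr vartheta + (e * norm v) powr vartheta) * (e * norm (u - v))"
        unfolding e_def by (rule f_lipschitz_P[OF elim])
      also have "\<dots> \<le> \<theta> * (1 + (e * R) powr vartheta + (e * R) powr vartheta) * (e * norm (u - v))"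
        using uv params e0 by (intro mult_right_mono mult_left_mono add_mono powr_mono2) auto
      finally show ?case by (simp only: mult.assoc)
    qed
  qed simp
  then show ?thesis by blast
qed

lemma mild_integrand:
  assumes "0 < s"
  shows "ext_semigroup B A j (Hs (- \<alpha>)) (nrm (- \<alpha>)) s (F (V \<sigma> p)) = V \<sigma> (K s (f p))"
proof -
  have bdd: "bdd_mult (\<lambda>b. mu b powr \<alpha> * exp ((\<kappa> - mu b) * s))"
    using params assms by (intro bdd_mult_smoothing) auto
  have "ext_semigroup B A j (Hs (- \<alpha>)) (nrm (- \<alpha>)) s (F (V \<sigma> p)) = j (dg (\<lambda>b. mu b powr \<alpha> * exp ((\<kappa> - mu b) * s)) (f p))"
    unfolding F_V using ext_semigroup_V[of "- \<alpha>" s "f p"] params assms by simp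
  also have "\<dots> = V \<sigma> (K s (f p))"
    using assms by (intro V_eq_j[symmetric]) (simp add: inner_K inner_dg_bdd[OF bdd] powr_add)
  finally show ?thesis .
qed

lemma scheme_integrand:
  assumes n: "1 \<le> n" and s: "0 < s"
  shows "j (P n (inv j (ext_semigroup B A j (Hs (- \<alpha>)) (nrm (- \<alpha>)) s (a *\<^sub>R F (V \<sigma> p))))) = V \<sigma> (P n (K s (a *\<^sub>R f p)))"
proof -
  have bdd: "bdd_mult (\<lambda>b. mu b powr \<alpha> * exp ((\<kappa> - mu b) * s))"
    using params s by (intro bdd_mult_smoothing) auto
  have "ext_semigroup B A j (Hs (- \<alpha>)) (nrm (- \<alpha>)) s (a *\<^sub>R F (V \<sigma> p)) = j (dg (\<lambda>b. mu b powr \<alpha> * exp ((\<kappa> - mu b) * s)) (a *\<^sub>R f p))"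
    unfolding F_V V.V_scale[symmetric] using ext_semigroup_V[of "- \<alpha>" s "a *\<^sub>R f p"] params s by simp
  then have "j (P n (inv j (ext_semigroup B A j (Hs (- \<alpha>)) (nrm (- \<alpha>)) s (a *\<^sub>R F (V \<sigma> p)))))
      = j (P n (dg (\<lambda>b. mu b powr \<alpha> * exp ((\<kappa> - mu b) * s)) (a *\<^sub>R f p)))" by simp
  also have "\<dots> = V \<sigma> (P n (K s (a *\<^sub>R f p)))"
    using s n by (intro V_eq_j[symmetric]) (simp add: inner_P inner_K inner_dg_bdd[OF bdd] powr_add)
  finally show ?thesis .
qed

end

section \<open>Convergence along a path\<close>

context interpolation
begin

lemma j_eq_V_dg:
  assumes "r \<le> 0"
  shows "j u = V r (dg (\<lambda>b. mu b powr r) u)"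
  by (rule V_eq_j[symmetric]) (simp add: inner_dg_bdd[OF bdd_mult_mu_powr[OF assms]])

lemma wnorm_le_nrm_j:
  assumes "r \<le> 0" "finite J" "J \<subseteq> B"
  shows "wnorm mu J r (\<lambda>b. b \<bullet> u) \<le> nrm r (j u)"
proof -
  have "wnorm mu J r (\<lambda>b. b \<bullet> u) = L2_set (\<lambda>b. b \<bullet> dg (\<lambda>b. mu b powr r) u) J"
    unfolding wnorm_def using assms(3)
    by (intro L2_set_cong) (auto simp: inner_dg_bdd[OF bdd_mult_mu_powr[OF assms(1)]])
  also have "\<dots> \<le> norm (dg (\<lambda>b. mu b powr r) u)" by (rule L2_set_inner_le[OF assms(2,3)])
  also have "\<dots> = nrm r (j u)" unfolding j_eq_V_dg[OF assms(1)] V.N_V ..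
  finally show ?thesis .
qed

end

text \<open>The hypotheses of the theorem at a single \<open>\<omega>\<close>, for approximations \<open>Xp\<close> which occur also in their own
  truncated nonlinearity.\<close>

locale galerkin_path = galerkin +
  fixes Xp Op Qp :: "nat \<Rightarrow> real \<Rightarrow> 'b" and Ol :: "real \<Rightarrow> 'b"
  assumes in_Hs: "\<And>n t. 1 \<le> n \<Longrightarrow> t \<in> {0..T} \<Longrightarrow> Xp n t \<in> Hs \<sigma> \<and> Qp n t \<in> Hs \<sigma>"
    and O_cont: "\<And>n. 1 \<le> n \<Longrightarrow> continuous_map (top_of_set {0..T}) (ntop (Hs \<sigma>) (nrm \<sigma>)) (Op n)"
    and Ol_cont: "continuous_map (top_of_set {0..T}) (ntop (Hs \<sigma>) (nrm \<sigma>)) Ol"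
    and O_range: "\<And>n t. 1 \<le> n \<Longrightarrow> t \<in> {0..T} \<Longrightarrow> Op n t \<in> j ` range (P n)"
    and X_eq: "\<And>n t. 1 \<le> n \<Longrightarrow> t \<in> {0..T} \<Longrightarrow> has_time_integral (Hs \<sigma>) (nrm \<sigma>) t
            (\<lambda>s. j (P n (inv j (ext_semigroup B A j (Hs (- \<alpha>)) (nrm (- \<alpha>)) (t - s)
               (of_bool (nrm \<sigma> (Xp n (round_down (h n) s)) + nrm \<sigma> (Op n (round_down (h n) s)) \<le> \<bar>h n\<bar> powr (- chi))
                 *\<^sub>R F (Xp n (round_down (h n) s)))))))
            (Xp n t - Op n t)"
    and Q_eq: "\<And>n t. 1 \<le> n \<Longrightarrow> t \<in> {0..T} \<Longrightarrow> has_time_integral (Hs \<sigma>) (nrm \<sigma>) t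
            (\<lambda>s. j (exp (- \<eta> * (t - s)) *\<^sub>R semigroup_op B A (t - s) (\<eta> *\<^sub>R inv j (Op n s))))
            (Op n t - Qp n t)"
    and bound: "liminf (\<lambda>m. ereal (LBINT r:{0..T}.
            exp (LBINT u:{r..T}. 2 * \<phi> (Qp m (round_down (h m) u))) *
            (1 + \<bar>\<Phi> (Qp m (round_down (h m) r))\<bar>
               + (LBINT u:{0..T}. nrm \<sigma> (Op m u) powr (4 + 4 * vartheta))
               + (norm (inv j (Qp m r)))\<^sup>2))) < \<infinity>"
    and O_conv: "limsup (\<lambda>m. SUP t\<in>{0..T}. ereal (nrm \<sigma> (Ol t - Op m t))) = 0"
begin

definition x where "x n t = inv (V \<sigma>) (Xp n t)"
definition z where "z n t = inv (V \<sigma>) (Op n t)"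
definition q where "q n t = inv (V \<sigma>) (Qp n t)"
definition zl where "zl t = inv (V \<sigma>) (Ol t)"

lemma V_coords:
  assumes "t \<in> {0..T}"
  shows "V \<sigma> (zl t) = Ol t" "1 \<le> n \<Longrightarrow> V \<sigma> (x n t) = Xp n t" "1 \<le> n \<Longrightarrow> V \<sigma> (z n t) = Op n t"
    "1 \<le> n \<Longrightarrow> V \<sigma> (q n t) = Qp n t"
proof -
  have "Ol t \<in> Hs \<sigma>" using continuous_map_image_subset_topspace[OF Ol_cont] assms by (auto simp: image_subset_iff)
  moreover have "Op n t \<in> Hs \<sigma>" if "1 \<le> n"
    using continuous_map_image_subset_topspace[OF O_cont[OF that]] assms by (auto simp: image_subset_iff)
  ultimately show "V \<sigma> (zl t) = Ol t" "1 \<le> n \<Longrightarrow> V \<sigma> (x n t) = Xp n t" "1 \<le> n \<Longrightarrow> V \<sigma> (z n t) = Op n t"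
    "1 \<le> n \<Longrightarrow> V \<sigma> (q n t) = Qp n t"
    using in_Hs assms by (auto simp: x_def z_def q_def zl_def)
qed

lemma continuous_coords:
  "continuous_on {0..T} zl" "1 \<le> n \<Longrightarrow> continuous_on {0..T} (z n)"
proof -
  have "continuous_map (top_of_set {0..T}) (ntop (Hs \<sigma>) (nrm \<sigma>)) (\<lambda>t. V \<sigma> (zl t))"
    by (rule continuous_map_eq[OF Ol_cont]) (simp add: V_coords)
  then show "continuous_on {0..T} zl" unfolding V.continuous_map_V by simp
  have "continuous_map (top_of_set {0..T}) (ntop (Hs \<sigma>) (nrm \<sigma>)) (\<lambda>t. V \<sigma> (z n t))" if "1 \<le> n"
    by (rule continuous_map_eq[OF O_cont[OF that]]) (simp add: V_coords(3)[OF _ that])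
  then show "1 \<le> n \<Longrightarrow> continuous_on {0..T} (z n)" unfolding V.continuous_map_V by simp
qed

lemma noise_converges: "uniform_limit {0..T} z zl sequentially"
proof (rule uniform_limitI)
  fix e :: real assume e: "0 < e"
  have "\<forall>\<^sub>F m in sequentially. (SUP t\<in>{0..T}. ereal (nrm \<sigma> (Ol t - Op m t))) < ereal e"
    using O_conv e by (intro Limsup_lessD) auto
  then show "\<forall>\<^sub>F m in sequentially. \<forall>t\<in>{0..T}. dist (z m t) (zl t) < e"
    using eventually_ge_at_top[of 1]
  proof eventually_elim
    case (elim m)
    show ?case
    proof
      fix t assume t: "t \<in> {0..T}"
      have "ereal (nrm \<sigma> (Ol t - Op m t)) \<le> (SUP t\<in>{0..T}. ereal (nrm \<sigma> (Ol t - Op m t)))"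
        using t by (rule SUP_upper)
      then have "ereal (nrm \<sigma> (Ol t - Op m t)) < ereal e" using elim(1) by (rule le_less_trans)
      then have "nrm \<sigma> (V \<sigma> (zl t) - V \<sigma> (z m t)) < e" using V_coords[OF t] elim(2) by simp
      then show "dist (z m t) (zl t) < e"
        unfolding V.V_diff[symmetric] V.N_V by (simp add: dist_norm norm_minus_commute)
    qed
  qed
qed

lemma round_down_range:
  assumes "1 \<le> n" "0 < s" "s < t" "t \<in> {0..T}"
  shows "round_down (h n) s \<in> {0..T}"
  using round_down_grid(2,3)[of "h n" s] h(1)[OF assms(1)] assms by auto

lemma scheme:
  assumes n: "1 \<le> n" and t: "t \<in> {0..T}"
  shows "truncated_scheme (\<lambda>r v. P n (K r v)) f (h n) chi (z n) (x n) t"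
proof -
  have "has_time_integral (Hs \<sigma>) (nrm \<sigma>) t
            (\<lambda>s. j (P n (inv j (ext_semigroup B A j (Hs (- \<alpha>)) (nrm (- \<alpha>)) (t - s)
               (of_bool (nrm \<sigma> (Xp n (round_down (h n) s)) + nrm \<sigma> (Op n (round_down (h n) s)) \<le> \<bar>h n\<bar> powr (- chi))
                 *\<^sub>R F (Xp n (round_down (h n) s)))))))
            (V \<sigma> (x n t - z n t))"
    using X_eq[OF n t] unfolding V.V_diff V_coords(2,3)[OF t n] .
  then show ?thesis unfolding truncated_scheme_def
  proof (rule has_time_integral_V[THEN iffD1, rotated])
    fix s assume s: "0 < s" "s < t"
    note r = V_coords(2,3)[OF round_down_range[OF n s t] n]
    have hn: "\<bar>h n\<bar> = h n" using h(1)[OF n] by simp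
    show "j (P n (inv j (ext_semigroup B A j (Hs (- \<alpha>)) (nrm (- \<alpha>)) (t - s)
               (of_bool (nrm \<sigma> (Xp n (round_down (h n) s)) + nrm \<sigma> (Op n (round_down (h n) s)) \<le> \<bar>h n\<bar> powr (- chi))
                 *\<^sub>R F (Xp n (round_down (h n) s)))))) =
        V \<sigma> (P n (K (t - s) (of_bool (norm (x n (round_down (h n) s)) + norm (z n (round_down (h n) s)) \<le> h n powr - chi)
          *\<^sub>R f (x n (round_down (h n) s)))))"
      unfolding r[symmetric] V.N_V hn using s by (intro scheme_integrand[OF n]) auto
  qed
qed

lemma noise_fin:
  assumes n: "1 \<le> n" and t: "t \<in> {0..T}"
  shows "\<forall>b\<in>B - Bn n. b \<bullet> z n t = 0"
proof -
  obtain u where "Op n t = j (P n u)" using O_range[OF n t] by auto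
  then have "V \<sigma> (z n t) = V \<sigma> (fin (Bn n) (\<lambda>b. mu b powr \<sigma> * (b \<bullet> u)))"
    using V_coords(3)[OF t n] by (simp add: P_fin[OF n] j_fin[OF Bn[OF n], symmetric])
  then show ?thesis using Bn[OF n] by (simp add: inner_fin)
qed

lemma shift_equation:
  assumes n: "1 \<le> n" and t: "t \<in> {0..T}"
  shows "has_bochner_integral (time_measure t)
    (\<lambda>s. fin (Bn n) (\<lambda>b. exp (- (mu b - (\<kappa> - \<eta>)) * (t - s)) * (\<eta> * (b \<bullet> z n s)))) (z n t - q n t)"
proof -
  have "has_time_integral (Hs \<sigma>) (nrm \<sigma>) t
            (\<lambda>s. j (exp (- \<eta> * (t - s)) *\<^sub>R semigroup_op B A (t - s) (\<eta> *\<^sub>R inv j (Op n s))))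
            (V \<sigma> (z n t - q n t))"
    using Q_eq[OF n t] unfolding V.V_diff V_coords(3,4)[OF t n] .
  then show ?thesis
  proof (rule has_time_integral_V[THEN iffD1, rotated])
    fix s assume s: "0 < s" "s < t"
    then have sT: "s \<in> {0..T}" using t by auto
    obtain u where u: "Op n s = j (P n u)" using O_range[OF n sT] by auto
    have "V \<sigma> (z n s) = V \<sigma> (fin (Bn n) (\<lambda>b. mu b powr \<sigma> * (b \<bullet> u)))"
      using V_coords(3)[OF sT n] u by (simp add: P_fin[OF n] j_fin[OF Bn[OF n], symmetric])
    then have zs: "z n s = fin (Bn n) (\<lambda>b. mu b powr \<sigma> * (b \<bullet> u))" by simp
    have bdd: "bdd_mult (\<lambda>b. exp ((\<kappa> - mu b) * (t - s)))"
      using mu_pos s by (intro bdd_multI[of _ "exp (\<kappa> * (t - s))"]) (simp add: less_imp_le)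
    have "exp (- (mu b - (\<kappa> - \<eta>)) * (t - s)) = exp (- \<eta> * (t - s)) * exp ((\<kappa> - mu b) * (t - s))" for b
      by (simp add: exp_add[symmetric] algebra_simps)
    then show "j (exp (- \<eta> * (t - s)) *\<^sub>R semigroup_op B A (t - s) (\<eta> *\<^sub>R inv j (Op n s))) =
        V \<sigma> (fin (Bn n) (\<lambda>b. exp (- (mu b - (\<kappa> - \<eta>)) * (t - s)) * (\<eta> * (b \<bullet> z n s))))"
      unfolding u inv_j semigroup_op_eq_dg using Bn[OF n] n
      by (intro V_eq_j[symmetric]) (auto simp: inner_fin inner_dg_bdd[OF bdd] zs inner_P subset_iff)
  qed
qed

lemma has_bochner_integral_zero_value:
  assumes "has_bochner_integral (time_measure t) g y" "\<And>s. 0 < s \<Longrightarrow> s < t \<Longrightarrow> b \<bullet> g s = 0"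
  shows "b \<bullet> y = 0"
proof -
  have "has_bochner_integral (time_measure t) (\<lambda>s. b \<bullet> g s) (b \<bullet> y)"
    using has_bochner_integral_bounded_linear[OF bounded_linear_inner_right assms(1)] .
  moreover have "has_bochner_integral (time_measure t) (\<lambda>s. b \<bullet> g s) 0"
    by (rule has_bochner_integral_cong[THEN iffD1, OF _ _ _ has_bochner_integral_zero])
      (use assms(2) in \<open>auto simp: space_restrict_space\<close>)
  ultimately show ?thesis by (rule has_bochner_integral_eq)
qed

text \<open>Both integrands take values in the range of \<open>P n\<close>, up to coordinates, and so do their integrals.\<close>

lemma approximation_fin:
  assumes n: "1 \<le> n" and t: "t \<in> {0..T}"
  shows "\<forall>b\<in>B - Bn n. b \<bullet> x n t = 0" "\<forall>b\<in>B - Bn n. b \<bullet> q n t = 0"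
proof -
  have "b \<bullet> (x n t - z n t) = 0" if "b \<in> B - Bn n" for b
    using scheme[OF n t] unfolding truncated_scheme_def
    by (rule has_bochner_integral_zero_value) (use that in \<open>simp add: inner_P[OF n]\<close>)
  then show "\<forall>b\<in>B - Bn n. b \<bullet> x n t = 0" using noise_fin[OF assms] by (simp add: inner_diff_right)
  have "b \<bullet> (z n t - q n t) = 0" if "b \<in> B - Bn n" for b
    using shift_equation[OF n t]
    by (rule has_bochner_integral_zero_value) (use that in \<open>simp add: inner_fin[OF Bn[OF n]]\<close>)
  then show "\<forall>b\<in>B - Bn n. b \<bullet> q n t = 0" using noise_fin[OF assms] by (simp add: inner_diff_right)
qed

text \<open>If \<open>p\<close> are the coordinates of an element of \<open>H\<^sub>\<sigma>\<close>, these are its coefficients as an element of \<open>H\<close>.\<close>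

definition H_coord :: "'a \<Rightarrow> 'a \<Rightarrow> real" where
  "H_coord p b = mu b powr - \<sigma> * (b \<bullet> p)"

definition F_coord :: "nat \<Rightarrow> ('a \<Rightarrow> real) \<Rightarrow> 'a \<Rightarrow> real" where
  "F_coord n v b = b \<bullet> inv j (F (j (fin (Bn n) v)))"

lemma fin_H_coord:
  assumes n: "1 \<le> n" and p: "\<forall>b\<in>B - Bn n. b \<bullet> p = 0"
  shows "j (fin (Bn n) (H_coord p)) = V \<sigma> p" "wnorm mu (Bn n) \<sigma> (H_coord p) = norm p"
proof -
  have eq: "p = fin (Bn n) (\<lambda>b. mu b powr \<sigma> * H_coord p b)"
    using p Bn[OF n] by (intro basis_eqI) (auto simp: inner_fin H_coord_def mu_powr_cancel)
  show *: "j (fin (Bn n) (H_coord p)) = V \<sigma> p"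
    unfolding j_fin[OF Bn[OF n], of _ \<sigma>] eq[symmetric] ..
  show "wnorm mu (Bn n) \<sigma> (H_coord p) = norm p"
    unfolding nrm_j_fin[OF Bn[OF n], symmetric] * by simp
qed

lemma F_coord_j:
  assumes n: "1 \<le> n"
  shows "F (j (fin (Bn n) v)) = j (inv j (F (j (fin (Bn n) v))))"
  by (rule f_inv_into_f[OF F_H[OF n fin_in_range_P[OF n]], symmetric])

lemma inner_f:
  assumes n: "1 \<le> n" and p: "\<forall>b\<in>B - Bn n. b \<bullet> p = 0" and b: "b \<in> B"
  shows "b \<bullet> f p = mu b powr - \<alpha> * F_coord n (H_coord p) b"
proof -
  have \<alpha>: "- \<alpha> \<le> 0" using params by simp
  have "V (- \<alpha>) (f p) = F (j (fin (Bn n) (H_coord p)))" by (simp only: F_V[symmetric] fin_H_coord(1)[OF n p])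
  also have "\<dots> = j (inv j (F (j (fin (Bn n) (H_coord p)))))" by (rule F_coord_j[OF n])
  also have "\<dots> = V (- \<alpha>) (dg (\<lambda>b. mu b powr - \<alpha>) (inv j (F (j (fin (Bn n) (H_coord p))))))"
    by (rule j_eq_V_dg[OF \<alpha>])
  finally have "f p = dg (\<lambda>b. mu b powr - \<alpha>) (inv j (F (j (fin (Bn n) (H_coord p)))))" by simp
  then show ?thesis using b by (simp add: F_coord_def inner_dg_bdd[OF bdd_mult_mu_powr[OF \<alpha>]])
qed

lemma inner_scheme:
  assumes n: "1 \<le> n" and p: "\<forall>b\<in>B - Bn n. b \<bullet> p = 0" and b: "b \<in> Bn n" and r: "0 < r"
  shows "b \<bullet> P n (K r (a *\<^sub>R f p)) = mu b powr \<sigma> * (exp ((\<kappa> - mu b) * r) * (a * F_coord n (H_coord p) b))"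
proof -
  have bB: "b \<in> B" using b Bn(2)[OF n] by auto
  have "b \<bullet> P n (K r (a *\<^sub>R f p)) = (mu b powr (\<sigma> + \<alpha>) * mu b powr - \<alpha>) * (exp ((\<kappa> - mu b) * r) * (a * F_coord n (H_coord p) b))"
    using b bB r n by (simp add: inner_P inner_K inner_f[OF n p bB])
  also have "mu b powr (\<sigma> + \<alpha>) * mu b powr - \<alpha> = mu b powr \<sigma>" by (simp add: powr_add[symmetric])
  finally show ?thesis .
qed

lemma energy_setting_instance:
  assumes "0 \<le> C"
  shows "energy_setting B mu \<delta> \<delta> \<kappa> \<eta> T \<alpha> \<rho> \<sigma> vartheta chi \<theta> \<phi>' C (norm (f 0))"
proof
  show "chi * (1 + vartheta) \<le> \<sigma> - \<rho>" "chi * (1 + 2 * vartheta) \<le> 1 - \<alpha> - \<rho>"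
    using params by (simp_all add: field_simps)
qed (use \<delta>_pos mu_ge \<eta> \<kappa>_nonneg params assms in auto)

lemma galerkin_data_instance:
  assumes n: "1 \<le> n" and C: "0 \<le> C" and z_le: "\<And>t. t \<in> {0..T} \<Longrightarrow> norm (z n t) \<le> C"
  shows "energy_setting.galerkin_data B mu \<kappa> \<eta> T \<alpha> \<rho> \<sigma> vartheta chi \<theta> \<phi>' C (norm (f 0))
    (Bn n) (h n) (\<lambda>t. H_coord (x n t)) (\<lambda>t. H_coord (z n t)) (\<lambda>t. H_coord (q n t)) (F_coord n)
    (\<lambda>v. \<phi> (j (fin (Bn n) v))) (\<lambda>v. \<Phi> (j (fin (Bn n) v)))"
proof -
  note fB = Bn[OF n] and hn = h(1)[OF n]
  interpret E: energy_setting B mu \<delta> \<delta> \<kappa> \<eta> T \<alpha> \<rho> \<sigma> vartheta chi \<theta> \<phi>' C "norm (f 0)"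
    by (rule energy_setting_instance[OF C])
  note xf = approximation_fin(1)[OF n] and qf = approximation_fin(2)[OF n] and zf = noise_fin[OF n]
  show ?thesis unfolding E.galerkin_data_def
  proof (intro conjI allI ballI)
    fix t b assume t: "t \<in> {0..T}" and b: "b \<in> Bn n"
    have bB: "b \<in> B" using b fB by auto
    have "has_bochner_integral (time_measure t) (\<lambda>s. mu b powr - \<sigma> * (b \<bullet> P n (K (t - s)
        (of_bool (norm (x n (round_down (h n) s)) + norm (z n (round_down (h n) s)) \<le> h n powr - chi) *\<^sub>R f (x n (round_down (h n) s))))))
      (mu b powr - \<sigma> * (b \<bullet> (x n t - z n t)))"
      using scheme[OF n t] unfolding truncated_scheme_def
      by (intro has_bochner_integral_mult_right has_bochner_integral_bounded_linear[OF bounded_linear_inner_right])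
    then show "has_bochner_integral (time_measure t)
        (\<lambda>s. exp (- (mu b - \<kappa>) * (t - s)) *
          (of_bool (wnorm mu (Bn n) \<sigma> (H_coord (x n (round_down (h n) s))) + wnorm mu (Bn n) \<sigma> (H_coord (z n (round_down (h n) s))) \<le> h n powr - chi)
            * F_coord n (H_coord (x n (round_down (h n) s))) b))
        (H_coord (x n t) b - H_coord (z n t) b)"
    proof (rule has_bochner_integral_cong[THEN iffD1, rotated -1])
      fix s assume "s \<in> space (time_measure t)"
      then have s: "0 < s" "s < t" by (auto simp: space_restrict_space)
      note r = round_down_range[OF n s t]
      have e: "- (mu b - \<kappa>) = \<kappa> - mu b" by simp
      show "mu b powr - \<sigma> * (b \<bullet> P n (K (t - s)
          (of_bool (norm (x n (round_down (h n) s)) + norm (z n (round_down (h n) s)) \<le> h n powr - chi) *\<^sub>R f (x n (round_down (h n) s)))))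
        = exp (- (mu b - \<kappa>) * (t - s)) *
          (of_bool (wnorm mu (Bn n) \<sigma> (H_coord (x n (round_down (h n) s))) + wnorm mu (Bn n) \<sigma> (H_coord (z n (round_down (h n) s))) \<le> h n powr - chi)
            * F_coord n (H_coord (x n (round_down (h n) s))) b)"
        unfolding fin_H_coord(2)[OF n xf[OF r]] fin_H_coord(2)[OF n zf[OF r]] e
        using s by (subst inner_scheme[OF n xf[OF r] b]) (auto simp: mu_powr_cancel[OF bB])
    qed (auto simp: H_coord_def inner_diff_right right_diff_distrib)
    have "has_bochner_integral (time_measure t) (\<lambda>s. mu b powr - \<sigma> * (b \<bullet> fin (Bn n) (\<lambda>b. exp (- (mu b - (\<kappa> - \<eta>)) * (t - s)) * (\<eta> * (b \<bullet> z n s)))))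
        (mu b powr - \<sigma> * (b \<bullet> (z n t - q n t)))"
      using shift_equation[OF n t]
      by (intro has_bochner_integral_mult_right has_bochner_integral_bounded_linear[OF bounded_linear_inner_right])
    then show "has_bochner_integral (time_measure t) (\<lambda>s. exp (- (mu b - (\<kappa> - \<eta>)) * (t - s)) * (\<eta> * H_coord (z n s) b))
        (H_coord (z n t) b - H_coord (q n t) b)"
      using b bB fB by (simp add: inner_fin H_coord_def inner_diff_right right_diff_distrib mult.left_commute)
  next
    fix b assume "b \<in> Bn n"
    show "continuous_on {0..T} (\<lambda>t. H_coord (z n t) b)"
      unfolding H_coord_def by (intro continuous_intros continuous_coords(2)[OF n])
  next
    fix t assume t: "t \<in> {0..T}"
    show "wnorm mu (Bn n) \<sigma> (H_coord (z n t)) \<le> C"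
      using fin_H_coord(2)[OF n zf[OF t]] z_le[OF t] by simp
  next
    have "H_coord 0 = (\<lambda>b. 0)" by (simp add: H_coord_def fun_eq_iff)
    then have "wnorm mu (Bn n) (- \<alpha>) (F_coord n (\<lambda>b. 0)) = L2_set (\<lambda>b. b \<bullet> f 0) (Bn n)"
      unfolding wnorm_def using fB inner_f[OF n, of 0] by (intro L2_set_cong) auto
    also have "\<dots> \<le> norm (f 0)" by (rule L2_set_inner_le[OF fB])
    finally show "wnorm mu (Bn n) (- \<alpha>) (F_coord n (\<lambda>b. 0)) \<le> norm (f 0)" .
  next
    fix v w :: "'a \<Rightarrow> real"
    have "wnorm mu (Bn n) (- \<alpha>) (\<lambda>b. F_coord n v b - F_coord n w b) \<le>
        nrm (- \<alpha>) (j (inv j (F (j (fin (Bn n) v))) - inv j (F (j (fin (Bn n) w)))))"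
      using wnorm_le_nrm_j[OF _ fB, of "- \<alpha>" "inv j (F (j (fin (Bn n) v))) - inv j (F (j (fin (Bn n) w)))"] params
      by (simp add: F_coord_def inner_diff_right)
    also have "\<dots> = nrm (- \<alpha>) (F (j (fin (Bn n) v)) - F (j (fin (Bn n) w)))"
      by (simp only: linear_diff[OF linear_j] F_coord_j[OF n, symmetric])
    also have "\<dots> \<le> \<theta> * (1 + nrm \<rho> (j (fin (Bn n) v)) powr vartheta + nrm \<rho> (j (fin (Bn n) w)) powr vartheta) * nrm \<rho> (j (fin (Bn n) v) - j (fin (Bn n) w))"
      by (intro F_lipschitz[OF n] fin_in_range_P[OF n])
    also have "\<dots> = \<theta> * (1 + wnorm mu (Bn n) \<rho> v powr vartheta + wnorm mu (Bn n) \<rho> w powr vartheta) * wnorm mu (Bn n) \<rho> (\<lambda>b. v b - w b)"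
      by (simp only: linear_diff[OF linear_j, symmetric] fin_diff[symmetric] nrm_j_fin[OF fB])
    finally show "wnorm mu (Bn n) (- \<alpha>) (\<lambda>b. F_coord n v b - F_coord n w b) \<le>
        \<theta> * (1 + wnorm mu (Bn n) \<rho> v powr vartheta + wnorm mu (Bn n) \<rho> w powr vartheta) * wnorm mu (Bn n) \<rho> (\<lambda>b. v b - w b)" .
  next
    fix v w :: "'a \<Rightarrow> real"
    have "fpow B (shift_op \<eta> A) (1/2) (fin (Bn n) v) = fin (Bn n) (\<lambda>b. (mu b - \<kappa> + \<eta>) powr (1/2) * v b)"
    proof -
      have ev: "b \<bullet> shift_op \<eta> A b = mu b - \<kappa> + \<eta>" if "b \<in> B" for b
        using eigenvalue[OF that] inner_basis[OF that that] by (simp add: shift_op_def inner_diff_right)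
      have "fpow B (shift_op \<eta> A) (1/2) (fin (Bn n) v) = (\<Sum>\<^sub>\<infinity>b\<in>Bn n. ((mu b - \<kappa> + \<eta>) powr (1/2) * v b) *\<^sub>R b)"
        unfolding fpow_def opfun_def using fB
        by (intro infsum_cong_neutral) (auto simp: inner_fin ev subset_iff)
      then show ?thesis using fB by (simp add: fin_def)
    qed
    then have "(norm (fpow B (shift_op \<eta> A) (1/2) (fin (Bn n) v)))\<^sup>2 = (\<Sum>b\<in>Bn n. ((mu b - \<kappa> + \<eta>) powr (1/2) * v b)\<^sup>2)"
      by (simp add: norm_fin[OF fB] L2_set_def sum_nonneg)
    also have "\<dots> = (\<Sum>b\<in>Bn n. (mu b - \<kappa> + \<eta>) * (v b)\<^sup>2)"
    proof (rule sum.cong)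
      fix b assume "b \<in> Bn n"
      then have "0 < mu b - \<kappa> + \<eta>" using \<eta>(2)[of b] \<delta>_pos fB by (auto intro: less_le_trans)
      then show "((mu b - \<kappa> + \<eta>) powr (1/2) * v b)\<^sup>2 = (mu b - \<kappa> + \<eta>) * (v b)\<^sup>2"
        by (simp add: power_mult_distrib powr_half_sqrt)
    qed simp
    finally have n2: "(norm (fpow B (shift_op \<eta> A) (1/2) (fin (Bn n) v)))\<^sup>2 = (\<Sum>b\<in>Bn n. (mu b - \<kappa> + \<eta>) * (v b)\<^sup>2)" .
    have n1: "(norm (fin (Bn n) v))\<^sup>2 = (\<Sum>b\<in>Bn n. (v b)\<^sup>2)"
      by (simp add: norm_fin[OF fB] L2_set_def sum_nonneg)
    have "fin (Bn n) v \<bullet> P n u = (\<Sum>b\<in>Bn n. v b * (b \<bullet> u))" for u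
      unfolding fin_def inner_sum_left inner_scaleR_left using fB(2)
      by (intro sum.cong) (auto simp: inner_P[OF n] subset_iff)
    then have "fin (Bn n) v \<bullet> P n (inv j (F (j (fin (Bn n) v + fin (Bn n) w)))) = (\<Sum>b\<in>Bn n. v b * F_coord n (\<lambda>b. v b + w b) b)"
      by (simp only: fin_add[symmetric] F_coord_def)
    then show "(\<Sum>b\<in>Bn n. v b * F_coord n (\<lambda>b. v b + w b) b) \<le> \<phi> (j (fin (Bn n) w)) * (\<Sum>b\<in>Bn n. (v b)\<^sup>2) +
        \<phi>' * (\<Sum>b\<in>Bn n. (mu b - \<kappa> + \<eta>) * (v b)\<^sup>2) + \<Phi> (j (fin (Bn n) w))"
      using F_coercive[OF n fin_in_range_P[OF n, of v] fin_in_range_P[OF n, of w]] unfolding n1 n2 by simp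
  next
    fix v :: "'a \<Rightarrow> real"
    have "j (fin (Bn n) v) \<in> Hs 1" unfolding j_fin[OF fB, of v 1] by simp
    then show "0 \<le> \<phi> (j (fin (Bn n) v))" "0 \<le> \<Phi> (j (fin (Bn n) v))" using \<phi>_\<Phi> by auto
  qed (use fB hn in auto)
qed

end

context galerkin_path
begin

definition energy_bound :: "nat \<Rightarrow> real" where
  "energy_bound m = (LBINT r:{0..T}.
            exp (LBINT u:{r..T}. 2 * \<phi> (Qp m (round_down (h m) u))) *
            (1 + \<bar>\<Phi> (Qp m (round_down (h m) r))\<bar>
               + (LBINT u:{0..T}. nrm \<sigma> (Op m u) powr (4 + 4 * vartheta))
               + (norm (inv j (Qp m r)))\<^sup>2))"

lemma frequently_energy_bound: "\<exists>l. \<exists>\<^sub>F m in sequentially. energy_bound m < l"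
proof -
  have "liminf (\<lambda>m. ereal (energy_bound m)) < \<infinity>" using bound unfolding energy_bound_def .
  then obtain k :: nat where l: "liminf (\<lambda>m. ereal (energy_bound m)) < ereal (real k)"
    using less_PInf_Ex_of_nat by auto
  define l where "l = real k"
  note l = l[folded l_def]
  have "\<not> (\<forall>\<^sub>F m in sequentially. \<not> energy_bound m < l)"
  proof
    assume "\<forall>\<^sub>F m in sequentially. \<not> energy_bound m < l"
    then have "\<forall>\<^sub>F m in sequentially. ereal l \<le> ereal (energy_bound m)"
      by eventually_elim simp
    then have "ereal l \<le> liminf (\<lambda>m. ereal (energy_bound m))" by (rule Liminf_bounded)
    with l show False by simp
  qed
  then show ?thesis unfolding frequently_def by blast
qed

lemma noise_bounded: "\<exists>C\<ge>0. \<forall>\<^sub>F n in sequentially. \<forall>t\<in>{0..T}. norm (z n t) \<le> C"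
proof -
  have "bounded (zl ` {0..T})" by (intro compact_imp_bounded compact_continuous_image continuous_coords) auto
  then obtain C where C: "\<And>t. t \<in> {0..T} \<Longrightarrow> norm (zl t) \<le> C" unfolding bounded_iff by blast
  have "\<forall>\<^sub>F n in sequentially. \<forall>t\<in>{0..T}. dist (z n t) (zl t) < 1"
    using uniform_limitD[OF noise_converges] by simp
  then have "\<forall>\<^sub>F n in sequentially. \<forall>t\<in>{0..T}. norm (z n t) \<le> C + 1"
  proof eventually_elim
    case (elim n)
    show ?case
    proof
      fix t assume t: "t \<in> {0..T}"
      have "norm (z n t) \<le> norm (zl t) + dist (z n t) (zl t)" by norm
      then show "norm (z n t) \<le> C + 1" using C[OF t] elim t by fastforce
    qed
  qed
  moreover have "0 \<le> C" using order_trans[OF norm_ge_zero C[of 0]] params by simp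
  ultimately show ?thesis by (intro exI[of _ "C + 1"]) auto
qed

lemma energy_bound_coordinates:
  assumes n: "1 \<le> n"
  shows "energy_bound n = (LBINT r:{0..T}. exp (LBINT u:{r..T}. 2 * \<phi> (j (fin (Bn n) (H_coord (q n (round_down (h n) u)))))) *
        (1 + \<bar>\<Phi> (j (fin (Bn n) (H_coord (q n (round_down (h n) r)))))\<bar> + (LBINT u:{0..T}. nrm \<sigma> (Op n u) powr (4 + 4 * vartheta))
          + (\<Sum>b\<in>Bn n. (H_coord (q n r) b)\<^sup>2)))"
proof -
  have Q: "j (fin (Bn n) (H_coord (q n t))) = Qp n t" if "t \<in> {0..T}" for t
    using fin_H_coord(1)[OF n approximation_fin(2)[OF n that]] V_coords(4)[OF that n] by simp
  have rd: "round_down (h n) t \<in> {0..T}" if "t \<in> {0..T}" for t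
    using round_down_grid(2,3)[of "h n" t] h(1)[OF n] that by auto
  have norm_Q: "(norm (inv j (Qp n t)))\<^sup>2 = (\<Sum>b\<in>Bn n. (H_coord (q n t) b)\<^sup>2)" if "t \<in> {0..T}" for t
    unfolding Q[OF that, symmetric] inv_j by (simp add: norm_fin[OF Bn[OF n]] L2_set_def sum_nonneg)
  show ?thesis unfolding energy_bound_def
  proof (rule set_lebesgue_integral_cong, goal_cases)
    case 2
    show ?case
    proof (intro allI impI arg_cong2[where f="(*)"] arg_cong[where f=exp])
      fix r assume r: "r \<in> {0..T}"
      show "(LBINT u:{r..T}. 2 * \<phi> (Qp n (round_down (h n) u))) = (LBINT u:{r..T}. 2 * \<phi> (j (fin (Bn n) (H_coord (q n (round_down (h n) u))))))"
        using r by (intro set_lebesgue_integral_cong) (auto simp: Q[OF rd])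
      show "1 + \<bar>\<Phi> (Qp n (round_down (h n) r))\<bar> + (LBINT u:{0..T}. nrm \<sigma> (Op n u) powr (4 + 4 * vartheta)) + (norm (inv j (Qp n r)))\<^sup>2 =
        1 + \<bar>\<Phi> (j (fin (Bn n) (H_coord (q n (round_down (h n) r)))))\<bar> + (LBINT u:{0..T}. nrm \<sigma> (Op n u) powr (4 + 4 * vartheta))
          + (\<Sum>b\<in>Bn n. (H_coord (q n r) b)\<^sup>2)"
        by (simp add: Q[OF rd[OF r]] norm_Q[OF r])
    qed
  qed simp
qed

lemma mu_nonzero: "1 \<le> n \<Longrightarrow> b \<in> Bn n \<Longrightarrow> mu b \<noteq> 0"
  using mu_pos[of b] Bn(2)[of n] by auto

text \<open>Once the energy is bounded in \<open>H\<close>, the growth condition bounds the nonlinearity in \<open>H\<^sub>-\<^sub>\<gamma>\<close>, and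
  the smoothing of the semigroup turns this into a bound in \<open>H\<^sub>\<sigma>\<close>, because \<open>\<sigma> + \<gamma> < 1\<close>.\<close>

lemma smoothing_bootstrap:
  assumes n: "1 \<le> n" and \<sigma>: "0 < \<sigma>" and R: "\<And>t. t \<in> {0..T} \<Longrightarrow> wnorm mu (Bn n) 0 (H_coord (x n t)) \<le> R" and t: "t \<in> {0..T}"
  shows "norm (x n t - z n t) \<le> exp (\<kappa> * T) * (c * (2 * \<epsilon> + R\<^sup>2)) * kernel_mass T (\<sigma> + \<gamma>) 0"
proof -
  define G where "G = c * (2 * \<epsilon> + R\<^sup>2)"
  have G0: "0 \<le> G" unfolding G_def using params by (intro mult_nonneg_nonneg add_nonneg_nonneg) auto
  have tT: "t \<le> T" using t by simp
  have "norm (x n t - z n t) \<le> (exp (\<kappa> * T) * G) * (exp (0 * t) * kernel_mass T (\<sigma> + \<gamma>) 0) + 0 * (exp (0 * t) * kernel_mass T 0 0)"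
  proof (rule norm_integral_kernel_le[OF scheme[OF n t, unfolded truncated_scheme_def] tT])
    fix s assume s: "0 < s" "s < t"
    define p where "p = x n (round_down (h n) s)"
    define a where "a = (of_bool (norm p + norm (z n (round_down (h n) s)) \<le> h n powr - chi) :: real)"
    have a: "\<bar>a\<bar> \<le> 1" by (simp add: a_def)
    note r = round_down_range[OF n s t]
    have pf: "\<forall>b\<in>B - Bn n. b \<bullet> p = 0" unfolding p_def by (rule approximation_fin(1)[OF n r])
    define v where "v = P n (K (t - s) (a *\<^sub>R f p))"
    have "norm v = L2_set (\<lambda>b. b \<bullet> v) (Bn n)"
    proof -
      have "v = fin (Bn n) (\<lambda>b. b \<bullet> v)"
        using Bn[OF n] by (intro basis_eqI) (auto simp: inner_fin v_def inner_P[OF n])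
      then show ?thesis using norm_fin[OF Bn[OF n], of "\<lambda>b. b \<bullet> v"] by simp
    qed
    also have "\<dots> \<le> (exp (\<kappa> * T) * (t - s) powr - (\<sigma> + \<gamma>)) * L2_set (\<lambda>b. mu b powr - \<gamma> * F_coord n (H_coord p) b) (Bn n) + 0 * L2_set (\<lambda>b. 0) (Bn n)"
    proof (rule L2_set_le_linear_combination)
      fix b assume b: "b \<in> Bn n"
      have bB: "b \<in> B" using b Bn(2)[OF n] by auto
      have "\<bar>b \<bullet> v\<bar> = \<bar>a\<bar> * (mu b powr \<sigma> * exp ((\<kappa> - mu b) * (t - s)) * \<bar>F_coord n (H_coord p) b\<bar>)"
        unfolding v_def using s by (subst inner_scheme[OF n pf b]) (auto simp: abs_mult)
      also have "\<dots> \<le> 1 * (mu b powr \<sigma> * exp ((\<kappa> - mu b) * (t - s)) * \<bar>F_coord n (H_coord p) b\<bar>)"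
        using a by (intro mult_right_mono) auto
      also have "mu b powr \<sigma> = mu b powr (\<sigma> + \<gamma>) * mu b powr - \<gamma>" by (simp add: powr_add[symmetric])
      also have "1 * (mu b powr (\<sigma> + \<gamma>) * mu b powr - \<gamma> * exp ((\<kappa> - mu b) * (t - s)) * \<bar>F_coord n (H_coord p) b\<bar>) =
          (mu b powr (\<sigma> + \<gamma>) * exp ((\<kappa> - mu b) * (t - s))) * \<bar>mu b powr - \<gamma> * F_coord n (H_coord p) b\<bar>"
        by (simp add: abs_mult)
      also have "\<dots> \<le> (exp (\<kappa> * T) * (t - s) powr - (\<sigma> + \<gamma>)) * \<bar>mu b powr - \<gamma> * F_coord n (H_coord p) b\<bar>"
        using s tT bB \<sigma> exponents params by (intro mult_right_mono smoothing_multiplier_le_T) auto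
      finally show "\<bar>b \<bullet> v\<bar> \<le> (exp (\<kappa> * T) * (t - s) powr - (\<sigma> + \<gamma>)) * \<bar>mu b powr - \<gamma> * F_coord n (H_coord p) b\<bar> + 0 * \<bar>0\<bar>"
        by simp
    qed auto
    also have "L2_set (\<lambda>b. mu b powr - \<gamma> * F_coord n (H_coord p) b) (Bn n) \<le> G"
    proof -
      have "L2_set (\<lambda>b. mu b powr - \<gamma> * F_coord n (H_coord p) b) (Bn n) \<le> nrm (- \<gamma>) (j (inv j (F (j (fin (Bn n) (H_coord p))))))"
        using wnorm_le_nrm_j[OF _ Bn[OF n], of "- \<gamma>" "inv j (F (j (fin (Bn n) (H_coord p))))"] params
        unfolding wnorm_def F_coord_def by simp
      also have "\<dots> = nrm (- \<gamma>) (F (j (fin (Bn n) (H_coord p))))" by (simp only: F_coord_j[OF n, symmetric])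
      also have "\<dots> \<le> c * (2 * \<epsilon> + (norm (fin (Bn n) (H_coord p)))\<^sup>2)" by (intro F_growth[OF n] fin_in_range_P[OF n])
      also have "norm (fin (Bn n) (H_coord p)) = wnorm mu (Bn n) 0 (H_coord p)"
        unfolding norm_fin[OF Bn[OF n]] wnorm_def using mu_nonzero[OF n] by (intro L2_set_cong) auto
      also have "c * (2 * \<epsilon> + (wnorm mu (Bn n) 0 (H_coord p))\<^sup>2) \<le> G"
        unfolding G_def p_def using R[OF r] params by (intro mult_left_mono add_left_mono power_mono wnorm_nonneg) auto
      finally show ?thesis .
    qed
    finally have "norm v \<le> (exp (\<kappa> * T) * (t - s) powr - (\<sigma> + \<gamma>)) * G"
      by (simp add: mult_left_mono)
    then show "norm (P n (K (t - s) (of_bool (norm (x n (round_down (h n) s)) + norm (z n (round_down (h n) s)) \<le> h n powr - chi) *\<^sub>R f (x n (round_down (h n) s)))))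
        \<le> (exp (\<kappa> * T) * G) * ((t - s) powr - (\<sigma> + \<gamma>) * exp (0 * s)) + 0 * ((t - s) powr - 0 * exp (0 * s))"
      unfolding v_def a_def p_def by (simp add: ac_simps)
  qed (use exponents G0 in auto)
  then show ?thesis by (simp add: G_def)
qed

lemma frequently_bounded: "\<exists>R. \<exists>\<^sub>F n in sequentially. 1 \<le> n \<and> (\<forall>t\<in>{0..T}. norm (x n t) \<le> R)"
proof -
  obtain l where l: "\<exists>\<^sub>F n in sequentially. energy_bound n < l" using frequently_energy_bound by blast
  obtain M where M: "0 \<le> M" "\<forall>\<^sub>F n in sequentially. \<forall>t\<in>{0..T}. norm (z n t) \<le> M" using noise_bounded by blast
  interpret E: energy_setting B mu \<delta> \<delta> \<kappa> \<eta> T \<alpha> \<rho> \<sigma> vartheta chi \<theta> \<phi>' M "norm (f 0)"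
    by (rule energy_setting_instance[OF M(1)])
  obtain C where C: "0 \<le> C" "\<forall>J h x z q F \<phi> \<Phi>. E.galerkin_data J h x z q F \<phi> \<Phi> \<longrightarrow> (\<forall>t\<in>{0..T}. \<forall>a\<ge>0.
    (\<Sum>b\<in>J. (x t b - q t b)\<^sup>2) \<le> C *
      (LBINT r:{0..T}. exp (LBINT u:{r..T}. 2 * \<phi> (q (round_down h u))) *
        (1 + \<bar>\<Phi> (q (round_down h r))\<bar> + a + (\<Sum>b\<in>J. (q r b)\<^sup>2))))"
    using E.uniform_energy_bound by (elim exE conjE) (rule that)
  (* \<open>N\<close> bounds \<open>x - q\<close> in \<open>H\<close> and \<open>S\<close> bounds \<open>q\<close> in \<open>H\<^sub>\<sigma>\<close>. One of the spaces \<open>H\<close> and \<open>H\<^sub>\<sigma>\<close> is embedded in the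
     other: for \<open>\<sigma> \<le> 0\<close> this gives the bound \<open>R\<^sub>1\<close> of \<open>x\<close> in \<open>H\<^sub>\<sigma>\<close>, for \<open>\<sigma> > 0\<close> the bound \<open>R\<^sub>2\<close> of \<open>x\<close> in \<open>H\<close>,
     from which \<open>smoothing_bootstrap\<close> produces \<open>R\<^sub>3\<close>. *)
  define N where "N = sqrt (C * \<bar>l\<bar>)"
  have N0: "0 \<le> N" using C(1) by (simp add: N_def)
  define S where "S = M + E.shift_const * T"
  define R\<^sub>1 where "R\<^sub>1 = \<delta> powr \<sigma> * N + S"
  define R\<^sub>2 where "R\<^sub>2 = N + \<delta> powr - \<sigma> * S"
  define R\<^sub>3 where "R\<^sub>3 = exp (\<kappa> * T) * (c * (2 * \<epsilon> + R\<^sub>2\<^sup>2)) * kernel_mass T (\<sigma> + \<gamma>) 0 + M"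
  have bounds: "\<forall>t\<in>{0..T}. norm (x n t) \<le> max R\<^sub>1 R\<^sub>3"
    if n: "1 \<le> n" and zM: "\<forall>t\<in>{0..T}. norm (z n t) \<le> M" and el: "energy_bound n < l" for n
  proof
    fix t\<^sub>0 assume t0: "t\<^sub>0 \<in> {0..T}"
    have data: "E.galerkin_data (Bn n) (h n) (\<lambda>t. H_coord (x n t)) (\<lambda>t. H_coord (z n t)) (\<lambda>t. H_coord (q n t)) (F_coord n)
        (\<lambda>v. \<phi> (j (fin (Bn n) v))) (\<lambda>v. \<Phi> (j (fin (Bn n) v)))"
      using zM by (intro galerkin_data_instance n M) auto
    have a0: "0 \<le> (LBINT u:{0..T}. nrm \<sigma> (Op n u) powr (4 + 4 * vartheta))"
      unfolding set_lebesgue_integral_def by (intro integral_nonneg_AE AE_I2) (auto simp: indicator_def)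
    have xq: "wnorm mu (Bn n) 0 (\<lambda>b. H_coord (x n t) b - H_coord (q n t) b) \<le> N" if t: "t \<in> {0..T}" for t
    proof -
      have "wnorm mu (Bn n) 0 (\<lambda>b. H_coord (x n t) b - H_coord (q n t) b) = sqrt (\<Sum>b\<in>Bn n. (H_coord (x n t) b - H_coord (q n t) b)\<^sup>2)"
        unfolding wnorm_def L2_set_def using mu_nonzero[OF n]
        by (intro arg_cong[where f=sqrt] sum.cong) auto
      also have "\<dots> \<le> sqrt (C * energy_bound n)"
        unfolding energy_bound_coordinates[OF n] using C(2)[rule_format, OF data t a0] by (rule real_sqrt_le_mono)
      also have "\<dots> \<le> N" unfolding N_def using el C(1) by (intro real_sqrt_le_mono mult_left_mono) auto
      finally show ?thesis .
    qed
    have q_le: "wnorm mu (Bn n) \<sigma> (H_coord (q n t)) \<le> S" if t: "t \<in> {0..T}" for t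
    proof -
      have "wnorm mu (Bn n) \<sigma> (H_coord (q n t)) \<le> wnorm mu (Bn n) \<sigma> (H_coord (z n t)) + wnorm mu (Bn n) \<sigma> (\<lambda>b. H_coord (z n t) b - H_coord (q n t) b)"
        using wnorm_diff[of mu "Bn n" \<sigma> "H_coord (z n t)" "\<lambda>b. H_coord (z n t) b - H_coord (q n t) b"] by simp
      also have "\<dots> \<le> M + E.shift_const * T"
        using E.shift_le[OF data t] fin_H_coord(2)[OF n noise_fin[OF n t]] zM t by (intro add_mono) auto
      finally show ?thesis by (simp add: S_def)
    qed
    show "norm (x n t\<^sub>0) \<le> max R\<^sub>1 R\<^sub>3"
    proof (cases "0 < \<sigma>")
      case False
      have "norm (x n t\<^sub>0) = wnorm mu (Bn n) \<sigma> (H_coord (x n t\<^sub>0))" by (rule fin_H_coord(2)[OF n approximation_fin(1)[OF n t0], symmetric])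
      also have "\<dots> \<le> wnorm mu (Bn n) \<sigma> (\<lambda>b. H_coord (x n t\<^sub>0) b - H_coord (q n t\<^sub>0) b) + wnorm mu (Bn n) \<sigma> (H_coord (q n t\<^sub>0))"
        using wnorm_add[of mu "Bn n" \<sigma> "\<lambda>b. H_coord (x n t\<^sub>0) b - H_coord (q n t\<^sub>0) b" "H_coord (q n t\<^sub>0)"] by simp
      also have "\<dots> \<le> \<delta> powr (\<sigma> - 0) * wnorm mu (Bn n) 0 (\<lambda>b. H_coord (x n t\<^sub>0) b - H_coord (q n t\<^sub>0) b) + S"
        using False Bn(2)[OF n] mu_ge \<delta>_pos by (intro add_mono wnorm_embedding q_le t0) auto
      also have "\<dots> \<le> R\<^sub>1" unfolding R\<^sub>1_def using xq[OF t0] by (auto intro: mult_left_mono)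
      finally show ?thesis by simp
    next
      case True
      have "wnorm mu (Bn n) 0 (H_coord (x n t)) \<le> R\<^sub>2" if t: "t \<in> {0..T}" for t
      proof -
        have "wnorm mu (Bn n) 0 (H_coord (x n t)) \<le> wnorm mu (Bn n) 0 (\<lambda>b. H_coord (x n t) b - H_coord (q n t) b) + wnorm mu (Bn n) 0 (H_coord (q n t))"
          using wnorm_add[of mu "Bn n" 0 "\<lambda>b. H_coord (x n t) b - H_coord (q n t) b" "H_coord (q n t)"] by simp
        also have "\<dots> \<le> N + \<delta> powr (0 - \<sigma>) * wnorm mu (Bn n) \<sigma> (H_coord (q n t))"
          using True Bn(2)[OF n] mu_ge \<delta>_pos by (intro add_mono wnorm_embedding xq t) auto
        also have "\<dots> \<le> R\<^sub>2" unfolding R\<^sub>2_def using q_le[OF t] by (auto intro: mult_left_mono)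
        finally show ?thesis .
      qed
      from smoothing_bootstrap[OF n True this t0]
      have "norm (x n t\<^sub>0 - z n t\<^sub>0) \<le> exp (\<kappa> * T) * (c * (2 * \<epsilon> + R\<^sub>2\<^sup>2)) * kernel_mass T (\<sigma> + \<gamma>) 0" .
      moreover have "norm (x n t\<^sub>0) \<le> norm (x n t\<^sub>0 - z n t\<^sub>0) + norm (z n t\<^sub>0)" by norm
      moreover have "norm (z n t\<^sub>0) \<le> M" using zM t0 by blast
      ultimately have "norm (x n t\<^sub>0) \<le> R\<^sub>3" unfolding R\<^sub>3_def by linarith
      then show ?thesis by simp
    qed
  qed
  have "\<forall>\<^sub>F n in sequentially. 1 \<le> n \<and> (\<forall>t\<in>{0..T}. norm (z n t) \<le> M)"
    using M(2) eventually_ge_at_top[of 1] by eventually_elim auto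
  from frequently_eventually_frequently[OF l this]
  have "\<exists>\<^sub>F n in sequentially. 1 \<le> n \<and> (\<forall>t\<in>{0..T}. norm (x n t) \<le> max R\<^sub>1 R\<^sub>3)"
    by (rule frequently_elim1) (use bounds in blast)
  then show ?thesis by blast
qed

text \<open>The shift of the index reflects that the data are constrained for \<open>n \<ge> 1\<close> only.\<close>

theorem path_convergence:
  "\<exists>y. continuous_on {0..T} y \<and> (\<forall>t\<in>{0..T}. mild_eq K f zl y t) \<and> uniform_limit {0..T} (\<lambda>n. x (Suc n)) y sequentially"
proof -
  obtain d a' where Kn: "d \<longlonglongrightarrow> 0" "\<And>n. kernel_approx K (Kn n) (exp (\<kappa> * T)) (\<sigma> + \<alpha>) (d n) a' T"
    using kernel_approx_Kn by blast
  obtain R where R: "\<exists>\<^sub>F n in sequentially. 1 \<le> n \<and> (\<forall>t\<in>{0..T}. norm (x n t) \<le> R)"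
    using frequently_bounded by blast
  have R': "\<exists>\<^sub>F n in sequentially. \<forall>t\<in>{0..T}. norm (x (Suc n) t) \<le> R"
  proof -
    have "\<not> (\<forall>\<^sub>F n in sequentially. \<not> (\<forall>t\<in>{0..T}. norm (x (Suc n) t) \<le> R))"
    proof
      assume "\<forall>\<^sub>F n in sequentially. \<not> (\<forall>t\<in>{0..T}. norm (x (Suc n) t) \<le> R)"
      then have "\<forall>\<^sub>F n in sequentially. \<not> (\<forall>t\<in>{0..T}. norm (x n t) \<le> R)"
        by (subst (asm) eventually_sequentially_Suc)
      then have "\<forall>\<^sub>F n in sequentially. \<not> (1 \<le> n \<and> (\<forall>t\<in>{0..T}. norm (x n t) \<le> R))"
        by eventually_elim blast
      with R show False unfolding frequently_def by blast
    qed
    then show ?thesis unfolding frequently_def .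
  qed
  have zc: "uniform_limit {0..T} (\<lambda>n. z (Suc n)) zl sequentially"
    using noise_converges unfolding uniform_limit_iff by (subst eventually_sequentially_Suc)
  have sch: "truncated_scheme (Kn n) f (h (Suc n)) chi (z (Suc n)) (x (Suc n)) t" if "t \<in> {0..T}" for n t
    using scheme[of "Suc n" t] that unfolding Kn_def truncated_scheme_def by simp
  have hS: "0 < h (Suc n)" for n using h(1)[of "Suc n"] by simp
  show ?thesis
    by (rule scheme_converges_if_frequently_bounded[OF singular_kernel_K params(1) Kn(2,1) params(14)
          f_locally_lipschitz hS LIMSEQ_Suc[OF h(2)] sch continuous_coords(1) zc R'])
qed

end

section \<open>Existence, uniqueness and convergence of the processes\<close>

lemma has_time_integral_cong:
  assumes "\<And>s. 0 < s \<Longrightarrow> s < t \<Longrightarrow> g s = g' s"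
  shows "has_time_integral S N t g y \<longleftrightarrow> has_time_integral S N t g' y"
proof -
  have sp: "g s = g' s" if "s \<in> space (time_measure t)" for s
    using that assms by (auto simp: space_restrict_space)
  have 1: "g \<in> measurable (time_measure t) (nborel S N) \<longleftrightarrow> g' \<in> measurable (time_measure t) (nborel S N)"
    by (rule measurable_cong) (rule sp)
  have 2: "(\<integral>\<^sup>+s. ennreal (N (g s - u s)) \<partial>time_measure t) = (\<integral>\<^sup>+s. ennreal (N (g' s - u s)) \<partial>time_measure t)" for u
    by (rule nn_integral_cong) (simp add: sp)
  show ?thesis unfolding has_time_integral_def has_bochner_integral_in_def 1 2 ..
qed

lemma limsup_SUP_eq_0:
  fixes f :: "nat \<Rightarrow> 'a \<Rightarrow> real"
  assumes "S \<noteq> {}" "\<And>n t. 1 \<le> n \<Longrightarrow> t \<in> S \<Longrightarrow> 0 \<le> f n t"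
    and "\<And>e. 0 < e \<Longrightarrow> \<forall>\<^sub>F n in sequentially. \<forall>t\<in>S. f n t \<le> e"
  shows "limsup (\<lambda>n. SUP t\<in>S. ereal (f n t)) = 0"
proof (rule antisym)
  show "limsup (\<lambda>n. SUP t\<in>S. ereal (f n t)) \<le> 0"
  proof (rule ereal_le_epsilon2)
    fix e :: real assume "0 < e"
    have "\<forall>\<^sub>F n in sequentially. (SUP t\<in>S. ereal (f n t)) \<le> ereal e"
      using assms(3)[OF \<open>0 < e\<close>] by eventually_elim (auto intro!: SUP_least)
    then have "limsup (\<lambda>n. SUP t\<in>S. ereal (f n t)) \<le> ereal e" by (rule Limsup_bounded)
    then show "limsup (\<lambda>n. SUP t\<in>S. ereal (f n t)) \<le> 0 + ereal e" by simp
  qed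
  obtain t where t: "t \<in> S" using assms(1) by auto
  have "\<forall>\<^sub>F n in sequentially. 0 \<le> (SUP t\<in>S. ereal (f n t))"
    using eventually_ge_at_top[of 1]
  proof eventually_elim
    case (elim n)
    have "0 \<le> ereal (f n t)" using assms(2)[OF elim t] by simp
    also have "\<dots> \<le> (SUP t\<in>S. ereal (f n t))" using t by (rule SUP_upper)
    finally show ?case .
  qed
  then show "0 \<le> limsup (\<lambda>n. SUP t\<in>S. ereal (f n t))" by (intro le_Limsup) auto
qed

locale galerkin_processes = galerkin +
  fixes M :: "'w measure"
    and XX Om Xbb Obb :: "nat \<Rightarrow> real \<Rightarrow> 'w \<Rightarrow> 'b"
    and Olim :: "real \<Rightarrow> 'w \<Rightarrow> 'b" and \<Omega>0 :: "'w set"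
  assumes M: "prob_space M"
    and XX: "\<And>n. 1 \<le> n \<Longrightarrow> process_on M T (Hs \<sigma>) (nrm \<sigma>) (XX n)"
    and Om: "\<And>n. 1 \<le> n \<Longrightarrow> cont_process_on M T (Hs \<sigma>) (nrm \<sigma>) (Om n)"
    and Olim: "cont_process_on M T (Hs \<sigma>) (nrm \<sigma>) Olim"
    and Xbb_Obb: "\<And>n t \<omega>. 1 \<le> n \<Longrightarrow> t \<in> {0..T} \<Longrightarrow> \<omega> \<in> space M \<Longrightarrow> Xbb n t \<omega> \<in> Hs \<sigma> \<and> Obb n t \<omega> \<in> Hs \<sigma>"
    and Xbb_eq: "\<And>n t \<omega>. 1 \<le> n \<Longrightarrow> t \<in> {0..T} \<Longrightarrow> \<omega> \<in> space M \<Longrightarrow>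
          has_time_integral (Hs \<sigma>) (nrm \<sigma>) t
            (\<lambda>s. j (P n (inv j (ext_semigroup B A j (Hs (- \<alpha>)) (nrm (- \<alpha>)) (t - s)
               (of_bool (nrm \<sigma> (XX n (round_down (h n) s) \<omega>)
                         + nrm \<sigma> (Om n (round_down (h n) s) \<omega>) \<le> \<bar>h n\<bar> powr (- chi))
                 *\<^sub>R F (XX n (round_down (h n) s) \<omega>))))))
            (Xbb n t \<omega> - Om n t \<omega>)"
    and Om_range: "\<And>n t \<omega>. 1 \<le> n \<Longrightarrow> t \<in> {0..T} \<Longrightarrow> \<omega> \<in> space M \<Longrightarrow> Om n t \<omega> \<in> j ` range (P n)"
    and Obb_eq: "\<And>n t \<omega>. 1 \<le> n \<Longrightarrow> t \<in> {0..T} \<Longrightarrow> \<omega> \<in> space M \<Longrightarrow>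
          has_time_integral (Hs \<sigma>) (nrm \<sigma>) t
            (\<lambda>s. j (exp (- \<eta> * (t - s)) *\<^sub>R semigroup_op B A (t - s) (\<eta> *\<^sub>R inv j (Om n s \<omega>))))
            (Om n t \<omega> - Obb n t \<omega>)"
    and Xbb_XX: "\<And>n t. 1 \<le> n \<Longrightarrow> t \<in> {0..T} \<Longrightarrow> \<P>(\<omega> in M. Xbb n t \<omega> = XX n t \<omega>) = 1"
    and \<Omega>0: "\<Omega>0 \<in> sets M" "measure M \<Omega>0 = 1"
    and bound: "\<And>\<omega>. \<omega> \<in> \<Omega>0 \<Longrightarrow>
          liminf (\<lambda>m. ereal (LBINT r:{0..T}.
            exp (LBINT u:{r..T}. 2 * \<phi> (Obb m (round_down (h m) u) \<omega>)) *
            (1 + \<bar>\<Phi> (Obb m (round_down (h m) r) \<omega>)\<bar>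
               + (LBINT u:{0..T}. nrm \<sigma> (Om m u \<omega>) powr (4 + 4 * vartheta))
               + (norm (inv j (Obb m r \<omega>)))\<^sup>2))) < \<infinity>"
    and O_conv: "\<And>\<omega>. \<omega> \<in> \<Omega>0 \<Longrightarrow>
          limsup (\<lambda>m. SUP t\<in>{0..T}. ereal (nrm \<sigma> (Olim t \<omega> - Om m t \<omega>))) = 0"
begin

text \<open>The approximation \<open>Xbb n\<close> is driven by the process \<open>XX n\<close>, evaluated at grid points. Only where the two
  agree at all of the countably many grid points in \<open>{0..T}\<close> is \<open>Xbb n\<close> driven by itself.\<close>

definition agree :: "nat \<Rightarrow> nat \<Rightarrow> 'w set" where
  "agree n k = (if 1 \<le> n \<and> real k * h n \<le> T
     then {\<omega> \<in> space M. Xbb n (real k * h n) \<omega> = XX n (real k * h n) \<omega>} else space M)"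

definition good :: "'w set" where
  "good = \<Omega>0 \<inter> (\<Inter>n. \<Inter>k. agree n k)"

lemma agree_prob: "agree n k \<in> sets M" "measure M (agree n k) = 1"
proof -
  have 1: "measure M (agree n k) = 1"
  proof (cases "1 \<le> n \<and> real k * h n \<le> T")
    case True
    then have "real k * h n \<in> {0..T}" using h(1)[of n] by auto
    from Xbb_XX[OF _ this] True show ?thesis by (simp add: agree_def)
  next
    case False
    then have "agree n k = space M" unfolding agree_def by (rule if_not_P)
    then show ?thesis by (simp add: prob_space.prob_space[OF M])
  qed
  then show "measure M (agree n k) = 1" .
  show "agree n k \<in> sets M"
    using 1 measure_notin_sets[of "agree n k" M] by fastforce
qed

lemma good_sets: "good \<in> sets M" and AE_good: "AE \<omega> in M. \<omega> \<in> good"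
proof -
  interpret prob_space M by (rule M)
  show "good \<in> sets M"
    unfolding good_def using \<Omega>0(1) agree_prob(1) by (intro sets.Int sets.countable_INT) auto
  have "AE \<omega> in M. \<omega> \<in> \<Omega>0" using \<Omega>0 AE_in_set_eq_1 by blast
  moreover have "AE \<omega> in M. \<omega> \<in> agree n k" for n k using agree_prob AE_in_set_eq_1 by blast
  then have "AE \<omega> in M. \<forall>n k. \<omega> \<in> agree n k" by (simp add: AE_all_countable)
  ultimately show "AE \<omega> in M. \<omega> \<in> good" by eventually_elim (simp add: good_def)
qed

lemma good_space: "\<omega> \<in> good \<Longrightarrow> \<omega> \<in> space M"
  using sets.sets_into_space[OF good_sets] by auto

lemma good_agree:
  assumes \<omega>: "\<omega> \<in> good" and n: "1 \<le> n" and t: "t \<in> {0..T}"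
  shows "XX n (round_down (h n) t) \<omega> = Xbb n (round_down (h n) t) \<omega>" "round_down (h n) t \<in> {0..T}"
proof -
  have t0: "0 \<le> t" using t by simp
  note r = round_down_grid[OF conjunct1[OF h(1)[OF n]] t0]
  show "round_down (h n) t \<in> {0..T}" using r(2,3) t by auto
  define k where "k = nat \<lfloor>t / h n\<rfloor>"
  have k: "round_down (h n) t = real k * h n" unfolding k_def by (rule r(1))
  have "\<omega> \<in> agree n k" using \<omega> unfolding good_def by blast
  moreover have "real k * h n \<le> T" using r(3) t unfolding k by auto
  ultimately show "XX n (round_down (h n) t) \<omega> = Xbb n (round_down (h n) t) \<omega>"
    unfolding k agree_def using n by simp
qed

lemma good_path:
  assumes \<omega>: "\<omega> \<in> good"
  shows "galerkin_path B mu \<kappa> \<delta> A j Hs nrm \<eta> T vartheta c \<theta> \<epsilon> \<alpha> \<phi>' \<gamma> \<rho> \<sigma> chi F P Bn \<phi> \<Phi> h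
    (\<lambda>n t. Xbb n t \<omega>) (\<lambda>n t. Om n t \<omega>) (\<lambda>n t. Obb n t \<omega>) (\<lambda>t. Olim t \<omega>)"
proof
  note sp = good_space[OF \<omega>]
  have \<Omega>: "\<omega> \<in> \<Omega>0" using \<omega> by (simp add: good_def)
  fix n :: nat and t assume n: "1 \<le> n" and t: "t \<in> {0..T}"
  show "Xbb n t \<omega> \<in> Hs \<sigma> \<and> Obb n t \<omega> \<in> Hs \<sigma>" by (rule Xbb_Obb[OF n t sp])
  show "Om n t \<omega> \<in> j ` range (P n)" by (rule Om_range[OF n t sp])
  show "has_time_integral (Hs \<sigma>) (nrm \<sigma>) t
            (\<lambda>s. j (exp (- \<eta> * (t - s)) *\<^sub>R semigroup_op B A (t - s) (\<eta> *\<^sub>R inv j (Om n s \<omega>))))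
            (Om n t \<omega> - Obb n t \<omega>)" by (rule Obb_eq[OF n t sp])
  show "has_time_integral (Hs \<sigma>) (nrm \<sigma>) t
            (\<lambda>s. j (P n (inv j (ext_semigroup B A j (Hs (- \<alpha>)) (nrm (- \<alpha>)) (t - s)
               (of_bool (nrm \<sigma> (Xbb n (round_down (h n) s) \<omega>) + nrm \<sigma> (Om n (round_down (h n) s) \<omega>) \<le> \<bar>h n\<bar> powr (- chi))
                 *\<^sub>R F (Xbb n (round_down (h n) s) \<omega>))))))
            (Xbb n t \<omega> - Om n t \<omega>)"
    by (rule has_time_integral_cong[THEN iffD1, OF _ Xbb_eq[OF n t sp]])
      (use t good_agree(1)[OF \<omega> n] in auto)
next
  note sp = good_space[OF \<omega>]
  show "continuous_map (top_of_set {0..T}) (ntop (Hs \<sigma>) (nrm \<sigma>)) (\<lambda>t. Om n t \<omega>)" if "1 \<le> n" for n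
    using Om[OF that] sp unfolding cont_process_on_def by blast
  show "continuous_map (top_of_set {0..T}) (ntop (Hs \<sigma>) (nrm \<sigma>)) (\<lambda>t. Olim t \<omega>)"
    using Olim sp unfolding cont_process_on_def by blast
next
  have \<Omega>: "\<omega> \<in> \<Omega>0" using \<omega> by (simp add: good_def)
  show "liminf (\<lambda>m. ereal (LBINT r:{0..T}.
            exp (LBINT u:{r..T}. 2 * \<phi> (Obb m (round_down (h m) u) \<omega>)) *
            (1 + \<bar>\<Phi> (Obb m (round_down (h m) r) \<omega>)\<bar>
               + (LBINT u:{0..T}. nrm \<sigma> (Om m u \<omega>) powr (4 + 4 * vartheta))
               + (norm (inv j (Obb m r \<omega>)))\<^sup>2))) < \<infinity>" by (rule bound[OF \<Omega>])
  show "limsup (\<lambda>m. SUP t\<in>{0..T}. ereal (nrm \<sigma> (Olim t \<omega> - Om m t \<omega>))) = 0" by (rule O_conv[OF \<Omega>])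
qed

definition limit_path :: "'w \<Rightarrow> real \<Rightarrow> 'a" where
  "limit_path \<omega> = (SOME y. continuous_on {0..T} y \<and> (\<forall>t\<in>{0..T}. mild_eq K f (\<lambda>t. inv (V \<sigma>) (Olim t \<omega>)) y t) \<and>
     uniform_limit {0..T} (\<lambda>n t. inv (V \<sigma>) (Xbb (Suc n) t \<omega>)) y sequentially)"

lemma limit_path:
  assumes "\<omega> \<in> good"
  shows "continuous_on {0..T} (limit_path \<omega>)"
    and "t \<in> {0..T} \<Longrightarrow> mild_eq K f (\<lambda>t. inv (V \<sigma>) (Olim t \<omega>)) (limit_path \<omega>) t"
    and "uniform_limit {0..T} (\<lambda>n t. inv (V \<sigma>) (Xbb (Suc n) t \<omega>)) (limit_path \<omega>) sequentially"
proof -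
  interpret gp: galerkin_path B mu \<kappa> \<delta> A j Hs nrm \<eta> T vartheta c \<theta> \<epsilon> \<alpha> \<phi>' \<gamma> \<rho> \<sigma> chi F P Bn \<phi> \<Phi> h
    "\<lambda>n t. Xbb n t \<omega>" "\<lambda>n t. Om n t \<omega>" "\<lambda>n t. Obb n t \<omega>" "\<lambda>t. Olim t \<omega>"
    by (rule good_path[OF assms])
  have "\<exists>y. continuous_on {0..T} y \<and> (\<forall>t\<in>{0..T}. mild_eq K f (\<lambda>t. inv (V \<sigma>) (Olim t \<omega>)) y t) \<and>
     uniform_limit {0..T} (\<lambda>n t. inv (V \<sigma>) (Xbb (Suc n) t \<omega>)) y sequentially"
    using gp.path_convergence unfolding gp.x_def gp.zl_def .
  from someI_ex[OF this] show "continuous_on {0..T} (limit_path \<omega>)"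
    "t \<in> {0..T} \<Longrightarrow> mild_eq K f (\<lambda>t. inv (V \<sigma>) (Olim t \<omega>)) (limit_path \<omega>) t"
    "uniform_limit {0..T} (\<lambda>n t. inv (V \<sigma>) (Xbb (Suc n) t \<omega>)) (limit_path \<omega>) sequentially"
    unfolding limit_path_def[symmetric] by blast+
qed

definition solution :: "real \<Rightarrow> 'w \<Rightarrow> 'b" where
  "solution t \<omega> = V \<sigma> (if \<omega> \<in> good then limit_path \<omega> t else 0)"

text \<open>Measurability is known for \<open>XX n\<close> at fixed times, but not for \<open>Xbb n\<close>, and the two agree at grid points
  only. This representation of the limit therefore makes the solution a process.\<close>

lemma solution_limit:
  assumes \<omega>: "\<omega> \<in> good" and t: "t \<in> {0..T}"
  shows "(\<lambda>n. inv (V \<sigma>) (XX (Suc n) (round_down (h (Suc n)) t) \<omega>)) \<longlonglongrightarrow> limit_path \<omega> t"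
proof -
  let ?r = "\<lambda>n. round_down (h (Suc n)) t"
  have r: "?r n \<in> {0..T}" for n by (rule good_agree(2)[OF \<omega> _ t]) simp
  have "?r \<longlonglongrightarrow> t"
  proof (rule tendsto_sandwich)
    have "?r n \<le> t" "t < ?r n + h (Suc n)" for n
      using round_down_grid(3,4)[of "h (Suc n)" t] h(1)[of "Suc n"] t by auto
    then show "\<forall>\<^sub>F n in sequentially. t - h (Suc n) \<le> ?r n" "\<forall>\<^sub>F n in sequentially. ?r n \<le> t"
      by (auto intro!: always_eventually simp: less_imp_le algebra_simps)
    show "(\<lambda>n. t - h (Suc n)) \<longlonglongrightarrow> t"
      using tendsto_diff[OF tendsto_const LIMSEQ_Suc[OF h(2)], of t] by simp
  qed simp
  then have 1: "(\<lambda>n. limit_path \<omega> (?r n)) \<longlonglongrightarrow> limit_path \<omega> t"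
    using r t by (intro continuous_on_tendsto_compose[OF limit_path(1)[OF \<omega>]]) auto
  have "(\<lambda>n. inv (V \<sigma>) (Xbb (Suc n) (?r n) \<omega>) - limit_path \<omega> (?r n)) \<longlonglongrightarrow> 0"
  proof (rule tendstoI)
    fix e :: real assume "0 < e"
    from uniform_limitD[OF limit_path(3)[OF \<omega>] this]
    show "\<forall>\<^sub>F n in sequentially. dist (inv (V \<sigma>) (Xbb (Suc n) (?r n) \<omega>) - limit_path \<omega> (?r n)) 0 < e"
    proof eventually_elim
      case (elim n)
      from bspec[OF elim r[of n]] show ?case by (simp add: dist_norm)
    qed
  qed
  from tendsto_add[OF this 1] have "(\<lambda>n. inv (V \<sigma>) (Xbb (Suc n) (?r n) \<omega>)) \<longlonglongrightarrow> limit_path \<omega> t" by simp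
  then show ?thesis using good_agree(1)[OF \<omega> _ t] by simp
qed

lemma solution_cont_process: "cont_process_on M T (Hs \<sigma>) (nrm \<sigma>) solution"
  unfolding cont_process_on_def process_on_def
proof (intro conjI ballI)
  fix t assume t: "t \<in> {0..T}"
  have "(\<lambda>\<omega>. if \<omega> \<in> good then limit_path \<omega> t else 0) \<in> borel_measurable M"
  proof (rule borel_measurable_LIMSEQ_metric)
    fix n
    have "round_down (h (Suc n)) t \<in> {0..T}"
      using round_down_grid(2,3)[of "h (Suc n)" t] h(1)[of "Suc n"] t by auto
    then have "(\<lambda>\<omega>. inv (V \<sigma>) (XX (Suc n) (round_down (h (Suc n)) t) \<omega>)) \<in> borel_measurable M"
      using XX[of "Suc n"] unfolding process_on_def by (intro V.measurable_nborelD) auto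
    then show "(\<lambda>\<omega>. if \<omega> \<in> good then inv (V \<sigma>) (XX (Suc n) (round_down (h (Suc n)) t) \<omega>) else 0) \<in> borel_measurable M"
      using good_sets by (intro measurable_If_set) (auto simp: good_sets sets.Int_space_eq2)
  next
    fix \<omega>
    show "(\<lambda>n. if \<omega> \<in> good then inv (V \<sigma>) (XX (Suc n) (round_down (h (Suc n)) t) \<omega>) else 0)
        \<longlonglongrightarrow> (if \<omega> \<in> good then limit_path \<omega> t else 0)"
      using solution_limit[OF _ t] by auto
  qed
  then show "solution t \<in> measurable M (nborel (Hs \<sigma>) (nrm \<sigma>))"
    unfolding solution_def[abs_def] V.measurable_V_iff .
next
  fix \<omega>
  have "continuous_on {0..T} (\<lambda>t. if \<omega> \<in> good then limit_path \<omega> t else 0)"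
    using limit_path(1) by (cases "\<omega> \<in> good") auto
  then show "continuous_map (top_of_set {0..T}) (ntop (Hs \<sigma>) (nrm \<sigma>)) (\<lambda>t. solution t \<omega>)"
    unfolding solution_def V.continuous_map_V continuous_map_iff_continuous .
qed

abbreviation "E \<equiv> ext_semigroup B A j (Hs (- \<alpha>)) (nrm (- \<alpha>))"

lemma Olim_in_Hs: "\<omega> \<in> space M \<Longrightarrow> t \<in> {0..T} \<Longrightarrow> Olim t \<omega> \<in> Hs \<sigma>"
  using Olim continuous_map_image_subset_topspace unfolding cont_process_on_def by fastforce

lemma mild_integral_iff:
  assumes \<omega>: "\<omega> \<in> space M" and t: "t \<in> {0..T}" and X: "\<And>s. s \<in> {0..T} \<Longrightarrow> X s = V \<sigma> (y s)"
  shows "has_time_integral (Hs \<sigma>) (nrm \<sigma>) t (\<lambda>s. E (t - s) (F (X s))) (X t - Olim t \<omega>) \<longleftrightarrow>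
    mild_eq K f (\<lambda>t. inv (V \<sigma>) (Olim t \<omega>)) y t"
proof -
  have val: "X t - Olim t \<omega> = V \<sigma> (y t - inv (V \<sigma>) (Olim t \<omega>))"
    using X[OF t] Olim_in_Hs[OF \<omega> t] by (simp add: V.V_diff)
  show ?thesis unfolding mild_eq_def val
  proof (rule has_time_integral_V)
    fix s assume s: "0 < s" "s < t"
    then have "s \<in> {0..T}" using t by auto
    then show "E (t - s) (F (X s)) = V \<sigma> (K (t - s) (f (y s)))"
      using s by (simp add: X mild_integrand)
  qed
qed

lemma solution_mild: "mild_solution M T (Hs \<sigma>) (nrm \<sigma>) E F Olim solution"
  unfolding mild_solution_def
proof (intro conjI ballI)
  fix t assume t: "t \<in> {0..T}"
  show "AE \<omega> in M. has_time_integral (Hs \<sigma>) (nrm \<sigma>) t (\<lambda>s. E (t - s) (F (solution s \<omega>))) (solution t \<omega> - Olim t \<omega>)"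
    using AE_good
  proof eventually_elim
    case (elim \<omega>)
    show ?case
      using limit_path(2)[OF elim t]
      by (subst mild_integral_iff[OF good_space[OF elim] t, where y = "limit_path \<omega>"]) (auto simp: solution_def elim)
  qed
qed (rule solution_cont_process)

text \<open>For a countable dense set \<open>D\<close> of times the exceptional sets can be united, and
  \<open>mild_solution_unique\<close> asks for the equations on \<open>D\<close> only.\<close>

lemma mild_solutions_equal:
  assumes Y: "mild_solution M T (Hs \<sigma>) (nrm \<sigma>) E F Olim Y"
  shows "AE \<omega> in M. \<omega> \<in> good \<and> (\<forall>t\<in>{0..T}. solution t \<omega> = Y t \<omega>)"
proof -
  obtain D :: "real set" where D: "countable D" "D \<subseteq> {0..T}" "{0..T} \<subseteq> closure D"
    using separable[of "{0..T}"] by blast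
  have "AE \<omega> in M. \<forall>t\<in>D. has_time_integral (Hs \<sigma>) (nrm \<sigma>) t (\<lambda>s. E (t - s) (F (Y s \<omega>))) (Y t \<omega> - Olim t \<omega>)"
    using Y D unfolding mild_solution_def by (subst AE_ball_countable) auto
  with AE_good show ?thesis
  proof eventually_elim
    case (elim \<omega>)
    note sp = good_space[OF elim(1)]
    define y where "y = (\<lambda>t. inv (V \<sigma>) (Y t \<omega>))"
    have c: "continuous_map (top_of_set {0..T}) (ntop (Hs \<sigma>) (nrm \<sigma>)) (\<lambda>t. Y t \<omega>)"
      using Y sp unfolding mild_solution_def cont_process_on_def by blast
    have Yy: "Y t \<omega> = V \<sigma> (y t)" if "t \<in> {0..T}" for t
      using continuous_map_image_subset_topspace[OF c] that by (auto simp: y_def image_subset_iff)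
    have "continuous_map (top_of_set {0..T}) (ntop (Hs \<sigma>) (nrm \<sigma>)) (\<lambda>t. V \<sigma> (y t))"
      by (rule continuous_map_eq[OF c]) (simp add: Yy)
    then have y_cont: "continuous_on {0..T} y" unfolding V.continuous_map_V by simp
    have "bounded (limit_path \<omega> ` {0..T} \<union> y ` {0..T})"
      by (intro bounded_Un[THEN iffD2] conjI compact_imp_bounded compact_continuous_image limit_path(1)[OF elim(1)] y_cont) auto
    then obtain R where R: "\<And>t. t \<in> {0..T} \<Longrightarrow> norm (limit_path \<omega> t) \<le> R \<and> norm (y t) \<le> R"
      unfolding bounded_iff by blast
    obtain L where L: "\<And>u v. norm u \<le> R \<Longrightarrow> norm v \<le> R \<Longrightarrow> norm (f u - f v) \<le> L * norm (u - v)"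
      using f_locally_lipschitz by blast
    have "limit_path \<omega> t = y t" if t: "t \<in> {0..T}" for t
    proof (rule mild_solution_unique[OF singular_kernel_K limit_path(1)[OF elim(1)] y_cont _ _ D(2,3) _ _ _ t, where L = "\<bar>L\<bar>"])
      show "mild_eq K f (\<lambda>t. inv (V \<sigma>) (Olim t \<omega>)) (limit_path \<omega>) t" if "t \<in> D" for t
        using limit_path(2)[OF elim(1)] D that by auto
      show "mild_eq K f (\<lambda>t. inv (V \<sigma>) (Olim t \<omega>)) y t" if "t \<in> D" for t
      proof -
        have "t \<in> {0..T}" using that D by auto
        from mild_integral_iff[OF sp this, of "\<lambda>t. Y t \<omega>" y] show ?thesis
          using Yy bspec[OF elim(2) that] by blast
      qed
      show "norm (f (limit_path \<omega> s) - f (y s)) \<le> \<bar>L\<bar> * norm (limit_path \<omega> s - y s)" if "s \<in> {0..T}" for s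
        using L[of "limit_path \<omega> s" "y s"] R[OF that] by (meson abs_ge_self mult_right_mono norm_ge_zero order_trans)
    qed (use params in auto)
    then show ?case using elim(1) Yy by (simp add: solution_def)
  qed
qed

lemma solution_approximated:
  assumes \<omega>: "\<omega> \<in> good"
  shows "limsup (\<lambda>n. SUP t\<in>{0..T}. ereal (nrm \<sigma> (solution t \<omega> - Xbb n t \<omega>))) = 0"
proof (rule limsup_SUP_eq_0)
  show "{0..T} \<noteq> {}" using params by simp
  have eq: "nrm \<sigma> (solution t \<omega> - Xbb n t \<omega>) = norm (limit_path \<omega> t - inv (V \<sigma>) (Xbb n t \<omega>))"
    if "1 \<le> n" "t \<in> {0..T}" for n t
  proof -
    have "Xbb n t \<omega> = V \<sigma> (inv (V \<sigma>) (Xbb n t \<omega>))"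
      using Xbb_Obb[OF that good_space[OF \<omega>]] by simp
    then have "solution t \<omega> - Xbb n t \<omega> = V \<sigma> (limit_path \<omega> t - inv (V \<sigma>) (Xbb n t \<omega>))"
      using \<omega> by (simp add: solution_def V.V_diff)
    then show ?thesis by simp
  qed
  show "0 \<le> nrm \<sigma> (solution t \<omega> - Xbb n t \<omega>)" if "1 \<le> n" "t \<in> {0..T}" for n t
    by (simp add: eq[OF that])
  fix e :: real assume "0 < e"
  from uniform_limitD[OF limit_path(3)[OF \<omega>] this]
  have "\<forall>\<^sub>F n in sequentially. \<forall>t\<in>{0..T}. dist (inv (V \<sigma>) (Xbb n t \<omega>)) (limit_path \<omega> t) < e"
    by (subst (asm) eventually_sequentially_Suc)
  with eventually_ge_at_top[of 1]
  show "\<forall>\<^sub>F n in sequentially. \<forall>t\<in>{0..T}. nrm \<sigma> (solution t \<omega> - Xbb n t \<omega>) \<le> e"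
    by eventually_elim (auto simp: eq dist_norm norm_minus_commute less_imp_le)
qed

theorem existence_uniqueness_convergence:
  "(\<exists>X. mild_solution M T (Hs \<sigma>) (nrm \<sigma>) E F Olim X \<and>
        (\<forall>Y. mild_solution M T (Hs \<sigma>) (nrm \<sigma>) E F Olim Y \<longrightarrow> indistinguishable M T X Y)) \<and>
   (\<forall>X. mild_solution M T (Hs \<sigma>) (nrm \<sigma>) E F Olim X \<longrightarrow>
        (\<exists>\<Omega>1\<in>sets M. measure M \<Omega>1 = 1 \<and>
           (\<forall>\<omega>\<in>\<Omega>1. limsup (\<lambda>n. SUP t\<in>{0..T}. ereal (nrm \<sigma> (X t \<omega> - Xbb n t \<omega>))) = 0)))"
proof (intro conjI exI allI impI)
  show "mild_solution M T (Hs \<sigma>) (nrm \<sigma>) E F Olim solution" by (rule solution_mild)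
  fix Y assume "mild_solution M T (Hs \<sigma>) (nrm \<sigma>) E F Olim Y"
  from mild_solutions_equal[OF this] show "indistinguishable M T solution Y"
    unfolding indistinguishable_def by eventually_elim blast
next
  interpret prob_space M by (rule M)
  fix X assume "mild_solution M T (Hs \<sigma>) (nrm \<sigma>) E F Olim X"
  from mild_solutions_equal[OF this] obtain N where N:
    "{\<omega> \<in> space M. \<not> (\<omega> \<in> good \<and> (\<forall>t\<in>{0..T}. solution t \<omega> = X t \<omega>))} \<subseteq> N" "emeasure M N = 0" "N \<in> sets M"
    by (rule AE_E)
  have "measure M (space M - N) = 1"
    using prob_compl[OF N(3)] N(2) by (simp add: measure_def)
  moreover have "limsup (\<lambda>n. SUP t\<in>{0..T}. ereal (nrm \<sigma> (X t \<omega> - Xbb n t \<omega>))) = 0" if "\<omega> \<in> space M - N" for \<omega>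
  proof -
    have \<omega>: "\<omega> \<in> good" "\<forall>t\<in>{0..T}. solution t \<omega> = X t \<omega>" using that N(1) by auto
    have "(\<lambda>n. SUP t\<in>{0..T}. ereal (nrm \<sigma> (X t \<omega> - Xbb n t \<omega>))) = (\<lambda>n. SUP t\<in>{0..T}. ereal (nrm \<sigma> (solution t \<omega> - Xbb n t \<omega>)))"
      using \<omega>(2) by (intro ext SUP_cong) auto
    then show ?thesis using solution_approximated[OF \<omega>(1)] by simp
  qed
  ultimately show "\<exists>\<Omega>1\<in>sets M. measure M \<Omega>1 = 1 \<and>
      (\<forall>\<omega>\<in>\<Omega>1. limsup (\<lambda>n. SUP t\<in>{0..T}. ereal (nrm \<sigma> (X t \<omega> - Xbb n t \<omega>))) = 0)"
    using N(3) by (intro bexI[of _ "space M - N"]) auto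
qed

end

section \<open>Convergence of the truncated Galerkin scheme\<close>

theorem theorem3p2:
  fixes B :: "'h::{real_inner, banach, second_countable_topology} set"
    and \<eta> \<kappa> :: real and lam :: "'h \<Rightarrow> real"
    and A :: "'h \<Rightarrow> 'h" and DA :: "'h set"
    and j :: "'h \<Rightarrow> 'e::real_vector"
    and Hs :: "real \<Rightarrow> 'e set" and nrm :: "real \<Rightarrow> 'e \<Rightarrow> real"
    and T vartheta c \<theta> \<epsilon> \<alpha> varphi \<gamma> \<rho> varrho chi :: real
    and F :: "'e \<Rightarrow> 'e"
    and P :: "nat \<Rightarrow> 'h \<Rightarrow> 'h" and Bn :: "nat \<Rightarrow> 'h set"
    and \<phi> \<Phi> :: "'e \<Rightarrow> real"
    and h :: "nat \<Rightarrow> real"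
    and M :: "'w measure"
    and \<X> \<O> Xbb Obb :: "nat \<Rightarrow> real \<Rightarrow> 'w \<Rightarrow> 'e"
    and Olim :: "real \<Rightarrow> 'w \<Rightarrow> 'e"
    and \<Omega>0 :: "'w set"
  assumes basis: "orthonormal_basis B" "B \<noteq> {}"
    and eta_kappa: "0 \<le> \<eta>" "0 \<le> \<kappa>"
    and lam: "(INF b\<in>B. ereal (lam b)) > ereal (- min \<eta> \<kappa>)"
    and DA: "DA = {v. (\<lambda>b. \<bar>lam b * (b \<bullet> v)\<bar>\<^sup>2) summable_on B}"
    and A: "\<forall>v\<in>DA. A v = (\<Sum>\<^sub>\<infinity>b\<in>B. (- lam b * (b \<bullet> v)) *\<^sub>R b)"
    and Hs: "interpolation_spaces B (shift_op \<kappa> A) j Hs nrm"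
    and params: "0 < T" "0 < vartheta" "0 < c" "0 \<le> \<theta>" "0 \<le> \<epsilon>"
      "0 \<le> \<alpha>" "\<alpha> \<le> 1/2" "0 \<le> varphi" "varphi < 1" "0 < \<gamma>" "\<gamma> < 1"
      "- \<alpha> \<le> \<rho>" "\<rho> < 1 - max \<alpha> \<gamma>" "\<rho> < varrho" "varrho < 1 - max \<alpha> \<gamma>"
      "0 < chi"
      "chi \<le> min ((varrho - \<rho>) / (1 + vartheta)) ((1 - \<alpha> - \<rho>) / (1 + 2 * vartheta))"
    and F_cont: "continuous_map (ntop (Hs varrho) (nrm varrho)) (ntop (Hs (- \<alpha>)) (nrm (- \<alpha>))) F"
    and P: "\<forall>n\<ge>1. bounded_linear (P n) \<and> finite (Bn n) \<and> Bn n \<subseteq> B \<and>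
              (\<forall>u. P n u = (\<Sum>b\<in>Bn n. (b \<bullet> u) *\<^sub>R b))"
    and lam_lim: "liminf (\<lambda>m. Inf ((\<lambda>b. ereal (lam b)) ` (B - Bn m) \<union> {\<infinity>})) = \<infinity>"
    and \<phi>_\<Phi>: "\<forall>w\<in>Hs 1. 0 \<le> \<phi> w \<and> 0 \<le> \<Phi> w"
    and F_H: "\<forall>n\<ge>1. \<forall>v\<in>range (P n). F (j v) \<in> range j"
    and F_growth: "\<forall>n\<ge>1. \<forall>v\<in>range (P n).
          nrm (- \<gamma>) (F (j v)) \<le> c * (2 * \<epsilon> + (norm v)\<^sup>2)"
    and F_coercive: "\<forall>n\<ge>1. \<forall>v\<in>range (P n). \<forall>w\<in>range (P n).
          v \<bullet> P n (inv j (F (j (v + w))))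
            \<le> \<phi> (j w) * (norm v)\<^sup>2 + varphi * (norm (fpow B (shift_op \<eta> A) (1/2) v))\<^sup>2 + \<Phi> (j w)"
    and F_lipschitz: "\<forall>n\<ge>1. \<forall>v\<in>range (P n). \<forall>w\<in>range (P n).
          nrm (- \<alpha>) (F (j v) - F (j w))
            \<le> \<theta> * (1 + nrm \<rho> (j v) powr vartheta + nrm \<rho> (j w) powr vartheta) * nrm \<rho> (j v - j w)"
    and h: "\<forall>n\<ge>1. 0 < h n \<and> h n \<le> T" "limsup (\<lambda>m. ereal (h m)) = 0"
    and M: "prob_space M"
    and \<X>: "\<forall>n\<ge>1. process_on M T (Hs varrho) (nrm varrho) (\<X> n)"
    and \<O>: "\<forall>n\<ge>1. cont_process_on M T (Hs varrho) (nrm varrho) (\<O> n)"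
    and Olim: "cont_process_on M T (Hs varrho) (nrm varrho) Olim"
    and Xbb_Obb: "\<forall>n\<ge>1. \<forall>t\<in>{0..T}. \<forall>\<omega>\<in>space M. Xbb n t \<omega> \<in> Hs varrho \<and> Obb n t \<omega> \<in> Hs varrho"
    and Xbb_eq: "\<forall>n\<ge>1. \<forall>t\<in>{0..T}. \<forall>\<omega>\<in>space M.
          has_time_integral (Hs varrho) (nrm varrho) t
            (\<lambda>s. j (P n (inv j (ext_semigroup B A j (Hs (- \<alpha>)) (nrm (- \<alpha>)) (t - s)
               (of_bool (nrm varrho (\<X> n (round_down (h n) s) \<omega>)
                         + nrm varrho (\<O> n (round_down (h n) s) \<omega>) \<le> \<bar>h n\<bar> powr (- chi))
                 *\<^sub>R F (\<X> n (round_down (h n) s) \<omega>))))))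
            (Xbb n t \<omega> - \<O> n t \<omega>)"
    and \<O>_range: "\<forall>n\<ge>1. \<forall>t\<in>{0..T}. \<forall>\<omega>\<in>space M. \<O> n t \<omega> \<in> j ` range (P n)"
    and Obb_eq: "\<forall>n\<ge>1. \<forall>t\<in>{0..T}. \<forall>\<omega>\<in>space M.
          has_time_integral (Hs varrho) (nrm varrho) t
            (\<lambda>s. j (exp (- \<eta> * (t - s)) *\<^sub>R semigroup_op B A (t - s) (\<eta> *\<^sub>R inv j (\<O> n s \<omega>))))
            (\<O> n t \<omega> - Obb n t \<omega>)"
    and Xbb_\<X>: "\<forall>n\<ge>1. \<forall>t\<in>{0..T}. \<P>(\<omega> in M. Xbb n t \<omega> = \<X> n t \<omega>) = 1"
    and \<Omega>0: "\<Omega>0 \<in> sets M" "measure M \<Omega>0 = 1"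
    and bound: "\<forall>\<omega>\<in>\<Omega>0.
          liminf (\<lambda>m. ereal (LBINT r:{0..T}.
            exp (LBINT u:{r..T}. 2 * \<phi> (Obb m (round_down (h m) u) \<omega>)) *
            (1 + \<bar>\<Phi> (Obb m (round_down (h m) r) \<omega>)\<bar>
               + (LBINT u:{0..T}. nrm varrho (\<O> m u \<omega>) powr (4 + 4 * vartheta))
               + (norm (inv j (Obb m r \<omega>)))\<^sup>2))) < \<infinity>"
    and O_conv: "\<forall>\<omega>\<in>\<Omega>0.
          limsup (\<lambda>m. SUP t\<in>{0..T}. ereal (nrm varrho (Olim t \<omega> - \<O> m t \<omega>))) = 0"
  shows
    "(\<exists>X. mild_solution M T (Hs varrho) (nrm varrho)
          (ext_semigroup B A j (Hs (- \<alpha>)) (nrm (- \<alpha>))) F Olim X \<and>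
        (\<forall>Y. mild_solution M T (Hs varrho) (nrm varrho)
          (ext_semigroup B A j (Hs (- \<alpha>)) (nrm (- \<alpha>))) F Olim Y \<longrightarrow> indistinguishable M T X Y)) \<and>
     (\<forall>X. mild_solution M T (Hs varrho) (nrm varrho)
          (ext_semigroup B A j (Hs (- \<alpha>)) (nrm (- \<alpha>))) F Olim X \<longrightarrow>
        (\<exists>\<Omega>1\<in>sets M. measure M \<Omega>1 = 1 \<and>
           (\<forall>\<omega>\<in>\<Omega>1. limsup (\<lambda>n. SUP t\<in>{0..T}. ereal (nrm varrho (X t \<omega> - Xbb n t \<omega>))) = 0)))"
proof -
  interpret onb B by unfold_locales (rule basis(1))
  (* Since the infimum of the eigenvalues of \<open>- A\<close> is strictly larger than \<open>- min \<eta> \<kappa>\<close>, both \<open>\<kappa> - A\<close> and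
     \<open>\<eta> - A\<close> are bounded below by a common \<open>\<delta> > 0\<close>. *)
  obtain r where r: "ereal (- min \<eta> \<kappa>) < ereal r" "ereal r < (INF b\<in>B. ereal (lam b))"
    using ereal_dense2[OF lam] by blast
  define \<delta> where "\<delta> = r + min \<eta> \<kappa>"
  have \<delta>: "0 < \<delta>" using r(1) by (simp add: \<delta>_def)
  have lam_ge: "\<delta> \<le> \<kappa> + lam b" "\<delta> \<le> \<eta> + lam b" if "b \<in> B" for b
  proof -
    have "r < lam b" using less_INF_D[OF r(2) that] by simp
    then show "\<delta> \<le> \<kappa> + lam b" "\<delta> \<le> \<eta> + lam b" by (auto simp: \<delta>_def)
  qed
  have A_eigen: "b \<bullet> A b = - lam b" if b: "b \<in> B" for b
  proof -
    have "b \<in> DA" unfolding DA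
      by (rule CollectI, rule has_sum_imp_summable, rule has_sum_finite_neutralI[of "{b}"])
        (use b inner_basis in auto)
    then have "A b = (\<Sum>\<^sub>\<infinity>b'\<in>B. (- lam b' * (b' \<bullet> b)) *\<^sub>R b')" using A by blast
    also have "\<dots> = - lam b *\<^sub>R b"
      by (rule infsumI, rule has_sum_finite_neutralI[of "{b}"]) (use b inner_basis in auto)
    finally show ?thesis using inner_basis[OF b b] by simp
  qed
  have h_lim: "h \<longlonglongrightarrow> 0"
  proof (rule tendstoI)
    fix e :: real assume "0 < e"
    then have "\<forall>\<^sub>F m in sequentially. ereal (h m) < ereal e" using h(2) by (intro Limsup_lessD) auto
    then show "\<forall>\<^sub>F m in sequentially. dist (h m) 0 < e"
      using eventually_ge_at_top[of 1]
    proof eventually_elim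
      case (elim m)
      then have "0 < h m" using h(1) by blast
      then show ?case using elim by (simp add: dist_real_def)
    qed
  qed
  have tail: "\<forall>\<^sub>F n in sequentially. \<forall>b\<in>B - Bn n. C \<le> \<kappa> + lam b" for C
  proof -
    have "\<forall>\<^sub>F n in sequentially. ereal (C - \<kappa>) < Inf ((\<lambda>b. ereal (lam b)) ` (B - Bn n) \<union> {\<infinity>})"
      by (rule less_LiminfD) (unfold lam_lim, simp)
    then show ?thesis
    proof eventually_elim
      case (elim n)
      show ?case
      proof
        fix b assume "b \<in> B - Bn n"
        then have "Inf ((\<lambda>b. ereal (lam b)) ` (B - Bn n) \<union> {\<infinity>}) \<le> ereal (lam b)" by (intro Inf_lower) auto
        with elim have "ereal (C - \<kappa>) < ereal (lam b)" by (rule less_le_trans)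
        then show "C \<le> \<kappa> + lam b" by simp
      qed
    qed
  qed
  interpret galerkin_processes B "\<lambda>b. \<kappa> + lam b" \<kappa> \<delta> A j Hs nrm \<eta> T vartheta c \<theta> \<epsilon> \<alpha> varphi \<gamma> \<rho> varrho chi
    F P Bn \<phi> \<Phi> h M \<X> \<O> Xbb Obb Olim \<Omega>0
  proof -
    interpret prob_space M by (rule M)
    have P': "finite (Bn n) \<and> Bn n \<subseteq> B \<and> (\<forall>u. P n u = (\<Sum>b\<in>Bn n. (b \<bullet> u) *\<^sub>R b))" if "1 \<le> n" for n
      using P that by blast
    have mu: "b \<bullet> A b = \<kappa> - (\<kappa> + lam b)" "\<delta> \<le> \<kappa> + lam b - \<kappa> + \<eta>" if "b \<in> B" for b
      using A_eigen[OF that] lam_ge[OF that] by auto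
    note facts = \<delta> lam_ge(1) mu P' eta_kappa Hs params F_cont tail \<phi>_\<Phi>[rule_format] F_H[rule_format]
      F_growth[rule_format] F_coercive[rule_format] F_lipschitz[rule_format] h(1)[rule_format] h_lim
      M \<X>[rule_format] \<O>[rule_format] Olim Xbb_Obb[rule_format] Xbb_eq[rule_format] \<O>_range[rule_format]
      Obb_eq[rule_format] Xbb_\<X>[rule_format] \<Omega>0 bound[rule_format] O_conv[rule_format]
    show "galerkin_processes B (\<lambda>b. \<kappa> + lam b) \<kappa> \<delta> A j Hs nrm \<eta> T vartheta c \<theta> \<epsilon> \<alpha> varphi \<gamma> \<rho> varrho chi
      F P Bn \<phi> \<Phi> h M \<X> \<O> Xbb Obb Olim \<Omega>0"
      by unfold_locales (rule facts; assumption)+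
  qed
  show ?thesis by (rule existence_uniqueness_convergence)
qed

end
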